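(* Let $N\ge 1$, let $p>1$ and let $A:\mathbb{R}^N\to\mathbb{R}^N$ be Lipschitz. Then, for every $u\in W^{1,p}_{A,K}(\mathbb{R}^N)$, $$ \lim_{\delta\searrow 0}\int_{\mathbb{R}^N}\int_{\mathbb{R}^N}\frac{\delta^p}{\|x-y\|_K^{N+p}}\,\mathbf{1}_{\{|\Psi_u(x,y)-\Psi_u(x,x)|_p>\delta\}}\,dx\,dy=\int_{\mathbb{R}^N}\|\nabla u-\mathrm{i}A(x)u\|_{Z_p^*K}^p\,dx . $$
   Context: $K\subset\mathbb{R}^N$ is a convex, symmetric (about the origin) set containing the origin such that $\|x\|_K:=\inf\{\lambda>0: x/\lambda\in K\}$ is a norm on $\mathbb{R}^N$ with unit ball $K$ (so $K$ is a compact convex symmetric set with nonempty interior). $|\cdot|$ is the Euclidean norm on $\mathbb{R}^N$. For $p\ge1$ and $z\in\mathbb{C}^N$, $|z|_p:=\big(|(\Re z_1,\dots,\Re z_N)|^p+|(\Im z_1,\dots,\Im z_N)|^p\big)^{1/p}$; likewise for $z\in\mathbb{C}$, $|z|_p:=(|\Re z|^p+|\Im z|^p)^{1/p}$. For $v\in\mathbb{C}^N$, $x\in\mathbb{R}^N$, $v\cdot x=\sum_j v_jx_j\in\mathbb{C}$, and $$\|v\|_{Z_p^*K}:=\Big(\frac{N+p}{p}\int_K|v\cdot x|_p^p\,dx\Big)^{1/p}.$$ $L^p(\mathbb{R}^N,\mathbb{C})$ is the space of measurable $u:\mathbb{R}^N\to\mathbb{C}$ with $\int_{\mathbb{R}^N}|u|_p^p\,dx<\infty$.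 $W^{1,p}_{A,K}(\mathbb{R}^N)$ is the space of $u\in L^p(\mathbb{R}^N,\mathbb{C})$ (with weak gradient $\nabla u$) such that $\int_{\mathbb{R}^N}\|\nabla u-\mathrm{i}A(x)u\|_{Z_p^*K}^p\,dx<\infty$. For $u:\mathbb{R}^N\to\mathbb{C}$, $\Psi_u(x,y):=e^{\mathrm{i}(x-y)\cdot A\left(\frac{x+y}{2}\right)}u(y)$ for $x,y\in\mathbb{R}^N$ (so $\Psi_u(x,x)=u(x)$). $\mathbf{1}_E$ denotes the indicator function of $E$. *)

theory Defs
  imports "HOL-Analysis.Analysis"
begin

definition is_norm :: "('a::real_vector \<Rightarrow> real) \<Rightarrow> bool" where
  "is_norm f \<longleftrightarrow>
     (\<forall>x. 0 \<le> f x) \<and> (\<forall>x. f x = 0 \<longleftrightarrow> x = 0) \<and>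
     (\<forall>c x. f (c *\<^sub>R x) = \<bar>c\<bar> * f x) \<and> (\<forall>x y. f (x + y) \<le> f x + f y)"

(* The infimum is real valued and hence unspecified when no dilate of K contains x; this cannot
   happen under norm_body K below. *)
definition gauge_norm :: "(real^'n) set \<Rightarrow> real^'n \<Rightarrow> real" where
  "gauge_norm K x = Inf {l. 0 < l \<and> (1 / l) *\<^sub>R x \<in> K}"

definition norm_body :: "(real^'n) set \<Rightarrow> bool" where
  "norm_body K \<longleftrightarrow>
     convex K \<and> (\<forall>x\<in>K. - x \<in> K) \<and> 0 \<in> K \<and>
     is_norm (gauge_norm K) \<and> {x. gauge_norm K x \<le> 1} = K"

definition cmod_p :: "real \<Rightarrow> complex \<Rightarrow> real" where
  "cmod_p p z = (\<bar>Re z\<bar> powr p + \<bar>Im z\<bar> powr p) powr (1 / p)"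

definition cdot :: "complex^'n \<Rightarrow> real^'n \<Rightarrow> complex" where
  "cdot v x = (\<Sum>j\<in>UNIV. v $ j * complex_of_real (x $ j))"

definition polar_moment_norm :: "real \<Rightarrow> (real^'n) set \<Rightarrow> complex^'n \<Rightarrow> real" where
  "polar_moment_norm p K v =
     ((real CARD('n) + p) / p * (LINT x:K|lebesgue. cmod_p p (cdot v x) powr p)) powr (1 / p)"

definition Lp_space :: "real \<Rightarrow> (real^'n \<Rightarrow> complex) set" where
  "Lp_space p = {u \<in> borel_measurable lebesgue.
     (\<integral>\<^sup>+ x. ennreal (cmod_p p (u x) powr p) \<partial>lebesgue) < \<infinity>}"

definition partial_deriv :: "'n \<Rightarrow> (real^'n \<Rightarrow> real) \<Rightarrow> real^'n \<Rightarrow> real" where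
  "partial_deriv j f x = frechet_derivative f (at x) (axis j 1)"

(* Real-valued C-infinity functions with compact support. Requiring every iterated partial
   derivative to be differentiable everywhere also makes all of them continuous. *)
definition test_function :: "(real^'n \<Rightarrow> real) \<Rightarrow> bool" where
  "test_function \<phi> \<longleftrightarrow>
     (\<forall>js x. fold partial_deriv js \<phi> differentiable (at x)) \<and>
     compact (closure {x. \<phi> x \<noteq> 0})"

definition locally_integrable :: "(real^'n \<Rightarrow> 'b::euclidean_space) \<Rightarrow> bool" where
  "locally_integrable f \<longleftrightarrow> (\<forall>C. compact C \<longrightarrow> set_integrable lebesgue C f)"

(* A relation rather than a function, as weak gradients are unique only almost everywhere. *)
definition has_weak_gradient :: "(real^'n \<Rightarrow> complex) \<Rightarrow> (real^'n \<Rightarrow> complex^'n) \<Rightarrow> bool" where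
  "has_weak_gradient u g \<longleftrightarrow>
     locally_integrable u \<and> locally_integrable g \<and>
     (\<forall>\<phi> j. test_function \<phi> \<longrightarrow>
        (LINT x|lebesgue. u x * complex_of_real (partial_deriv j \<phi> x)) =
        - (LINT x|lebesgue. g x $ j * complex_of_real (\<phi> x)))"

definition magnetic_gradient ::
    "(real^'n \<Rightarrow> real^'n) \<Rightarrow> (real^'n \<Rightarrow> complex) \<Rightarrow> (real^'n \<Rightarrow> complex^'n) \<Rightarrow> real^'n \<Rightarrow> complex^'n" where
  "magnetic_gradient A u g x = g x - (\<chi> j. \<i> * complex_of_real (A x $ j) * u x)"

definition magnetic_energy ::
    "real \<Rightarrow> (real^'n \<Rightarrow> real^'n) \<Rightarrow> (real^'n) set \<Rightarrow> (real^'n \<Rightarrow> complex) \<Rightarrow> (real^'n \<Rightarrow> complex^'n)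
      \<Rightarrow> ennreal" where
  "magnetic_energy p A K u g =
     (\<integral>\<^sup>+ x. ennreal (polar_moment_norm p K (magnetic_gradient A u g x) powr p) \<partial>lebesgue)"

definition magnetic_sobolev ::
    "real \<Rightarrow> (real^'n \<Rightarrow> real^'n) \<Rightarrow> (real^'n) set \<Rightarrow> (real^'n \<Rightarrow> complex) set" where
  "magnetic_sobolev p A K =
     {u \<in> Lp_space p. \<exists>g. has_weak_gradient u g \<and> magnetic_energy p A K u g < \<infinity>}"

definition magnetic_shift ::
    "(real^'n \<Rightarrow> real^'n) \<Rightarrow> (real^'n \<Rightarrow> complex) \<Rightarrow> real^'n \<Rightarrow> real^'n \<Rightarrow> complex" where
  "magnetic_shift A u x y = exp (\<i> * complex_of_real ((x - y) \<bullet> A (midpoint x y))) * u y"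

end

theory Submission
  imports Defs
begin

text \<open>
  Substituting \<open>y = x + \<delta> w\<close> turns the double integral into
  \<open>\<integral>\<integral> N w powr (- (n + p)) * 1 {|D (x, \<delta> w)| > \<delta>} dx dw\<close>, where \<open>N\<close> is the norm of \<open>K\<close> and
  \<open>D (x, h) = \<Psi>(x, x + h) - \<Psi>(x, x)\<close>.  Integrating the weak gradient along the segment from \<open>x\<close> to
  \<open>x + h\<close> with the constant phase \<open>h \<bullet> A (x + h/2)\<close> expresses \<open>D (x, h)\<close> as an average of the magnetic
  derivative plus an error \<open>O(|h|^2 |u|)\<close>.  Hence \<open>D (x, \<delta> w) / \<delta>\<close> converges almost everywhere by
  one-dimensional Lebesgue differentiation in direction \<open>w\<close>.  For \<open>\<delta> N w \<le> 1\<close> the integrand is dominated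
  through the weak type (1,1) bound for the directional maximal function: after truncation, homogeneity
  in \<open>w\<close> bounds the dominating integral by the energy and the \<open>L^p\<close> norm of \<open>u\<close>; this is where \<open>p > 1\<close> enters.  The
  part \<open>\<delta> N w > 1\<close> is controlled by \<open>\<delta> powr p\<close> times the measure of \<open>{|u| > \<delta>/4}\<close> and vanishes in the limit.
\<close>

section \<open>Directional maximal function and Lebesgue differentiation\<close>

text \<open>Dominated convergence needs one majorant for all \<open>\<delta>\<close> at once. For
  fixed w it is the indicator of the set where some segment average of m exceeds a fixed level; m is
  the modulus of the magnetic derivative in direction w plus an error proportional to |w| |u|. The
  plain weak type bound would leave the integral of N w powr (-(n + p)) * m x w over w, which
  diverges at w = 0 since m has degree 1. Truncating to {m > 1/4} keeps each ray away from 0, and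
  the remaining radial integral of s^(-p) at infinity converges because p > 1. The cut
  \<open>\<delta>\<close> N w \<le> 1 comes from the error L |h|^2 |u|: it is linear in h, up to a
  constant, only while |h| is bounded. Fixing w makes all averages one-dimensional, and taking
  \<open>\<delta>\<close> along a sequence keeps suprema and exceptional sets countable. The phase h
  . A (x + h/2) varies with x, so the null set in the difference formula must not depend on the
  phase. The constant (n + p)/p arises as n + p from writing the power of N as an integral, times
  1/p from integrating s^(-p-1).\<close>

lemma nn_integral_shift:
  fixes f :: "'a::euclidean_space \<Rightarrow> ennreal"
  assumes [measurable]: "f \<in> borel_measurable borel"
  shows "(\<integral>\<^sup>+x. f (x + a) \<partial>lborel) = (\<integral>\<^sup>+x. f x \<partial>lborel)"
proof -
  have "(\<integral>\<^sup>+x. f x \<partial>lborel) = (\<integral>\<^sup>+x. f x \<partial>distr lborel borel ((+) a))"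
    by (simp add: lborel_distr_plus)
  also have "\<dots> = (\<integral>\<^sup>+x. f (x + a) \<partial>lborel)"
    by (subst nn_integral_distr) (auto simp: add.commute)
  finally show ?thesis by simp
qed

lemma integral_shift:
  fixes f :: "'a::euclidean_space \<Rightarrow> 'b::{banach, second_countable_topology}"
  assumes [measurable]: "f \<in> borel_measurable borel"
  shows "(LINT x|lborel. f (x + a)) = (LINT x|lborel. f x)"
proof -
  have "(LINT x|lborel. f x) = (LINT x|distr lborel borel ((+) a). f x)"
    by (simp add: lborel_distr_plus)
  also have "\<dots> = (LINT x|lborel. f (x + a))"
    by (subst integral_distr) (auto simp: add.commute)
  finally show ?thesis by simp
qed

lemma integrable_shift:
  fixes f :: "'a::euclidean_space \<Rightarrow> 'b::{banach, second_countable_topology}"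
  assumes "integrable lborel f"
  shows "integrable lborel (\<lambda>x. f (x + a))"
proof -
  have "integrable (distr lborel borel ((+) a)) f"
    using assms by (simp add: lborel_distr_plus)
  then show ?thesis
    using assms by (subst (asm) integrable_distr_eq) (auto simp: add.commute)
qed

text \<open>Vitali covering: each bad point r carries a ball of radius \<open>\<rho> r\<close> with
  mass at least l * \<open>\<rho> r\<close>, and T bounds the radii. A disjoint countable subfamily,
  enlarged five times, covers the bad set; an interval of radius 5 \<rho> has length 10 \<rho>,
  hence the constant 10.\<close>

lemma weak_type_real:
  fixes f :: "real \<Rightarrow> ennreal" and t :: "nat \<Rightarrow> real" and T l :: real
  assumes [measurable]: "f \<in> borel_measurable borel"
    and t: "\<And>k. 0 < t k" "\<And>k. t k \<le> T"
  shows "ennreal l * emeasure lborel {r. \<exists>k. ennreal l < (\<integral>\<^sup>+s\<in>{0..1}. f (r + s * t k) \<partial>lborel)}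
    \<le> 10 * (\<integral>\<^sup>+r. f r \<partial>lborel)"
proof -
  define E where "E = {r. \<exists>k. ennreal l < (\<integral>\<^sup>+s\<in>{0..1}. f (r + s * t k) \<partial>lborel)}"
  have [measurable]: "E \<in> sets borel"
    unfolding E_def by measurable
  have "\<forall>r. \<exists>k. r \<in> E \<longrightarrow> ennreal l < (\<integral>\<^sup>+s\<in>{0..1}. f (r + s * t k) \<partial>lborel)"
    by (auto simp: E_def)
  then obtain k where k: "\<And>r. r \<in> E \<Longrightarrow> ennreal l < (\<integral>\<^sup>+s\<in>{0..1}. f (r + s * t (k r)) \<partial>lborel)"
    by metis
  define \<rho> where "\<rho> r = t (k r)" for r
  have \<rho>: "0 < \<rho> r" "\<rho> r \<le> T" for r
    using t by (auto simp: \<rho>_def)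
  \<comment> \<open>After rescaling, the one-sided average over s in [0, 1] is 1/\<rho> times the
    integral over [r, r + \<rho>], and this interval lies in the ball centred at r.\<close>
  have mass: "ennreal l * ennreal (\<rho> r) \<le> (\<integral>\<^sup>+x\<in>cball r (\<rho> r). f x \<partial>lborel)" if "r \<in> E" for r
  proof -
    have "(\<integral>\<^sup>+x\<in>{r..r + \<rho> r}. f x \<partial>lborel)
        = ennreal \<bar>\<rho> r\<bar> * (\<integral>\<^sup>+s. f (r + \<rho> r * s) * indicator {r..r + \<rho> r} (r + \<rho> r * s) \<partial>lborel)"
      using \<rho>[of r] by (intro nn_integral_real_affine) auto
    also have "(\<integral>\<^sup>+s. f (r + \<rho> r * s) * indicator {r..r + \<rho> r} (r + \<rho> r * s) \<partial>lborel)
        = (\<integral>\<^sup>+s\<in>{0..1}. f (r + s * t (k r)) \<partial>lborel)"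
      using \<rho>[of r]
      by (intro nn_integral_cong) (auto simp: indicator_def \<rho>_def mult.commute zero_le_mult_iff)
    finally have "ennreal (\<rho> r) * ennreal l \<le> (\<integral>\<^sup>+x\<in>{r..r + \<rho> r}. f x \<partial>lborel)"
      using k[OF that] \<rho>(1)[of r] by (simp add: mult_left_mono)
    also have "\<dots> \<le> (\<integral>\<^sup>+x\<in>cball r (\<rho> r). f x \<partial>lborel)"
      by (intro nn_integral_mono) (auto simp: indicator_def dist_real_def)
    finally show ?thesis by (simp add: mult.commute)
  qed
  have "E \<subseteq> (\<Union>i\<in>E. cball i (\<rho> i))"
  proof
    fix r assume "r \<in> E"
    moreover have "r \<in> cball r (\<rho> r)" using \<rho>(1)[of r] by simp
    ultimately show "r \<in> (\<Union>i\<in>E. cball i (\<rho> i))" by blast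
  qed
  then obtain C where C: "countable C" "C \<subseteq> E"
     "pairwise (\<lambda>i j. disjnt (cball i (\<rho> i)) (cball j (\<rho> j))) C"
     "E \<subseteq> (\<Union>i\<in>C. cball i (5 * \<rho> i))"
    by (rule Vitali_covering_lemma_cballs[of E "\<lambda>i. i" \<rho> E T]) (use \<rho> in blast)+
  have "emeasure lborel E = (\<integral>\<^sup>+x. indicator E x \<partial>lborel)"
    by simp
  \<comment> \<open>The sum over the countable family is written as an integral over
    \<open>count_space C\<close>, so that it can be exchanged with the integral in x.\<close>
  also have "\<dots> \<le> (\<integral>\<^sup>+x. (\<integral>\<^sup>+i. indicator (cball i (5 * \<rho> i)) x \<partial>count_space C) \<partial>lborel)"
  proof (rule nn_integral_mono)
    fix x :: real
    show "(indicator E x::ennreal) \<le> (\<integral>\<^sup>+i. indicator (cball i (5 * \<rho> i)) x \<partial>count_space C)"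
    proof (cases "x \<in> E")
      case True
      then obtain i where i: "i \<in> C" "x \<in> cball i (5 * \<rho> i)" using C(4) by auto
      have "indicator E x \<le> (indicator (cball i (5 * \<rho> i)) x :: ennreal)"
        using i by (auto simp: indicator_def)
      also have "\<dots> \<le> (\<integral>\<^sup>+i. indicator (cball i (5 * \<rho> i)) x \<partial>count_space C)"
        using i(1) by (rule nn_integral_ge_point)
      finally show ?thesis .
    qed auto
  qed
  also have "\<dots> = (\<integral>\<^sup>+i. (\<integral>\<^sup>+x. indicator (cball i (5 * \<rho> i)) x \<partial>lborel) \<partial>count_space C)"
    using C(1) by (rule nn_integral_count_space_nn_integral) (simp add: borel_measurable_indicator)
  also have "\<dots> = (\<integral>\<^sup>+i. 10 * ennreal (\<rho> i) \<partial>count_space C)"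
    using \<rho> by (intro nn_integral_cong)
      (auto simp: cball_eq_atLeastAtMost less_imp_le ennreal_mult[symmetric] simp flip: ennreal_numeral)
  finally have "ennreal l * emeasure lborel E \<le> ennreal l * (\<integral>\<^sup>+i. 10 * ennreal (\<rho> i) \<partial>count_space C)"
    by (rule mult_left_mono) simp
  also have "\<dots> = 10 * (\<integral>\<^sup>+i. ennreal l * ennreal (\<rho> i) \<partial>count_space C)"
    by (simp add: nn_integral_cmult mult.left_commute)
  also have "\<dots> \<le> 10 * (\<integral>\<^sup>+i. (\<integral>\<^sup>+x\<in>cball i (\<rho> i). f x \<partial>lborel) \<partial>count_space C)"
    using mass C(2) by (intro mult_left_mono nn_integral_mono) auto
  \<comment> \<open>For the measure with density f, disjointness turns the sum of the masses of the
    balls into the mass of their union, which is at most the total mass.\<close>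
  also have "(\<integral>\<^sup>+i. (\<integral>\<^sup>+x\<in>cball i (\<rho> i). f x \<partial>lborel) \<partial>count_space C)
      = (\<integral>\<^sup>+i. emeasure (density lborel f) (cball i (\<rho> i)) \<partial>count_space C)"
    by (intro nn_integral_cong) (simp add: emeasure_density)
  also have "\<dots> = emeasure (density lborel f) (\<Union>i\<in>C. cball i (\<rho> i))"
    using C by (intro emeasure_UN_countable[symmetric])
      (auto simp: disjoint_family_on_def pairwise_def disjnt_def)
  also have "\<dots> \<le> emeasure (density lborel f) (space (density lborel f))"
    by (rule emeasure_space)
  also have "\<dots> = (\<integral>\<^sup>+r. f r \<partial>lborel)"
    by (simp add: emeasure_density)
  finally show ?thesis
    unfolding E_def by (simp add: mult_left_mono)
qed

text \<open>Transference: averaging over the translates \<open>x + r w\<close> with \<open>0 \<le> r \<le> T\<close> reduces to the real line.\<close>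

lemma weak_type_directional:
  fixes f :: "'a::euclidean_space \<Rightarrow> ennreal" and w :: 'a and t :: "nat \<Rightarrow> real" and T l :: real
  assumes [measurable]: "f \<in> borel_measurable borel"
    and t: "\<And>k. 0 < t k" "\<And>k. t k \<le> T"
  shows "ennreal l * emeasure lborel {x. \<exists>k. ennreal l < (\<integral>\<^sup>+s\<in>{0..1}. f (x + (s * t k) *\<^sub>R w) \<partial>lborel)}
    \<le> 20 * (\<integral>\<^sup>+x. f x \<partial>lborel)"
proof -
  have T: "0 < T" using t[of 0] by simp
  define E where "E = {x. \<exists>k. ennreal l < (\<integral>\<^sup>+s\<in>{0..1}. f (x + (s * t k) *\<^sub>R w) \<partial>lborel)}"
  have [measurable]: "E \<in> sets borel"
    unfolding E_def by measurable
  have line: "ennreal l * (\<integral>\<^sup>+r\<in>{0..T}. indicator E (x + r *\<^sub>R w) \<partial>lborel)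
      \<le> 10 * (\<integral>\<^sup>+r\<in>{0..2*T}. f (x + r *\<^sub>R w) \<partial>lborel)" for x
  proof -
    \<comment> \<open>Cutting f off outside [0, 2T] along the line does not change the averages
      concerned: for r in [0, T] the points r + s * \<open>t k\<close> stay in [0, 2T]. The ratio of
      the lengths 2T and T turns 10 into 20.\<close>
    define \<phi> where "\<phi> r = f (x + r *\<^sub>R w) * indicator {0..2*T} r" for r :: real
    have [measurable]: "\<phi> \<in> borel_measurable borel"
      unfolding \<phi>_def by measurable
    have "(\<integral>\<^sup>+r\<in>{0..T}. indicator E (x + r *\<^sub>R w) \<partial>lborel)
        = emeasure lborel {r\<in>{0..T}. x + r *\<^sub>R w \<in> E}"
    proof -
      have "(\<integral>\<^sup>+r\<in>{0..T}. indicator E (x + r *\<^sub>R w) \<partial>lborel)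
          = (\<integral>\<^sup>+r. indicator {r\<in>{0..T}. x + r *\<^sub>R w \<in> E} r \<partial>lborel)"
        by (intro nn_integral_cong) (auto simp: indicator_def)
      also have "\<dots> = emeasure lborel {r\<in>{0..T}. x + r *\<^sub>R w \<in> E}"
        by (rule nn_integral_indicator) measurable
      finally show ?thesis .
    qed
    also have "\<dots> \<le> emeasure lborel {r. \<exists>k. ennreal l < (\<integral>\<^sup>+s\<in>{0..1}. \<phi> (r + s * t k) \<partial>lborel)}"
    proof (rule emeasure_mono)
      show "{r\<in>{0..T}. x + r *\<^sub>R w \<in> E} \<subseteq> {r. \<exists>k. ennreal l < (\<integral>\<^sup>+s\<in>{0..1}. \<phi> (r + s * t k) \<partial>lborel)}"
      proof safe
        fix r assume r: "r \<in> {0..T}" "x + r *\<^sub>R w \<in> E"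
        then obtain k where k: "ennreal l < (\<integral>\<^sup>+s\<in>{0..1}. f (x + r *\<^sub>R w + (s * t k) *\<^sub>R w) \<partial>lborel)"
          by (auto simp: E_def)
        also have "\<dots> = (\<integral>\<^sup>+s\<in>{0..1}. \<phi> (r + s * t k) \<partial>lborel)"
        proof (intro nn_integral_cong)
          fix s :: real
          have "0 \<le> r + s * t k \<and> r + s * t k \<le> 2 * T" if "0 \<le> s" "s \<le> 1"
            using r(1) that t[of k] mult_mono[of s 1 "t k" T] by auto
          then show "f (x + r *\<^sub>R w + (s * t k) *\<^sub>R w) * indicator {0..1} s = \<phi> (r + s * t k) * indicator {0..1} s"
            by (auto simp: \<phi>_def indicator_def algebra_simps)
        qed
        finally show "\<exists>k. ennreal l < (\<integral>\<^sup>+s\<in>{0..1}. \<phi> (r + s * t k) \<partial>lborel)" by blast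
      qed
    qed measurable
    finally have "ennreal l * (\<integral>\<^sup>+r\<in>{0..T}. indicator E (x + r *\<^sub>R w) \<partial>lborel)
        \<le> ennreal l * emeasure lborel {r. \<exists>k. ennreal l < (\<integral>\<^sup>+s\<in>{0..1}. \<phi> (r + s * t k) \<partial>lborel)}"
      by (rule mult_left_mono) simp
    also have "\<dots> \<le> 10 * (\<integral>\<^sup>+r. \<phi> r \<partial>lborel)"
      by (rule weak_type_real[OF _ t]) measurable
    finally show ?thesis by (simp add: \<phi>_def)
  qed
  \<comment> \<open>E is averaged over its translates by r w with r in [0, T]. All translates have
    the same measure, so a factor T appears, and it cancels at the end.\<close>
  have "ennreal T * (ennreal l * emeasure lborel E) = ennreal l * (\<integral>\<^sup>+r\<in>{0..T}. emeasure lborel E \<partial>lborel)"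
    using T by (simp add: nn_integral_cmult mult_ac)
  also have "\<dots> = ennreal l * (\<integral>\<^sup>+r\<in>{0..T}. (\<integral>\<^sup>+x. indicator E (x + r *\<^sub>R w) \<partial>lborel) \<partial>lborel)"
    by (subst nn_integral_shift) auto
  also have "\<dots> = ennreal l * (\<integral>\<^sup>+r. (\<integral>\<^sup>+x. indicator E (x + r *\<^sub>R w) * indicator {0..T} r \<partial>lborel) \<partial>lborel)"
    by (simp add: nn_integral_multc)
  also have "\<dots> = ennreal l * (\<integral>\<^sup>+x. (\<integral>\<^sup>+r\<in>{0..T}. indicator E (x + r *\<^sub>R w) \<partial>lborel) \<partial>lborel)"
    by (subst lborel_pair.Fubini') auto
  also have "\<dots> = (\<integral>\<^sup>+x. ennreal l * (\<integral>\<^sup>+r\<in>{0..T}. indicator E (x + r *\<^sub>R w) \<partial>lborel) \<partial>lborel)"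
    by (simp add: nn_integral_cmult)
  also have "\<dots> \<le> (\<integral>\<^sup>+x. 10 * (\<integral>\<^sup>+r\<in>{0..2*T}. f (x + r *\<^sub>R w) \<partial>lborel) \<partial>lborel)"
    by (intro nn_integral_mono line)
  also have "\<dots> = 10 * (\<integral>\<^sup>+x. (\<integral>\<^sup>+r\<in>{0..2*T}. f (x + r *\<^sub>R w) \<partial>lborel) \<partial>lborel)"
    by (simp add: nn_integral_cmult)
  also have "\<dots> = 10 * (\<integral>\<^sup>+r. (\<integral>\<^sup>+x. f (x + r *\<^sub>R w) * indicator {0..2*T} r \<partial>lborel) \<partial>lborel)"
    by (subst lborel_pair.Fubini') auto
  also have "\<dots> = 10 * (\<integral>\<^sup>+r. (\<integral>\<^sup>+x. f x \<partial>lborel) * indicator {0..2*T} r \<partial>lborel)"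
    by (simp add: nn_integral_multc nn_integral_shift)
  also have "\<dots> = ennreal T * (20 * (\<integral>\<^sup>+x. f x \<partial>lborel))"
    using T by (simp add: nn_integral_cmult ennreal_mult mult_ac)
  finally have "ennreal T * (ennreal l * emeasure lborel E) \<le> ennreal T * (20 * (\<integral>\<^sup>+x. f x \<partial>lborel))" .
  then show ?thesis
    using T unfolding E_def by (simp add: ennreal_mult_le_mult_iff)
qed

text \<open>Let f1 be f where f exceeds l, and 0 elsewhere. Then f \<le> f1 + l, and the constant
  adds l to an average over a segment, so an f-average above 2 l forces an f1-average above l. Only
  f1 enters the bound.\<close>

lemma weak_type_truncated:
  fixes f :: "'a::euclidean_space \<Rightarrow> ennreal" and w :: 'a and t :: "nat \<Rightarrow> real" and T l :: real
  assumes [measurable]: "f \<in> borel_measurable borel"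
    and t: "\<And>k. 0 < t k" "\<And>k. t k \<le> T" and l: "0 < l"
  shows "ennreal l * emeasure lborel {x. \<exists>k. ennreal (2 * l) < (\<integral>\<^sup>+s\<in>{0..1}. f (x + (s * t k) *\<^sub>R w) \<partial>lborel)}
    \<le> 20 * (\<integral>\<^sup>+x. f x * indicator {x. ennreal l < f x} x \<partial>lborel)"
proof -
  define f1 where "f1 x = f x * indicator {x. ennreal l < f x} x" for x
  have [measurable]: "f1 \<in> borel_measurable borel"
    unfolding f1_def by measurable
  have split: "f x \<le> f1 x + ennreal l" for x
    by (auto simp: f1_def indicator_def not_less)
  have "emeasure lborel {x. \<exists>k. ennreal (2 * l) < (\<integral>\<^sup>+s\<in>{0..1}. f (x + (s * t k) *\<^sub>R w) \<partial>lborel)}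
      \<le> emeasure lborel {x. \<exists>k. ennreal l < (\<integral>\<^sup>+s\<in>{0..1}. f1 (x + (s * t k) *\<^sub>R w) \<partial>lborel)}"
  proof (rule emeasure_mono, safe)
    fix x k assume "ennreal (2 * l) < (\<integral>\<^sup>+s\<in>{0..1}. f (x + (s * t k) *\<^sub>R w) \<partial>lborel)"
    also have "\<dots> \<le> (\<integral>\<^sup>+s. f1 (x + (s * t k) *\<^sub>R w) * indicator {0..1} s + ennreal l * indicator {0..1} s \<partial>lborel)"
      using split by (intro nn_integral_mono) (auto simp: indicator_def)
    also have "\<dots> = (\<integral>\<^sup>+s\<in>{0..1}. f1 (x + (s * t k) *\<^sub>R w) \<partial>lborel) + ennreal l"
      by (simp add: nn_integral_add nn_integral_cmult)
    finally have "ennreal l + ennreal l < (\<integral>\<^sup>+s\<in>{0..1}. f1 (x + (s * t k) *\<^sub>R w) \<partial>lborel) + ennreal l"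
      using l by (simp flip: ennreal_plus)
    then have "ennreal l < (\<integral>\<^sup>+s\<in>{0..1}. f1 (x + (s * t k) *\<^sub>R w) \<partial>lborel)"
      by (meson add_right_mono leD leI)
    then show "\<exists>k. ennreal l < (\<integral>\<^sup>+s\<in>{0..1}. f1 (x + (s * t k) *\<^sub>R w) \<partial>lborel)" by blast
  qed measurable
  then have "ennreal l * emeasure lborel {x. \<exists>k. ennreal (2 * l) < (\<integral>\<^sup>+s\<in>{0..1}. f (x + (s * t k) *\<^sub>R w) \<partial>lborel)}
      \<le> ennreal l * emeasure lborel {x. \<exists>k. ennreal l < (\<integral>\<^sup>+s\<in>{0..1}. f1 (x + (s * t k) *\<^sub>R w) \<partial>lborel)}"
    by (rule mult_left_mono) simp
  also have "\<dots> \<le> 20 * (\<integral>\<^sup>+x. f1 x \<partial>lborel)"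
    by (rule weak_type_directional[OF _ t]) measurable
  finally show ?thesis by (simp add: f1_def)
qed

text \<open>A measurable function is an almost everywhere limit of continuous functions; truncating
  these in height and in space makes dominated convergence applicable. Two limits are taken: first
  in the truncation level, then, with this level frozen, in the index of the continuous
  functions.\<close>

lemma continuous_L1_approximation:
  fixes f :: "'a::euclidean_space \<Rightarrow> 'b::euclidean_space"
  assumes f: "integrable lborel f" and e: "0 < e"
  obtains g where "continuous_on UNIV g" "(\<integral>\<^sup>+x. ennreal (norm (f x - g x)) \<partial>lborel) < ennreal e"
proof -
  have [measurable]: "f \<in> borel_measurable borel" using f by auto
  have "f measurable_on UNIV"
    by (intro lebesgue_measurable_imp_measurable_on measurable_completion) auto
  then obtain Z g where Z: "negligible Z" and g: "\<And>n. continuous_on UNIV (g n)"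
    and lim: "\<And>x. x \<notin> Z \<Longrightarrow> (\<lambda>n. g n x) \<longlonglongrightarrow> f x"
    by (auto simp: measurable_on_def)
  have lim: "AE x in lborel. (\<lambda>n. g n x) \<longlonglongrightarrow> f x"
    using Z lim AE_not_in[of Z lebesgue] by (auto simp: negligible_iff_null_sets AE_completion_iff elim!: eventually_mono)
  \<comment> \<open>\<open>r M\<close> retracts the target onto the ball of radius M and fixes that
    ball; \<open>\<eta> M\<close> is a continuous cutoff, equal to 1 for |x| \<le> M and to 0 for
    |x| \<ge> M + 1.\<close>
  define r where "r M y = (M / max M (norm y)) *\<^sub>R y" for M and y :: 'b
  define \<eta> where "\<eta> M x = max 0 (min 1 (M + 1 - norm x))" for M and x :: 'a
  have r_cont: "continuous_on UNIV (r M)" if "0 < M" for M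
    unfolding r_def using that by (intro continuous_intros) auto
  have r_le: "norm (r M y) \<le> M" "norm (r M y) \<le> norm y" if "0 < M" for M y
  proof -
    have 1: "norm (r M y) = M / max M (norm y) * norm y" using that by (simp add: r_def)
    show "norm (r M y) \<le> M" using that unfolding 1 by (simp add: pos_divide_le_eq mult_left_mono)
    show "norm (r M y) \<le> norm y" using that unfolding 1 by (intro mult_left_le_one_le) auto
  qed
  have r_eq: "r M y = y" if "0 < M" "norm y \<le> M" for M y
    using that by (simp add: r_def max_absorb1)
  have \<eta>_cont: "continuous_on UNIV (\<eta> M)" for M
    unfolding \<eta>_def by (intro continuous_intros)
  have [measurable]: "r (real (Suc M)) \<in> borel_measurable borel" "\<eta> M' \<in> borel_measurable borel"
      "g n \<in> borel_measurable borel" for M M' n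
    using r_cont \<eta>_cont g by (auto intro!: borel_measurable_continuous_onI)
  define F where "F M x = \<eta> (real (Suc M)) x *\<^sub>R r (real (Suc M)) (f x)" for M x
  have "(\<lambda>M. \<integral>\<^sup>+x. norm (f x - F M x) \<partial>lborel) \<longlonglongrightarrow> 0"
  proof (rule nn_integral_dominated_convergence_norm[where w="\<lambda>x. norm (f x)"])
    show "AE x in lborel. norm (F j x) \<le> norm (f x)" for j
    proof (rule AE_I2)
      fix x
      have "norm (F j x) = \<eta> (real (Suc j)) x * norm (r (real (Suc j)) (f x))"
        by (simp add: F_def \<eta>_def)
      also have "\<dots> \<le> 1 * norm (f x)"
        by (intro mult_mono r_le) (auto simp: \<eta>_def)
      finally show "norm (F j x) \<le> norm (f x)" by simp
    qed
    show "(\<integral>\<^sup>+x. ennreal (norm (f x)) \<partial>lborel) < \<infinity>"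
      using f by (simp add: integrable_iff_bounded)
    show "AE x in lborel. (\<lambda>i. F i x) \<longlonglongrightarrow> f x"
    proof (rule AE_I2)
      fix x
      obtain m :: nat where m: "norm x + norm (f x) \<le> real m" using real_arch_simple by blast
      have "F i x = f x" if "m \<le> i" for i
      proof -
        have *: "norm x + norm (f x) \<le> real i" using m that by linarith
        have "\<eta> (real (Suc i)) x = 1" using * norm_ge_zero[of "f x"] unfolding \<eta>_def by linarith
        moreover have "r (real (Suc i)) (f x) = f x"
          using * by (intro r_eq) (simp, smt (verit) norm_ge_zero of_nat_Suc)
        ultimately show ?thesis by (simp add: F_def)
      qed
      then show "(\<lambda>i. F i x) \<longlonglongrightarrow> f x"
        by (intro tendsto_eventually) (auto simp: eventually_sequentially)
    qed
  qed (simp_all add: F_def del: of_nat_Suc)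
  then have "eventually (\<lambda>M. (\<integral>\<^sup>+x. norm (f x - F M x) \<partial>lborel) < ennreal (e / 2)) sequentially"
    using e by (intro order_tendstoD) auto
  then obtain M where M: "(\<integral>\<^sup>+x. norm (f x - F M x) \<partial>lborel) < ennreal (e / 2)"
    by (auto simp: eventually_sequentially)
  define G where "G n x = \<eta> (real (Suc M)) x *\<^sub>R r (real (Suc M)) (g n x)" for n x
  have "(\<lambda>n. \<integral>\<^sup>+x. norm (F M x - G n x) \<partial>lborel) \<longlonglongrightarrow> 0"
  \<comment> \<open>The truncation level is \<open>Suc M\<close>, so the cutoff vanishes outside
    radius M + 2; this explains the ball in the dominating function.\<close>
  proof (rule nn_integral_dominated_convergence_norm[where w="\<lambda>x. real (Suc M) * indicator (cball 0 (real M + 2)) x"])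
    show "AE x in lborel. norm (G j x) \<le> real (Suc M) * indicator (cball 0 (real M + 2)) x" for j
    proof (rule AE_I2)
      fix x
      have "norm (G j x) = \<eta> (real (Suc M)) x * norm (r (real (Suc M)) (g j x))"
        by (simp add: G_def \<eta>_def)
      also have "\<dots> \<le> indicator (cball 0 (real M + 2)) x * real (Suc M)"
        by (intro mult_mono r_le) (auto simp: \<eta>_def indicator_def)
      finally show "norm (G j x) \<le> real (Suc M) * indicator (cball 0 (real M + 2)) x" by (simp add: mult.commute)
    qed
    have "(\<integral>\<^sup>+x. ennreal (real (Suc M) * indicator (cball (0::'a) (real M + 2)) x) \<partial>lborel)
        = ennreal (real (Suc M)) * emeasure lborel (cball (0::'a) (real M + 2))"
      by (subst ennreal_mult, simp, simp, subst nn_integral_cmult) (simp_all add: ennreal_indicator borel_measurable_indicator)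
    also have "\<dots> < \<infinity>"
      using emeasure_lborel_cball_finite[of "0::'a" "real M + 2"] by (simp add: ennreal_mult_less_top)
    finally show "(\<integral>\<^sup>+x. ennreal (real (Suc M) * indicator (cball (0::'a) (real M + 2)) x) \<partial>lborel) < \<infinity>" .
    show "AE x in lborel. (\<lambda>i. G i x) \<longlonglongrightarrow> F M x"
      using lim
    proof eventually_elim
      case (elim x)
      have c: "isCont (r (real (Suc M))) (f x)"
        using r_cont[of "real (Suc M)"] by (simp add: continuous_on_eq_continuous_at)
      then show ?case
        unfolding G_def F_def using elim by (intro tendsto_scaleR tendsto_const isCont_tendsto_compose[OF c])
    qed
    show "(\<lambda>x. real (Suc M) * indicator (cball (0::'a) (real M + 2)) x) \<in> borel_measurable lborel"
      by (intro borel_measurable_times borel_measurable_const borel_measurable_indicator) simp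
  qed (simp_all add: F_def G_def del: of_nat_Suc)
  then have "eventually (\<lambda>n. (\<integral>\<^sup>+x. norm (F M x - G n x) \<partial>lborel) < ennreal (e / 2)) sequentially"
    using e by (intro order_tendstoD) auto
  then obtain n where n: "(\<integral>\<^sup>+x. norm (F M x - G n x) \<partial>lborel) < ennreal (e / 2)"
    by (auto simp: eventually_sequentially)
  show ?thesis
  proof
    show "continuous_on UNIV (G n)"
      unfolding G_def
      by (intro continuous_intros continuous_on_compose2[OF r_cont g] \<eta>_cont) auto
    have "(\<integral>\<^sup>+x. ennreal (norm (f x - G n x)) \<partial>lborel)
        \<le> (\<integral>\<^sup>+x. ennreal (norm (f x - F M x)) + ennreal (norm (F M x - G n x)) \<partial>lborel)"
      by (intro nn_integral_mono) (auto simp flip: ennreal_plus intro!: ennreal_leI norm_diff_triangle_le)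
    also have "\<dots> = (\<integral>\<^sup>+x. norm (f x - F M x) \<partial>lborel) + (\<integral>\<^sup>+x. norm (F M x - G n x) \<partial>lborel)"
      by (intro nn_integral_add) (simp_all add: F_def G_def del: of_nat_Suc)
    also have "\<dots> < ennreal (e / 2) + ennreal (e / 2)"
      using M n by (intro add_strict_mono)
    finally show "(\<integral>\<^sup>+x. ennreal (norm (f x - G n x)) \<partial>lborel) < ennreal e"
      using e by (simp flip: ennreal_plus)
  qed
qed

section \<open>Lebesgue differentiation along segments of a fixed direction\<close>

definition line_avg :: "('a::real_vector \<Rightarrow> ennreal) \<Rightarrow> 'a \<Rightarrow> 'a \<Rightarrow> ennreal" where
  "line_avg f h x = (\<integral>\<^sup>+s\<in>{0..1}. f (x + s *\<^sub>R h) \<partial>lborel)"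

text \<open>Compare f with a continuous g close to it in L1: for g the averages converge at every
  point, while f - g is controlled off a small set, by the weak type bound along segments and by
  Markov's inequality at x itself.\<close>

lemma AE_line_avg_tendsto_0_integrable:
  fixes f :: "'a::euclidean_space \<Rightarrow> 'b::euclidean_space"
  assumes f: "integrable lborel f" and d: "\<And>k. 0 < d k" "d \<longlonglongrightarrow> 0"
  shows "AE x in lborel. (\<lambda>k. line_avg (\<lambda>y. ennreal (norm (f y - f x))) (d k *\<^sub>R w) x) \<longlonglongrightarrow> 0"
proof -
  have [measurable]: "f \<in> borel_measurable borel" using f by auto
  obtain T where T: "\<And>k. d k \<le> T"
    using convergent_imp_Bseq[OF convergentI[OF d(2)]] by (force simp: Bseq_def abs_le_iff)
  \<comment> \<open>The 3 l collects l from the average of |f - g|, l from the continuity of g and l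
    from |f x - g x|.\<close>
  have main: "AE x in lborel. eventually (\<lambda>k. line_avg (\<lambda>y. ennreal (norm (f y - f x))) (d k *\<^sub>R w) x \<le> ennreal (3 * l)) sequentially"
    if l: "0 < l" for l :: real
  proof -
    have "\<forall>j. \<exists>g. continuous_on UNIV g \<and> (\<integral>\<^sup>+x. ennreal (norm (f x - g x)) \<partial>lborel) < ennreal (1 / real (Suc j))"
      using continuous_L1_approximation[OF f] by (metis of_nat_0_less_iff zero_less_Suc zero_less_divide_1_iff)
    then obtain g where g: "\<And>j. continuous_on UNIV (g j)"
      "\<And>j. (\<integral>\<^sup>+x. ennreal (norm (f x - g j x)) \<partial>lborel) < ennreal (1 / real (Suc j))"
      by metis
    have [measurable]: "g j \<in> borel_measurable borel" for j
      using g by (auto intro!: borel_measurable_continuous_onI)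
    define u where "u j x = ennreal (norm (f x - g j x))" for j x
    have [measurable]: "u j \<in> borel_measurable borel" for j
      unfolding u_def by measurable
    define B1 where "B1 j = {x. \<exists>k. ennreal l < (\<integral>\<^sup>+s\<in>{0..1}. u j (x + (s * d k) *\<^sub>R w) \<partial>lborel)}" for j
    define B2 where "B2 j = {x. ennreal l < u j x}" for j
    have [measurable]: "B1 j \<in> sets borel" "B2 j \<in> sets borel" for j
      unfolding B1_def B2_def by measurable
    \<comment> \<open>21 = 20 + 1: the weak type constant for \<open>B1\<close> plus Markov's
      constant for \<open>B2\<close>.\<close>
    have small: "ennreal l * emeasure lborel (B1 j \<union> B2 j) \<le> ennreal (21 / real (Suc j))" for j
    proof -
      have "ennreal l * emeasure lborel (B2 j) = (\<integral>\<^sup>+x. ennreal l * indicator (B2 j) x \<partial>lborel)"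
        by (simp add: nn_integral_cmult)
      also have "\<dots> \<le> (\<integral>\<^sup>+x. u j x \<partial>lborel)"
        by (intro nn_integral_mono) (auto simp: B2_def indicator_def)
      finally have 2: "ennreal l * emeasure lborel (B2 j) \<le> (\<integral>\<^sup>+x. u j x \<partial>lborel)" .
      have 1: "ennreal l * emeasure lborel (B1 j) \<le> 20 * (\<integral>\<^sup>+x. u j x \<partial>lborel)"
        unfolding B1_def by (rule weak_type_directional[OF _ d(1) T]) measurable
      have "ennreal l * emeasure lborel (B1 j \<union> B2 j) \<le> ennreal l * (emeasure lborel (B1 j) + emeasure lborel (B2 j))"
        by (intro mult_left_mono emeasure_subadditive) auto
      also have "\<dots> \<le> 20 * (\<integral>\<^sup>+x. u j x \<partial>lborel) + 1 * (\<integral>\<^sup>+x. u j x \<partial>lborel)"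
        using 1 2 by (simp add: distrib_left add_mono)
      also have "\<dots> = 21 * (\<integral>\<^sup>+x. u j x \<partial>lborel)"
        unfolding distrib_right[symmetric] by simp
      also have "\<dots> \<le> 21 * ennreal (1 / real (Suc j))"
        using g(2)[of j] by (intro mult_left_mono) (auto simp: u_def)
      finally show ?thesis by (simp add: ennreal_mult[symmetric] flip: ennreal_numeral)
    qed
    \<comment> \<open>Points of B are bad for every approximant, so B is null. Any other point is
      good for at least one g, and one g is enough for the fixed tolerance l.\<close>
    define B where "B = (\<Inter>j. B1 j \<union> B2 j)"
    have [measurable]: "B \<in> sets borel" unfolding B_def by measurable
    have "ennreal l * emeasure lborel B \<le> ennreal (21 / real (Suc j))" for j
    proof -
      have "ennreal l * emeasure lborel B \<le> ennreal l * emeasure lborel (B1 j \<union> B2 j)"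
        by (intro mult_left_mono emeasure_mono) (auto simp: B_def)
      then show ?thesis using small[of j] by (rule order_trans)
    qed
    moreover have "(\<lambda>j. ennreal (21 / real (Suc j))) \<longlonglongrightarrow> ennreal 0"
      by (intro tendsto_ennrealI LIMSEQ_Suc lim_const_over_n)
    ultimately have "ennreal l * emeasure lborel B \<le> ennreal 0"
      by (intro LIMSEQ_le_const) auto
    then have "B \<in> null_sets lborel" using l by (auto intro: null_setsI)
    then have "AE x in lborel. x \<notin> B" by (rule AE_not_in)
    then show ?thesis
    proof eventually_elim
      case (elim x)
      then obtain j where j: "x \<notin> B1 j" "x \<notin> B2 j" by (auto simp: B_def)
      have "isCont (g j) x" using g(1)[of j] by (simp add: continuous_on_eq_continuous_at)
      then obtain r where r: "0 < r" "\<And>y. dist y x < r \<Longrightarrow> dist (g j y) (g j x) < l"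
        using l unfolding continuous_at_eps_delta by metis
      have "(\<lambda>k. d k * norm w) \<longlonglongrightarrow> 0 * norm w" by (intro tendsto_intros d)
      then have "eventually (\<lambda>k. d k * norm w < r) sequentially"
        using r(1) by (intro order_tendstoD) auto
      then show ?case
      proof eventually_elim
        case (elim k)
        have "line_avg (\<lambda>y. ennreal (norm (f y - f x))) (d k *\<^sub>R w) x
            \<le> (\<integral>\<^sup>+s. u j (x + (s * d k) *\<^sub>R w) * indicator {0..1} s + ennreal (2 * l) * indicator {0..1} s \<partial>lborel)"
          unfolding line_avg_def
        proof (intro nn_integral_mono)
          fix s :: real
          show "ennreal (norm (f (x + s *\<^sub>R d k *\<^sub>R w) - f x)) * indicator {0..1} s
              \<le> u j (x + (s * d k) *\<^sub>R w) * indicator {0..1} s + ennreal (2 * l) * indicator {0..1} s"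
          proof (cases "s \<in> {0..1}")
            case True
            define y where "y = x + (s * d k) *\<^sub>R w"
            have "dist y x = s * (d k * norm w)"
              using True d(1)[of k] by (simp add: y_def dist_norm abs_mult)
            also have "\<dots> \<le> 1 * (d k * norm w)"
              using True d(1)[of k] by (intro mult_right_mono) auto
            finally have "dist (g j y) (g j x) < l"
              using elim r(2) by simp
            moreover have "norm (f x - g j x) \<le> l"
              using j(2) l by (simp add: B2_def u_def not_less)
            moreover have "norm (f y - f x) \<le> norm (f y - g j y) + norm (g j y - g j x) + norm (g j x - f x)"
              by (smt (verit) diff_add_cancel norm_triangle_ineq add_diff_eq)
            ultimately have "norm (f y - f x) \<le> norm (f y - g j y) + 2 * l"
              by (simp add: dist_norm norm_minus_commute)
            then have "ennreal (norm (f y - f x)) \<le> ennreal (norm (f y - g j y)) + ennreal (2 * l)"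
              using l by (simp flip: ennreal_plus add: ennreal_leI)
            then show ?thesis using True by (simp add: u_def y_def)
          qed simp
        qed
        also have "\<dots> = (\<integral>\<^sup>+s\<in>{0..1}. u j (x + (s * d k) *\<^sub>R w) \<partial>lborel) + ennreal (2 * l)"
          by (simp add: nn_integral_add nn_integral_cmult)
        also have "\<dots> \<le> ennreal l + ennreal (2 * l)"
          using j(1) by (intro add_right_mono) (auto simp: B1_def not_less)
        also have "\<dots> = ennreal (3 * l)"
          using l by (simp flip: ennreal_plus)
        finally show ?case .
      qed
    qed
  qed
  have "AE x in lborel. \<forall>m::nat. eventually (\<lambda>k. line_avg (\<lambda>y. ennreal (norm (f y - f x))) (d k *\<^sub>R w) x
      \<le> ennreal (3 * (1 / real (Suc m)))) sequentially"
    by (subst AE_all_countable) (intro allI main, simp)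
  then show ?thesis
  proof eventually_elim
    case (elim x)
    show ?case
    proof (rule order_tendstoI)
      fix a :: ennreal assume a: "0 < a"
      have "(\<lambda>m. ennreal (3 / real (Suc m))) \<longlonglongrightarrow> ennreal 0"
        by (intro tendsto_ennrealI LIMSEQ_Suc lim_const_over_n)
      then have "eventually (\<lambda>m. ennreal (3 / real (Suc m)) < a) sequentially"
        using a by (intro order_tendstoD) auto
      then obtain m where m: "ennreal (3 / real (Suc m)) < a" by (auto simp: eventually_sequentially)
      show "eventually (\<lambda>k. line_avg (\<lambda>y. ennreal (norm (f y - f x))) (d k *\<^sub>R w) x < a) sequentially"
        using elim[rule_format, of m] by eventually_elim (use m in auto)
    qed auto
  qed
qed

text \<open>The assertion is local: once \<open>d k\<close> |w| < 1, the segment starting at x stays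
  in a ball of radius n \<ge> |x| + 1, where f agrees with its integrable truncation.\<close>

lemma AE_line_avg_tendsto_0:
  fixes f :: "'a::euclidean_space \<Rightarrow> 'b::euclidean_space"
  assumes f: "\<And>R. integrable lborel (\<lambda>x. indicator (cball 0 R) x *\<^sub>R f x)"
    and d: "\<And>k. 0 < d k" "d \<longlonglongrightarrow> 0"
  shows "AE x in lborel. (\<lambda>k. line_avg (\<lambda>y. ennreal (norm (f y - f x))) (d k *\<^sub>R w) x) \<longlonglongrightarrow> 0"
proof -
  define F where "F n x = indicator (cball 0 (real n)) x *\<^sub>R f x" for n x
  have "AE x in lborel. \<forall>n. (\<lambda>k. line_avg (\<lambda>y. ennreal (norm (F n y - F n x))) (d k *\<^sub>R w) x) \<longlonglongrightarrow> 0"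
    by (subst AE_all_countable) (intro allI AE_line_avg_tendsto_0_integrable d, simp add: F_def f)
  then show ?thesis
  proof eventually_elim
    case (elim x)
    obtain n :: nat where n: "norm x + 1 \<le> real n" using real_arch_simple by blast
    have "(\<lambda>k. d k * norm w) \<longlonglongrightarrow> 0 * norm w" by (intro tendsto_intros d)
    then have "eventually (\<lambda>k. d k * norm w < 1) sequentially"
      by (intro order_tendstoD) auto
    then have "eventually (\<lambda>k. line_avg (\<lambda>y. ennreal (norm (F n y - F n x))) (d k *\<^sub>R w) x
        = line_avg (\<lambda>y. ennreal (norm (f y - f x))) (d k *\<^sub>R w) x) sequentially"
    proof eventually_elim
      case (elim k)
      show ?case unfolding line_avg_def
      proof (intro nn_integral_cong)
        fix s :: real
        show "ennreal (norm (F n (x + s *\<^sub>R d k *\<^sub>R w) - F n x)) * indicator {0..1} s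
          = ennreal (norm (f (x + s *\<^sub>R d k *\<^sub>R w) - f x)) * indicator {0..1} s"
        proof (cases "s \<in> {0..1}")
          case True
          have "norm (s *\<^sub>R d k *\<^sub>R w) = s * (d k * norm w)" using True d(1)[of k] by (simp add: abs_mult)
          also have "\<dots> \<le> 1 * (d k * norm w)"
            using True d(1)[of k] by (intro mult_right_mono) auto
          finally have "norm (x + s *\<^sub>R d k *\<^sub>R w) \<le> real n"
            using elim n norm_triangle_ineq[of x "s *\<^sub>R d k *\<^sub>R w"] by linarith
          then show ?thesis using n by (simp add: F_def)
        qed simp
      qed
    qed
    then show ?case using elim by (blast intro: Lim_transform_eventually)
  qed
qed

section \<open>Integrals of homogeneous functions\<close>

lemma nn_integral_affine:
  fixes f :: "'a::euclidean_space \<Rightarrow> ennreal"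
  assumes [measurable]: "f \<in> borel_measurable borel" and c: "c \<noteq> 0"
  shows "(\<integral>\<^sup>+x. f x \<partial>lborel) = ennreal (\<bar>c\<bar> ^ DIM('a)) * (\<integral>\<^sup>+x. f (t + c *\<^sub>R x) \<partial>lborel)"
  by (subst lborel_affine[OF c, of t])
    (simp add: nn_integral_density nn_integral_distr nn_integral_cmult)

lemma nn_integral_powr_tail:
  fixes a c :: real
  assumes a: "0 < a" and c: "0 < c"
  shows "(\<integral>\<^sup>+s. ennreal (s powr (- a - 1)) * indicator {c..} s \<partial>lborel) = ennreal (c powr (- a) / a)"
proof -
  have "(\<integral>\<^sup>+s. ennreal (s powr (- a - 1)) * indicator {c..} s \<partial>lborel)
      = ennreal (0 - (- (c powr (- a)) / a))"
  proof (rule nn_integral_FTC_atLeast)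
    show "DERIV (\<lambda>s. - (s powr (- a)) / a) x :> x powr (- a - 1)" if "c \<le> x" for x
      using that c a by (auto intro!: derivative_eq_intros simp: powr_diff)
    have "((\<lambda>s. s powr (- a)) \<longlongrightarrow> 0) at_top"
      using a by (intro tendsto_neg_powr filterlim_ident) auto
    then have "((\<lambda>s. - (s powr (- a)) / a) \<longlongrightarrow> - 0 / a) at_top"
      using a by (intro tendsto_intros) auto
    then show "((\<lambda>s. - (s powr (- a)) / a) \<longlongrightarrow> 0) at_top" by simp
  qed auto
  then show ?thesis by simp
qed

lemma nn_integral_powr_tail_greater:
  fixes a c :: real
  assumes "0 < a" "0 < c"
  shows "(\<integral>\<^sup>+s. ennreal (s powr (- a - 1)) * indicator {c<..} s \<partial>lborel) = ennreal (c powr (- a) / a)"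
proof -
  have "AE s in lborel. s \<noteq> c" by (rule AE_lborel_singleton)
  then have "(\<integral>\<^sup>+s. ennreal (s powr (- a - 1)) * indicator {c<..} s \<partial>lborel)
      = (\<integral>\<^sup>+s. ennreal (s powr (- a - 1)) * indicator {c..} s \<partial>lborel)"
    by (intro nn_integral_cong_AE) (auto simp: indicator_def elim!: eventually_mono)
  then show ?thesis using nn_integral_powr_tail[OF assms] by simp
qed

text \<open>A substitute for polar coordinates: write \<open>N w powr - q\<close> as
  \<open>q * \<integral> s powr (- q - 1) ds\<close> over \<open>s \<ge> N w\<close> and rescale \<open>w\<close> by \<open>s\<close>.\<close>

lemma nn_integral_homogeneous:
  fixes N m :: "'a::euclidean_space \<Rightarrow> real" and \<phi> :: "real \<Rightarrow> ennreal" and p :: real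
  assumes [measurable]: "N \<in> borel_measurable borel" "m \<in> borel_measurable borel"
      "\<phi> \<in> borel_measurable borel"
    and N: "\<And>s z. 0 < s \<Longrightarrow> N (s *\<^sub>R z) = s * N z" "\<And>z. z \<noteq> 0 \<Longrightarrow> 0 < N z"
    and m: "\<And>s z. 0 < s \<Longrightarrow> m (s *\<^sub>R z) = s * m z"
    and p: "0 < p"
  shows "(\<integral>\<^sup>+w. ennreal (1 / N w powr (real DIM('a) + p)) * \<phi> (m w) \<partial>lborel)
    = ennreal (real DIM('a) + p) *
      (\<integral>\<^sup>+z\<in>{z. N z \<le> 1}. (\<integral>\<^sup>+s\<in>{0<..}. ennreal (s powr (- p - 1)) * \<phi> (s * m z) \<partial>lborel) \<partial>lborel)"
proof -
  define q where "q = real DIM('a) + p"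
  have q: "0 < q" using p by (simp add: q_def add_nonneg_pos)
  define h where "h w s = ennreal (s powr (- q - 1)) * indicator {0<..} s * (indicator {w. N w \<le> s} w * \<phi> (m w))" for w s
  have [measurable]: "(\<lambda>(w, s). h w s) \<in> borel_measurable (lborel \<Otimes>\<^sub>M lborel)"
    unfolding h_def indicator_def by measurable
  have [measurable]: "(\<lambda>(s, w). h w s) \<in> borel_measurable (lborel \<Otimes>\<^sub>M lborel)"
    unfolding h_def indicator_def by measurable
  have layer: "ennreal (1 / N w powr q) * \<phi> (m w) = ennreal q * (\<integral>\<^sup>+s. h w s \<partial>lborel)" if "w \<noteq> 0" for w
  proof -
    have Nw: "0 < N w" using N(2) that by simp
    have "(\<integral>\<^sup>+s. h w s \<partial>lborel) = (\<integral>\<^sup>+s. (ennreal (s powr (- q - 1)) * indicator {N w..} s) * \<phi> (m w) \<partial>lborel)"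
      using Nw by (intro nn_integral_cong) (auto simp: h_def indicator_def)
    also have "\<dots> = ennreal (N w powr (- q) / q) * \<phi> (m w)"
      using nn_integral_powr_tail[OF q Nw] by (simp add: nn_integral_multc)
    finally have "ennreal q * (\<integral>\<^sup>+s. h w s \<partial>lborel) = ennreal (q * (N w powr (- q) / q)) * \<phi> (m w)"
      by (subst ennreal_mult) (use q in \<open>auto simp: mult.assoc\<close>)
    moreover have "q * (N w powr (- q) / q) = 1 / N w powr q"
      using q by (simp add: powr_minus_divide)
    ultimately show ?thesis by simp
  qed
  have "(\<integral>\<^sup>+w. ennreal (1 / N w powr q) * \<phi> (m w) \<partial>lborel)
      = (\<integral>\<^sup>+w. ennreal q * (\<integral>\<^sup>+s. h w s \<partial>lborel) \<partial>lborel)"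
    using AE_lborel_singleton[of 0] layer by (intro nn_integral_cong_AE) (auto elim!: eventually_mono)
  also have "\<dots> = ennreal q * (\<integral>\<^sup>+s. (\<integral>\<^sup>+w. h w s \<partial>lborel) \<partial>lborel)"
    by (subst lborel_pair.Fubini'[symmetric]) (auto simp: nn_integral_cmult)
  also have "(\<integral>\<^sup>+s. (\<integral>\<^sup>+w. h w s \<partial>lborel) \<partial>lborel)
      = (\<integral>\<^sup>+s. (\<integral>\<^sup>+z. ennreal (s powr (- p - 1)) * \<phi> (s * m z) * indicator {0<..} s * indicator {z. N z \<le> 1} z \<partial>lborel) \<partial>lborel)"
  proof (rule nn_integral_cong)
    fix s :: real
    show "(\<integral>\<^sup>+w. h w s \<partial>lborel)
      = (\<integral>\<^sup>+z. ennreal (s powr (- p - 1)) * \<phi> (s * m z) * indicator {0<..} s * indicator {z. N z \<le> 1} z \<partial>lborel)"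
    proof (cases "0 < s")
      case True
      have "(\<integral>\<^sup>+w. h w s \<partial>lborel) = ennreal (\<bar>s\<bar> ^ DIM('a)) * (\<integral>\<^sup>+z. h (0 + s *\<^sub>R z) s \<partial>lborel)"
        using True by (intro nn_integral_affine) (auto simp: h_def)
      also have "\<dots> = (\<integral>\<^sup>+z. ennreal (s powr real DIM('a)) * h (s *\<^sub>R z) s \<partial>lborel)"
        using True by (simp add: nn_integral_cmult powr_realpow h_def)
      also have "\<dots> = (\<integral>\<^sup>+z. ennreal (s powr (- p - 1)) * \<phi> (s * m z) * indicator {0<..} s * indicator {z. N z \<le> 1} z \<partial>lborel)"
      proof (intro nn_integral_cong)
        fix z
        \<comment> \<open>Scaling w by s contributes s^n with n the dimension; against s^(-q-1) with
          q = n + p this leaves s^(-p-1).\<close>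
        have "s powr real DIM('a) * s powr (- q - 1) = s powr (- p - 1)"
          by (simp add: q_def flip: powr_add)
        then have "ennreal (s powr real DIM('a)) * ennreal (s powr (- q - 1)) = ennreal (s powr (- p - 1))"
          by (simp flip: ennreal_mult)
        moreover have "ennreal (s powr real DIM('a)) * h (s *\<^sub>R z) s
            = (ennreal (s powr real DIM('a)) * ennreal (s powr (- q - 1))) * (indicator {z. N z \<le> 1} z * \<phi> (s * m z))"
          using True by (auto simp: h_def m N(1) indicator_def mult.assoc)
        ultimately show "ennreal (s powr real DIM('a)) * h (s *\<^sub>R z) s
            = ennreal (s powr (- p - 1)) * \<phi> (s * m z) * indicator {0<..} s * indicator {z. N z \<le> 1} z"
          using True by (simp add: mult_ac)
      qed
      finally show ?thesis .
    next
      case False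
      then show ?thesis by (simp add: h_def)
    qed
  qed
  also have "\<dots> = (\<integral>\<^sup>+z\<in>{z. N z \<le> 1}. (\<integral>\<^sup>+s\<in>{0<..}. ennreal (s powr (- p - 1)) * \<phi> (s * m z) \<partial>lborel) \<partial>lborel)"
    by (subst lborel_pair.Fubini') (auto simp: nn_integral_multc)
  finally show ?thesis by (simp add: q_def)
qed

section \<open>Radial integration for superlevel sets of homogeneous functions\<close>

context
  fixes N m :: "'a::euclidean_space \<Rightarrow> real" and p :: real
  assumes [measurable]: "N \<in> borel_measurable borel" "m \<in> borel_measurable borel"
    and N: "\<And>s z. 0 < s \<Longrightarrow> N (s *\<^sub>R z) = s * N z" "\<And>z. z \<noteq> 0 \<Longrightarrow> 0 < N z"
    and m: "\<And>s z. 0 < s \<Longrightarrow> m (s *\<^sub>R z) = s * m z" "\<And>z. 0 \<le> m z"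
begin

text \<open>On the ray through z the superlevel set is s > 1 / m z, where s^(-p-1) integrates to (m
  z)^p / p. With the factor n + p this gives exactly the normalisation (n + p)/p of
  \<open>polar_moment_norm\<close>.\<close>

lemma nn_integral_homogeneous_superlevel:
  assumes p: "0 < p"
  shows "(\<integral>\<^sup>+w. ennreal (1 / N w powr (real DIM('a) + p)) * indicator {w. 1 < m w} w \<partial>lborel)
    = ennreal ((real DIM('a) + p) / p) * (\<integral>\<^sup>+z\<in>{z. N z \<le> 1}. ennreal (m z powr p) \<partial>lborel)"
proof -
  have inner: "(\<integral>\<^sup>+s\<in>{0<..}. ennreal (s powr (- p - 1)) * indicator {1<..} (s * m z) \<partial>lborel)
      = ennreal (1 / p) * ennreal (m z powr p)" for z
  proof (cases "m z = 0")
    case False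
    then have mz: "0 < m z" using m(2)[of z] by simp
    have "(\<integral>\<^sup>+s\<in>{0<..}. ennreal (s powr (- p - 1)) * indicator {1<..} (s * m z) \<partial>lborel)
        = (\<integral>\<^sup>+s. ennreal (s powr (- p - 1)) * indicator {1 / m z<..} s \<partial>lborel)"
    proof (intro nn_integral_cong)
      fix s :: real
      have "1 < s * m z \<longleftrightarrow> 1 / m z < s" using mz by (simp add: field_simps)
      moreover have "0 < s" if "1 / m z < s" using mz that less_trans[of 0 "1 / m z" s] by simp
      ultimately show "ennreal (s powr (- p - 1)) * indicator {1<..} (s * m z) * indicator {0<..} s
        = ennreal (s powr (- p - 1)) * indicator {1 / m z<..} s"
        by (auto simp: indicator_def)
    qed
    also have "\<dots> = ennreal ((1 / m z) powr (- p) / p)"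
      using p mz by (intro nn_integral_powr_tail_greater) auto
    also have "(1 / m z) powr (- p) / p = 1 / p * m z powr p"
      using mz by (simp add: powr_minus powr_divide field_simps)
    finally show ?thesis using p by (subst ennreal_mult[symmetric]) auto
  qed (use p in simp)
  have "(\<integral>\<^sup>+w. ennreal (1 / N w powr (real DIM('a) + p)) * indicator {w. 1 < m w} w \<partial>lborel)
      = (\<integral>\<^sup>+w. ennreal (1 / N w powr (real DIM('a) + p)) * indicator {1<..} (m w) \<partial>lborel)"
    by (intro nn_integral_cong) (auto simp: indicator_def)
  also have "\<dots> = ennreal (real DIM('a) + p) * (\<integral>\<^sup>+z\<in>{z. N z \<le> 1}. (ennreal (1 / p) * ennreal (m z powr p)) \<partial>lborel)"
    by (subst nn_integral_homogeneous[OF _ _ _ N m(1) p]) (auto simp: inner)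
  also have "\<dots> = ennreal (real DIM('a) + p) * (ennreal (1 / p) * (\<integral>\<^sup>+z\<in>{z. N z \<le> 1}. ennreal (m z powr p) \<partial>lborel))"
    by (simp add: nn_integral_cmult mult.assoc)
  also have "\<dots> = ennreal ((real DIM('a) + p) / p) * (\<integral>\<^sup>+z\<in>{z. N z \<le> 1}. ennreal (m z powr p) \<partial>lborel)"
    using p by (simp add: divide_inverse ennreal_mult mult.assoc)
  finally show ?thesis .
qed

text \<open>On each ray the integrand becomes m z times s^(-p) on s > l / m z. The truncation keeps
  s away from 0, and p > 1 gives integrability at infinity, whence the factor 1 / (p - 1).\<close>

lemma nn_integral_homogeneous_truncated:
  assumes p: "1 < p" and l: "0 < l"
  shows "(\<integral>\<^sup>+w. ennreal (1 / N w powr (real DIM('a) + p)) * (ennreal (m w) * indicator {w. l < m w} w) \<partial>lborel)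
    = ennreal ((real DIM('a) + p) * (l powr (1 - p) / (p - 1))) * (\<integral>\<^sup>+z\<in>{z. N z \<le> 1}. ennreal (m z powr p) \<partial>lborel)"
proof -
  define \<phi> where "\<phi> r = ennreal r * indicator {l<..} r" for r
  have [measurable]: "\<phi> \<in> borel_measurable borel" unfolding \<phi>_def by measurable
  have inner: "(\<integral>\<^sup>+s\<in>{0<..}. ennreal (s powr (- p - 1)) * \<phi> (s * m z) \<partial>lborel)
      = ennreal (l powr (1 - p) / (p - 1)) * ennreal (m z powr p)" for z
  proof (cases "m z = 0")
    case False
    then have mz: "0 < m z" using m(2)[of z] by simp
    have "(\<integral>\<^sup>+s\<in>{0<..}. ennreal (s powr (- p - 1)) * \<phi> (s * m z) \<partial>lborel)
        = (\<integral>\<^sup>+s. ennreal (m z) * (ennreal (s powr (- (p - 1) - 1)) * indicator {l / m z<..} s) \<partial>lborel)"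
    proof (intro nn_integral_cong)
      fix s :: real
      have 1: "l < s * m z \<longleftrightarrow> l / m z < s" using mz by (simp add: field_simps)
      have 2: "0 < s" if "l / m z < s" using mz l that less_trans[of 0 "l / m z" s] by simp
      have 3: "ennreal (s powr (- p - 1)) * ennreal (s * m z) = ennreal (m z) * ennreal (s powr (- p))" if "0 < s"
        using mz that powr_mult_base[of s "- p - 1"] by (simp add: mult_ac flip: ennreal_mult)
      show "ennreal (s powr (- p - 1)) * \<phi> (s * m z) * indicator {0<..} s
        = ennreal (m z) * (ennreal (s powr (- (p - 1) - 1)) * indicator {l / m z<..} s)"
        using 1 2 3 by (auto simp: indicator_def \<phi>_def)
    qed
    also have "\<dots> = ennreal (m z) * ennreal ((l / m z) powr (- (p - 1)) / (p - 1))"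
      using p mz l nn_integral_powr_tail_greater[of "p - 1" "l / m z"] by (simp add: nn_integral_cmult)
    also have "\<dots> = ennreal (m z * ((l / m z) powr (- (p - 1)) / (p - 1)))"
      using mz p by (subst ennreal_mult) auto
    also have "m z * ((l / m z) powr (- (p - 1)) / (p - 1)) = l powr (1 - p) / (p - 1) * m z powr p"
      using mz l p by (simp add: powr_divide powr_diff)
    finally show ?thesis using p by (subst ennreal_mult[symmetric]) auto
  qed (use p l in \<open>simp add: \<phi>_def\<close>)
  have "(\<integral>\<^sup>+w. ennreal (1 / N w powr (real DIM('a) + p)) * (ennreal (m w) * indicator {w. l < m w} w) \<partial>lborel)
      = (\<integral>\<^sup>+w. ennreal (1 / N w powr (real DIM('a) + p)) * \<phi> (m w) \<partial>lborel)"
    by (intro nn_integral_cong) (auto simp: indicator_def \<phi>_def)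
  also have "\<dots> = ennreal (real DIM('a) + p) *
      (\<integral>\<^sup>+z\<in>{z. N z \<le> 1}. (ennreal (l powr (1 - p) / (p - 1)) * ennreal (m z powr p)) \<partial>lborel)"
    using p by (subst nn_integral_homogeneous[OF _ _ _ N m(1)]) (auto simp: inner)
  also have "\<dots> = ennreal (real DIM('a) + p) * (ennreal (l powr (1 - p) / (p - 1)) * (\<integral>\<^sup>+z\<in>{z. N z \<le> 1}. ennreal (m z powr p) \<partial>lborel))"
    by (simp add: nn_integral_cmult mult.assoc)
  also have "\<dots> = ennreal ((real DIM('a) + p) * (l powr (1 - p) / (p - 1))) * (\<integral>\<^sup>+z\<in>{z. N z \<le> 1}. ennreal (m z powr p) \<partial>lborel)"
    using p by (subst ennreal_mult) (auto simp: mult.assoc)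
  finally show ?thesis .
qed

text \<open>A ray meets {m = 1} in at most one point, which is null for the radial integral. The
  weight, taken here with exponent 1 in place of p, is positive off 0, so the vanishing of the
  weighted integral makes the set null.\<close>

lemma AE_homogeneous_neq_1: "AE w in lborel. m w \<noteq> 1"
proof -
  have inner: "(\<integral>\<^sup>+s\<in>{0<..}. ennreal (s powr (- 2)) * indicator {1} (s * m z) \<partial>lborel) = 0" for z
  proof (subst nn_integral_0_iff_AE)
    show "AE s in lborel. ennreal (s powr (- 2)) * indicator {1} (s * m z) * indicator {0<..} s = 0"
      using AE_lborel_singleton[of "1 / m z"]
      by eventually_elim (auto simp: indicator_def eq_divide_eq split: if_splits)
  qed measurable
  have "(\<integral>\<^sup>+w. ennreal (1 / N w powr (real DIM('a) + 1)) * indicator {1} (m w) \<partial>lborel) = 0"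
    by (subst nn_integral_homogeneous[OF _ _ _ N m(1)]) (auto simp: inner)
  then have "AE w in lborel. ennreal (1 / N w powr (real DIM('a) + 1)) * indicator {1} (m w) = 0"
    by (subst (asm) nn_integral_0_iff_AE) measurable
  with AE_lborel_singleton[of 0] show ?thesis
  proof eventually_elim
    case (elim w)
    then have "0 < 1 / N w powr (real DIM('a) + 1)" using N(2)[of w] by simp
    then show ?case using elim by (auto simp: indicator_def split: if_splits)
  qed
qed

end

section \<open>Test functions and the fundamental lemma\<close>

text \<open>The classical smooth function exp (-1/t) is given the extra factor (1/t)^k so that
  derivatives stay in the span of the family; see \<open>flat_has_derivative\<close>.\<close>

definition flat :: "nat \<Rightarrow> real \<Rightarrow> real" where
  "flat k t = (if 0 < t then (1 / t) ^ k * exp (- (1 / t)) else 0)"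

lemma flat_over_id_tendsto_0: "((\<lambda>t. flat k t / t) \<longlongrightarrow> 0) (at_right 0)"
proof -
  have "((\<lambda>y::real. y ^ Suc k / exp y) \<longlongrightarrow> 0) at_top"
    by (rule tendsto_power_div_exp_0)
  then have "((\<lambda>t::real. inverse t ^ Suc k / exp (inverse t)) \<longlongrightarrow> 0) (at_right 0)"
    by (rule filterlim_compose) (rule filterlim_inverse_at_top_right)
  moreover have "eventually (\<lambda>t::real. 0 < t) (at_right 0)"
    by (rule eventually_at_right_less)
  then have "eventually (\<lambda>t. inverse t ^ Suc k / exp (inverse t) = flat k t / t) (at_right 0)"
    by eventually_elim (simp add: flat_def exp_minus divide_inverse)
  ultimately show ?thesis by (rule Lim_transform_eventually)
qed

text \<open>For t > 0 this is the product rule. At 0 the right difference quotient vanishes in the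
  limit because exp (-1/t) beats every power of 1/t, and the left one is identically 0.\<close>

lemma flat_has_derivative:
  "(flat k has_real_derivative - real k * flat (Suc k) t + flat (k + 2) t) (at t)"
proof -
  consider "0 < t" | "t < 0" | "t = 0" by linarith
  then show ?thesis
  proof cases
    case 1
    have "((\<lambda>t. (1 / t) ^ k * exp (- (1 / t))) has_real_derivative
        - real k * flat (Suc k) t + flat (k + 2) t) (at t)"
    proof -
      have D: "((\<lambda>t. 1 / t) has_real_derivative - ((1 / t)\<^sup>2)) (at t)"
        using 1 by (auto intro!: derivative_eq_intros simp: power2_eq_square field_simps)
      have E: "((\<lambda>t. exp (- (1 / t))) has_real_derivative exp (- (1 / t)) * - (- ((1 / t)\<^sup>2))) (at t)"
        by (intro DERIV_fun_exp DERIV_minus D)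
      have "((\<lambda>t. (1 / t) ^ k) has_real_derivative - real k * (1 / t) ^ Suc k) (at t)"
        by (rule DERIV_cong[OF DERIV_power[OF D, of k]])
          (cases k; simp add: power2_eq_square algebra_simps add_divide_distrib diff_divide_distrib)
      from DERIV_mult[OF this E] show ?thesis
        using 1 by (simp add: flat_def power2_eq_square algebra_simps)
    qed
    then show ?thesis
      by (rule has_field_derivative_transform_within_open[where S="{0<..}"])
        (use 1 in \<open>auto simp: flat_def\<close>)
  next
    case 2
    have "((\<lambda>t. 0) has_real_derivative 0) (at t)" by simp
    then have "(flat k has_real_derivative 0) (at t)"
      by (rule has_field_derivative_transform_within_open[where S="{..<0}"])
        (use 2 in \<open>auto simp: flat_def\<close>)
    then show ?thesis using 2 by (simp add: flat_def)
  next
    case 3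
    have "((\<lambda>h. (flat k (0 + h) - flat k 0) / h) \<longlongrightarrow> 0) (at_left 0)"
      by (rule tendsto_eventually)
        (auto simp: flat_def eventually_at_filter)
    moreover have "((\<lambda>h. (flat k (0 + h) - flat k 0) / h) \<longlongrightarrow> 0) (at_right 0)"
      using flat_over_id_tendsto_0[of k] by (simp add: flat_def)
    ultimately have "(flat k has_real_derivative 0) (at 0)"
      unfolding DERIV_def by (simp add: filterlim_split_at)
    then show ?thesis using 3 by (simp add: flat_def)
  qed
qed

text \<open>A class closed under sums, products and partial derivatives. Smoothness of its members
  then follows by induction on the list of derivatives, and no formula for higher derivatives is
  ever written down.\<close>

inductive flat_algebra :: "(real^'n \<Rightarrow> real) \<Rightarrow> bool" where
  const: "flat_algebra (\<lambda>x. c)"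
| base: "flat_algebra (\<lambda>x. flat k (l * x $ j + c))"
| add: "flat_algebra f \<Longrightarrow> flat_algebra g \<Longrightarrow> flat_algebra (\<lambda>x. f x + g x)"
| mult: "flat_algebra f \<Longrightarrow> flat_algebra g \<Longrightarrow> flat_algebra (\<lambda>x. f x * g x)"

lemma partial_deriv_eq:
  "(f has_derivative f') (at x) \<Longrightarrow> partial_deriv i f x = f' (axis i 1)"
  unfolding partial_deriv_def by (metis frechet_derivative_at)

lemma flat_algebra_closed:
  fixes f :: "real^'n \<Rightarrow> real"
  assumes "flat_algebra f"
  shows "(\<forall>x. f differentiable at x) \<and> flat_algebra (partial_deriv i f)"
  using assms
proof induction
  case (const c)
  have "partial_deriv i (\<lambda>x. c) = (\<lambda>x::real^'n. 0)"
    by (rule ext, rule partial_deriv_eq) (rule has_derivative_const)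
  then show ?case by (simp add: flat_algebra.const)
next
  case (base k l j c)
  define e :: real where "e = l * (axis i 1 :: real^'n) $ j"
  have D: "((\<lambda>x. flat k (l * x $ j + c)) has_derivative
      (\<lambda>h. (- real k * flat (Suc k) (l * x $ j + c) + flat (k + 2) (l * x $ j + c)) * (l * h $ j))) (at x)"
    for x :: "real^'n"
  proof -
    have "((\<lambda>x::real^'n. l * x $ j + c) has_derivative (\<lambda>h. l * h $ j)) (at x)"
      by (auto intro!: derivative_eq_intros bounded_linear_imp_has_derivative bounded_linear_vec_nth)
    from has_derivative_compose[OF this flat_has_derivative[unfolded has_field_derivative_def]]
    show ?thesis by simp
  qed
  have "partial_deriv i (\<lambda>x. flat k (l * x $ j + c)) = (\<lambda>x. ((- real k * flat (Suc k) (l * x $ j + c)) + flat (k + 2) (l * x $ j + c)) * e)"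
    by (rule ext, subst partial_deriv_eq[OF D]) (simp add: e_def)
  moreover have "flat_algebra \<dots>"
    by (intro flat_algebra.intros)
  ultimately show ?case using D by (auto simp: differentiable_def)
next
  case (add f g)
  then have d: "(f has_derivative frechet_derivative f (at x)) (at x)" "(g has_derivative frechet_derivative g (at x)) (at x)" for x
    by (auto simp: frechet_derivative_works)
  have "partial_deriv i (\<lambda>x. f x + g x) = (\<lambda>x. partial_deriv i f x + partial_deriv i g x)"
    by (rule ext, subst partial_deriv_eq[OF has_derivative_add[OF d]]) (simp add: partial_deriv_def)
  then show ?case using add by (auto intro: flat_algebra.intros)
next
  case (mult f g)
  then have d: "(f has_derivative frechet_derivative f (at x)) (at x)" "(g has_derivative frechet_derivative g (at x)) (at x)" for x
    by (auto simp: frechet_derivative_works)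
  have "partial_deriv i (\<lambda>x. f x * g x) = (\<lambda>x. f x * partial_deriv i g x + partial_deriv i f x * g x)"
    by (rule ext, subst partial_deriv_eq[OF has_derivative_mult[OF d]]) (simp add: partial_deriv_def)
  then show ?case using mult by (auto intro!: flat_algebra.intros)
qed

lemma flat_algebra_fold_differentiable:
  "flat_algebra f \<Longrightarrow> fold partial_deriv js f differentiable at x"
  by (induction js arbitrary: f) (simp_all add: flat_algebra_closed)

lemma flat_algebra_prod:
  "finite J \<Longrightarrow> (\<And>j. j \<in> J \<Longrightarrow> flat_algebra (f j)) \<Longrightarrow> flat_algebra (\<lambda>x. \<Prod>j\<in>J. f j x)"
  by (induction rule: finite_induct) (auto intro: flat_algebra.intros)

text \<open>Since exp (-1/t) tends to 1 as t grows, scaling the distances to the faces of the box by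
  m makes the bumps approach the indicator of the open box. The arguments have the shape l * x + c
  of the rule \<open>base\<close>.\<close>

definition box_bump :: "nat \<Rightarrow> real^'n \<Rightarrow> real^'n \<Rightarrow> real^'n \<Rightarrow> real" where
  "box_bump m a b x = (\<Prod>j\<in>UNIV. flat 0 (real m * x $ j + (- real m * a $ j)) * flat 0 (- real m * x $ j + real m * b $ j))"

lemma box_bump_bounds: "0 \<le> box_bump m a b x" "box_bump m a b x \<le> 1"
  unfolding box_bump_def by (auto intro!: prod_nonneg prod_le_1 mult_le_one simp: flat_def)

lemma box_bump_outside: "x \<notin> box a b \<Longrightarrow> box_bump m a b x = 0"
proof -
  assume "x \<notin> box a b"
  then obtain j where "x $ j \<le> a $ j \<or> b $ j \<le> x $ j" by (auto simp: mem_box_cart not_less)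
  then have "real m * x $ j + (- real m * a $ j) \<le> 0 \<or> - real m * x $ j + real m * b $ j \<le> 0"
    by (auto simp: mult_left_mono)
  then have "flat 0 (real m * x $ j + (- real m * a $ j)) * flat 0 (- real m * x $ j + real m * b $ j) = 0"
    by (auto simp: flat_def)
  then show ?thesis unfolding box_bump_def by (subst prod_zero_iff) auto
qed

lemma test_function_box_bump: "test_function (box_bump m a b)"
  unfolding test_function_def
proof (intro conjI allI)
  fix js x show "fold partial_deriv js (box_bump m a b) differentiable at x"
    unfolding box_bump_def[abs_def]
    by (intro flat_algebra_fold_differentiable flat_algebra_prod flat_algebra.intros) auto
next
  have "{x. box_bump m a b x \<noteq> 0} \<subseteq> box a b" using box_bump_outside by blast
  then have "bounded {x. box_bump m a b x \<noteq> 0}" by (rule bounded_subset[OF bounded_box])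
  then show "compact (closure {x. box_bump m a b x \<noteq> 0})" by simp
qed

lemma box_bump_tendsto: "(\<lambda>m. box_bump m a b x) \<longlonglongrightarrow> indicator (box a b) x"
proof (cases "x \<in> box a b")
  case True
  have flat1: "(\<lambda>m. flat 0 (real m * s)) \<longlonglongrightarrow> 1" if "0 < s" for s
  proof -
    have "(\<lambda>m. exp (- (inverse s / real m))) \<longlonglongrightarrow> exp (- 0)"
      by (intro tendsto_intros lim_const_over_n)
    moreover have "eventually (\<lambda>m. exp (- (inverse s / real m)) = flat 0 (real m * s)) sequentially"
      using eventually_gt_at_top[of 0] by eventually_elim (use that in \<open>simp add: flat_def field_simps\<close>)
    ultimately show ?thesis using Lim_transform_eventually by fastforce
  qed
  have "(\<lambda>m. box_bump m a b x) \<longlonglongrightarrow> (\<Prod>j\<in>(UNIV::'a set). 1 * 1)"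
    unfolding box_bump_def
  proof (intro tendsto_prod tendsto_mult)
    fix j
    show "(\<lambda>m. flat 0 (real m * x $ j + - real m * a $ j)) \<longlonglongrightarrow> 1"
      using flat1[of "x $ j - a $ j"] True by (simp add: mem_box_cart algebra_simps)
    show "(\<lambda>m. flat 0 (- real m * x $ j + real m * b $ j)) \<longlonglongrightarrow> 1"
      using flat1[of "b $ j - x $ j"] True by (simp add: mem_box_cart algebra_simps)
  qed
  then show ?thesis using True by simp
qed (simp add: box_bump_outside)

text \<open>\<open>ennreal\<close> sends negative values to 0, so the two densities are the positive
  and the negative part of f. They define measures that agree and are finite on open boxes, an
  intersection-stable generator of the Borel sets. Hence the two parts agree almost everywhere,
  which is possible only where f is 0.\<close>

lemma AE_zero_of_box_integrals:
  fixes f :: "'a::euclidean_space \<Rightarrow> real"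
  assumes f: "\<And>R. integrable lborel (\<lambda>x. indicator (cball 0 R) x * f x)"
    and box: "\<And>a b. (LINT x|lborel. indicator (box a b) x * f x) = 0"
    and [measurable]: "f \<in> borel_measurable borel"
  shows "AE x in lborel. f x = 0"
proof -
  have int: "integrable lborel (\<lambda>x. indicator (box a b) x * f x)" for a b
  proof -
    obtain R where R: "box a b \<subseteq> cball 0 R" using bounded_box[of a b] by (auto simp: bounded_iff subset_iff)
    show ?thesis
      by (rule Bochner_Integration.integrable_bound[OF f[of R]]) (use R in \<open>auto simp: indicator_def subset_iff\<close>)
  qed
  have eq: "emeasure (density lborel (\<lambda>x. ennreal (f x))) (box a b) = emeasure (density lborel (\<lambda>x. ennreal (- f x))) (box a b)
     \<and> emeasure (density lborel (\<lambda>x. ennreal (f x))) (box a b) \<noteq> \<infinity>" for a b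
  proof -
    have 1: "ennreal (f x) * indicator (box a b) x = ennreal (indicator (box a b) x * f x)"
      "ennreal (- f x) * indicator (box a b) x = ennreal (- (indicator (box a b) x * f x))" for x
      by (auto simp: indicator_def)
    obtain r q where rq: "0 \<le> r" "0 \<le> q" "(\<integral>\<^sup>+x. ennreal (indicator (box a b) x * f x) \<partial>lborel) = ennreal r"
      "(\<integral>\<^sup>+x. ennreal (- (indicator (box a b) x * f x)) \<partial>lborel) = ennreal q"
      "(LINT x|lborel. indicator (box a b) x * f x) = r - q"
      by (rule integrableE[OF int[of a b]]) (rule that, assumption+)
    then show ?thesis
      using box[of a b] by (simp add: emeasure_density 1)
  qed
  have "density lborel (\<lambda>x. ennreal (f x)) = density lborel (\<lambda>x. ennreal (- f x))"
  proof (rule measure_eqI_generator_eq)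
    show "Int_stable (range (\<lambda>(a, b). box a b :: 'a set))"
      by (auto simp: Int_stable_def box_Int_box)
    show "sets (density lborel (\<lambda>x. ennreal (f x))) = sigma_sets UNIV (range (\<lambda>(a, b). box a b))"
      by (simp add: borel_eq_box)
    show "sets (density lborel (\<lambda>x. ennreal (- f x))) = sigma_sets UNIV (range (\<lambda>(a, b). box a b))"
      by (simp add: borel_eq_box)
    show "(\<Union>n::nat. box (- (real n *\<^sub>R One)) (real n *\<^sub>R One)) = (UNIV::'a set)"
      by (rule UN_box_eq_UNIV)
    show "emeasure (density lborel (\<lambda>x. ennreal (f x))) (box (- (real n *\<^sub>R One)) (real n *\<^sub>R One)) \<noteq> \<infinity>" for n
      using eq by blast
  qed (use eq in auto)
  then have "AE x in lborel. ennreal (f x) = ennreal (- f x)"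
    by (subst (asm) sigma_finite_measure.density_unique_iff[OF sigma_finite_lborel]) auto
  then show ?thesis
  proof eventually_elim
    case (elim x)
    then show ?case by (cases "0 \<le> f x") (auto simp: ennreal_neg not_le dest: order.strict_implies_order)
  qed
qed

text \<open>Bumps converge boundedly to indicators of boxes, so by dominated convergence the
  integrals of f over all boxes vanish; the box criterion is then applied to each coordinate of
  f.\<close>

lemma AE_zero_of_test_functions:
  fixes f :: "real^'n \<Rightarrow> 'b::euclidean_space"
  assumes f: "\<And>R. integrable lborel (\<lambda>x. indicator (cball 0 R) x *\<^sub>R f x)"
    and [measurable]: "f \<in> borel_measurable borel"
    and test: "\<And>\<phi>. test_function \<phi> \<Longrightarrow> (LINT x|lborel. \<phi> x *\<^sub>R f x) = 0"
  shows "AE x in lborel. f x = 0"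
proof -
  have "AE x in lborel. f x \<bullet> i = 0" if i: "i \<in> Basis" for i
  proof (rule AE_zero_of_box_integrals)
    show "integrable lborel (\<lambda>x. indicator (cball 0 R) x * (f x \<bullet> i))" for R
      using integrable_inner_left[OF f[of R], of i] by simp
    fix a b :: "real^'n"
    obtain R where R: "box a b \<subseteq> cball 0 R" using bounded_box[of a b] by (auto simp: bounded_iff subset_iff)
    have [measurable]: "box_bump m a b \<in> borel_measurable borel" for m
      using test_function_box_bump[of m a b] differentiable_imp_continuous_on[of "box_bump m a b" UNIV]
      by (intro borel_measurable_continuous_onI)
        (auto simp: test_function_def differentiable_on_def dest!: spec[of _ "[]"])
    have "(\<lambda>m. LINT x|lborel. box_bump m a b x *\<^sub>R f x) \<longlonglongrightarrow> (LINT x|lborel. indicator (box a b) x *\<^sub>R f x)"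
    proof (rule integral_dominated_convergence[where w="\<lambda>x. norm (indicator (cball 0 R) x *\<^sub>R f x)"])
      show "AE x in lborel. (\<lambda>m. box_bump m a b x *\<^sub>R f x) \<longlonglongrightarrow> indicator (box a b) x *\<^sub>R f x"
        by (intro AE_I2 tendsto_scaleR box_bump_tendsto tendsto_const)
      show "AE x in lborel. norm (box_bump m a b x *\<^sub>R f x) \<le> norm (indicator (cball 0 R) x *\<^sub>R f x)" for m
      proof (rule AE_I2)
        fix x
        show "norm (box_bump m a b x *\<^sub>R f x) \<le> norm (indicator (cball 0 R) x *\<^sub>R f x)"
          using R box_bump_bounds[of m a b x] box_bump_outside[of x a b m]
          by (cases "x \<in> box a b") (auto simp: subset_iff intro!: mult_left_le_one_le)
      qed
      show "integrable lborel (\<lambda>x. norm (indicator (cball 0 R) x *\<^sub>R f x))"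
        by (rule integrable_norm) (rule f)
    qed measurable
    moreover have "(LINT x|lborel. box_bump m a b x *\<^sub>R f x) = 0" for m
      by (rule test) (rule test_function_box_bump)
    ultimately have 0: "(LINT x|lborel. indicator (box a b) x *\<^sub>R f x) = 0"
      by (simp add: LIMSEQ_const_iff)
    have "integrable lborel (\<lambda>x. indicator (box a b) x *\<^sub>R f x)"
      by (rule Bochner_Integration.integrable_bound[OF f[of R]]) (use R in \<open>auto simp: indicator_def subset_iff\<close>)
    from integral_inner_left[OF this, of i] 0
    show "(LINT x|lborel. indicator (box a b) x * (f x \<bullet> i)) = 0" by simp
  qed measurable
  then have "AE x in lborel. \<forall>i\<in>Basis. f x \<bullet> i = 0"
    by (subst AE_ball_countable) (auto intro: countable_finite)
  then show ?thesis
    by eventually_elim (simp add: euclidean_all_zero_iff)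
qed

section \<open>Norms and complex moduli\<close>

lemma is_norm_scaleR: "is_norm N \<Longrightarrow> N (s *\<^sub>R z) = \<bar>s\<bar> * N z"
  and is_norm_pos: "is_norm N \<Longrightarrow> z \<noteq> 0 \<Longrightarrow> 0 < N z"
  and is_norm_nonneg: "is_norm N \<Longrightarrow> 0 \<le> N z"
  and is_norm_triangle: "is_norm N \<Longrightarrow> N (x + y) \<le> N x + N y"
  unfolding is_norm_def by (metis less_eq_real_def)+

lemma is_norm_minus: "is_norm N \<Longrightarrow> N (- z) = N z"
  using is_norm_scaleR[of N "-1" z] by simp

lemma is_norm_le_norm:
  fixes N :: "'a::euclidean_space \<Rightarrow> real"
  assumes N: "is_norm N"
  shows "N x \<le> (\<Sum>b\<in>Basis. N b) * norm x"
proof -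
  have sum: "N (sum f I) \<le> (\<Sum>i\<in>I. N (f i))" if "finite I" for f :: "'a \<Rightarrow> 'a" and I
    using that
  proof induction
    case empty
    then show ?case using is_norm_scaleR[OF N, of 0 0] by simp
  next
    case (insert i I)
    then show ?case using is_norm_triangle[OF N, of "f i" "sum f I"] by simp
  qed
  have "N x = N (\<Sum>b\<in>Basis. (x \<bullet> b) *\<^sub>R b)"
    by (simp add: euclidean_representation)
  also have "\<dots> \<le> (\<Sum>b\<in>Basis. \<bar>x \<bullet> b\<bar> * N b)"
    using sum[of Basis "\<lambda>b. (x \<bullet> b) *\<^sub>R b"] by (simp add: is_norm_scaleR[OF N])
  also have "\<dots> \<le> (\<Sum>b\<in>Basis. norm x * N b)"
    by (intro sum_mono mult_right_mono Basis_le_norm is_norm_nonneg[OF N])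
  finally show ?thesis by (simp add: sum_distrib_left mult.commute)
qed

lemma is_norm_continuous:
  fixes N :: "'a::euclidean_space \<Rightarrow> real"
  assumes N: "is_norm N"
  shows "continuous_on UNIV N"
proof -
  define B where "B = (\<Sum>b\<in>(Basis::'a set). N b)"
  have "\<bar>N x - N y\<bar> \<le> B * norm (x - y)" for x y
    using is_norm_triangle[OF N, of y "x - y"] is_norm_triangle[OF N, of x "y - x"]
      is_norm_le_norm[OF N, of "x - y"] is_norm_minus[OF N, of "x - y"] by (simp add: B_def)
  moreover have "0 \<le> B" unfolding B_def by (intro sum_nonneg is_norm_nonneg[OF N])
  ultimately have "B-lipschitz_on UNIV N"
    by (intro lipschitz_onI) (auto simp: dist_real_def dist_norm)
  then show ?thesis by (rule lipschitz_on_continuous_on)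
qed

lemma is_norm_ge_norm:
  fixes N :: "'a::euclidean_space \<Rightarrow> real"
  assumes N: "is_norm N"
  obtains C where "0 < C" "\<And>x. norm x \<le> C * N x"
proof -
  have "compact (sphere (0::'a) 1)" "sphere (0::'a) 1 \<noteq> {}" by auto
  then obtain x0 where x0: "x0 \<in> sphere 0 1" "\<And>x. x \<in> sphere 0 1 \<Longrightarrow> N x0 \<le> N x"
    using continuous_attains_inf[of "sphere 0 1" N] continuous_on_subset[OF is_norm_continuous[OF N]] by blast
  have pos: "0 < N x0" using x0(1) by (intro is_norm_pos[OF N]) auto
  have "norm x \<le> 1 / N x0 * N x" for x
  proof (cases "x = 0")
    case True
    then show ?thesis using pos is_norm_nonneg[OF N, of x] by simp
  next
    case False
    have "N x0 \<le> N ((1 / norm x) *\<^sub>R x)" using False by (intro x0(2)) auto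
    also have "\<dots> = 1 / norm x * N x" using False by (simp add: is_norm_scaleR[OF N])
    finally show ?thesis using False pos by (simp add: field_simps)
  qed
  then show thesis using that[of "1 / N x0"] pos by simp
qed

lemma lipschitz_on_UNIV_measurable:
  fixes f :: "'a::metric_space \<Rightarrow> 'b::metric_space"
  shows "L-lipschitz_on UNIV f \<Longrightarrow> f \<in> borel_measurable borel"
  by (intro borel_measurable_continuous_onI lipschitz_on_continuous_on)

lemma is_norm_measurable:
  fixes N :: "'a::euclidean_space \<Rightarrow> real"
  shows "is_norm N \<Longrightarrow> N \<in> borel_measurable borel"
  by (intro borel_measurable_continuous_onI is_norm_continuous)

lemma is_norm_compact_ball:
  fixes N :: "'a::euclidean_space \<Rightarrow> real"
  assumes N: "is_norm N"
  shows "compact {z. N z \<le> 1}"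
proof -
  obtain C where C: "0 < C" "\<And>x. norm x \<le> C * N x" using is_norm_ge_norm[OF N] by metis
  have "norm z \<le> C" if "N z \<le> 1" for z
    using C(2)[of z] mult_left_mono[OF that less_imp_le[OF C(1)]] by simp
  then have "bounded {z. N z \<le> 1}" by (auto simp: bounded_iff)
  moreover have "closed {z. N z \<le> 1}"
    by (intro closed_Collect_le is_norm_continuous[OF N] continuous_on_const)
  ultimately show ?thesis by (simp add: compact_eq_bounded_closed)
qed

lemma powr_add_le:
  fixes a b p :: real
  assumes "0 \<le> a" "0 \<le> b" "0 \<le> p"
  shows "(a + b) powr p \<le> 2 powr p * a powr p + 2 powr p * b powr p"
proof -
  have "(a + b) powr p \<le> (2 * max a b) powr p" using assms by (intro powr_mono2) auto
  also have "\<dots> = 2 powr p * max a b powr p" using assms by (simp add: powr_mult)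
  also have "\<dots> \<le> 2 powr p * (a powr p + b powr p)"
    by (intro mult_left_mono) (auto simp: max_def)
  finally show ?thesis by (simp add: distrib_left)
qed

section \<open>The modulus \<open>cmod_p\<close> and the pairing \<open>cdot\<close>\<close>

lemma cmod_p_nonneg: "0 \<le> cmod_p p z"
  by (simp add: cmod_p_def)

lemma cmod_p_scaleR: "0 < p \<Longrightarrow> cmod_p p (s *\<^sub>R z) = \<bar>s\<bar> * cmod_p p z"
  by (simp add: cmod_p_def abs_mult powr_mult powr_powr flip: distrib_left)

text \<open>The constant 2 is crude. It reappears in the thresholds \<delta>/2 for the near part and
  \<delta>/4 for the far part.\<close>

lemma cmod_p_le_cmod:
  assumes "1 \<le> p"
  shows "cmod_p p z \<le> 2 * cmod z"
proof -
  have "\<bar>Re z\<bar> powr p + \<bar>Im z\<bar> powr p \<le> cmod z powr p + cmod z powr p"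
    using assms abs_Re_le_cmod[of z] abs_Im_le_cmod[of z] by (intro add_mono powr_mono2) auto
  then have "cmod_p p z \<le> (2 * cmod z powr p) powr (1 / p)"
    unfolding cmod_p_def using assms by (intro powr_mono2) auto
  also have "\<dots> = 2 powr (1 / p) * cmod z"
    using assms by (simp add: powr_mult powr_powr)
  also have "\<dots> \<le> 2 powr 1 * cmod z"
    using assms by (intro mult_right_mono powr_mono) auto
  finally show ?thesis by simp
qed

lemma cmod_le_cmod_p:
  assumes "0 < p"
  shows "cmod z \<le> 2 * cmod_p p z"
proof -
  have "\<bar>Re z\<bar> = (\<bar>Re z\<bar> powr p) powr (1 / p)" "\<bar>Im z\<bar> = (\<bar>Im z\<bar> powr p) powr (1 / p)"
    using assms by (simp_all add: powr_powr)
  moreover have "(\<bar>Re z\<bar> powr p) powr (1 / p) \<le> cmod_p p z" "(\<bar>Im z\<bar> powr p) powr (1 / p) \<le> cmod_p p z"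
    unfolding cmod_p_def using assms by (intro powr_mono2; simp)+
  ultimately show ?thesis using cmod_le[of z] by linarith
qed

lemma cmod_p_tendsto:
  assumes "0 < p" "(f \<longlongrightarrow> z) F"
  shows "((\<lambda>x. cmod_p p (f x)) \<longlongrightarrow> cmod_p p z) F"
  unfolding cmod_p_def using assms
  by (intro tendsto_powr' tendsto_intros) (auto intro!: always_eventually)

lemma cmod_p_continuous:
  assumes "0 < p"
  shows "continuous_on UNIV (cmod_p p)"
  unfolding continuous_on_def using cmod_p_tendsto[OF assms] by (auto intro: tendsto_ident_at)

lemma cmod_p_measurable [measurable]: "cmod_p p \<in> borel_measurable borel"
  unfolding cmod_p_def[abs_def] by measurable

lemma cdot_scaleR: "cdot v (s *\<^sub>R x) = s *\<^sub>R cdot v x"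
  unfolding cdot_def by (simp add: scaleR_conv_of_real[where 'a=complex] sum_distrib_left mult_ac)

lemma cdot_magnetic_gradient:
  "cdot (magnetic_gradient A u g x) w = cdot (g x) w - \<i> * complex_of_real (A x \<bullet> w) * u x"
  unfolding cdot_def magnetic_gradient_def
  by (simp add: inner_vec_def left_diff_distrib sum_subtractf sum_distrib_left sum_distrib_right algebra_simps)

lemma borel_measurable_vec_nth_comp:
  fixes f :: "'a \<Rightarrow> 'b::real_normed_vector ^ 'n"
  assumes "f \<in> borel_measurable M"
  shows "(\<lambda>x. f x $ j) \<in> borel_measurable M"
  by (rule measurable_compose[OF assms borel_measurable_continuous_onI])
    (intro continuous_intros)

lemma cdot_measurable_comp [measurable (raw)]:
  assumes "f \<in> borel_measurable M" "h \<in> borel_measurable M"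
  shows "(\<lambda>x. cdot (f x) (h x)) \<in> borel_measurable M"
proof -
  have "(\<lambda>x. complex_of_real (h x $ j)) \<in> borel_measurable M" for j
    by (rule measurable_compose[OF borel_measurable_vec_nth_comp[OF assms(2)]]) measurable
  then show ?thesis
    unfolding cdot_def
    by (intro borel_measurable_sum borel_measurable_times borel_measurable_vec_nth_comp[OF assms(1)])
qed

section \<open>Twisted differences of functions with a weak gradient\<close>

lemma test_function_differentiable:
  assumes "test_function \<phi>"
  shows "\<phi> differentiable at x" "partial_deriv j \<phi> differentiable at x"
  using assms[unfolded test_function_def, THEN conjunct1, rule_format, of "[]" x]
    assms[unfolded test_function_def, THEN conjunct1, rule_format, of "[j]" x] by simp_all

lemma test_function_continuous:
  assumes "test_function \<phi>"
  shows "continuous_on UNIV \<phi>" "continuous_on UNIV (partial_deriv j \<phi>)"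
  using test_function_differentiable[OF assms]
  by (auto intro!: differentiable_imp_continuous_on simp: differentiable_on_def intro: differentiable_at_withinI)

lemma test_function_has_derivative:
  fixes \<phi> :: "real^'n \<Rightarrow> real"
  assumes "test_function \<phi>"
  shows "(\<phi> has_derivative (\<lambda>h. \<Sum>j\<in>UNIV. h $ j * partial_deriv j \<phi> x)) (at x)"
proof -
  have D: "(\<phi> has_derivative frechet_derivative \<phi> (at x)) (at x)"
    using test_function_differentiable(1)[OF assms] frechet_derivative_works by blast
  then have lin: "linear (frechet_derivative \<phi> (at x))"
    by (rule has_derivative_linear)
  have "frechet_derivative \<phi> (at x) h = (\<Sum>j\<in>UNIV. h $ j * partial_deriv j \<phi> x)" for h
  proof -
    have "frechet_derivative \<phi> (at x) h = frechet_derivative \<phi> (at x) (\<Sum>j\<in>UNIV. h $ j *\<^sub>R axis j 1)"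
      using basis_expansion[of h] by (simp add: scalar_mult_eq_scaleR)
    also have "\<dots> = (\<Sum>j\<in>UNIV. h $ j * partial_deriv j \<phi> x)"
      by (simp add: linear_sum[OF lin] linear_scale[OF lin] partial_deriv_def)
    finally show ?thesis .
  qed
  then have "frechet_derivative \<phi> (at x) = (\<lambda>h. \<Sum>j\<in>UNIV. h $ j * partial_deriv j \<phi> x)" by blast
  then show ?thesis using D by simp
qed

lemma partial_deriv_shift:
  assumes "\<And>x. f differentiable at x"
  shows "partial_deriv j (\<lambda>x. f (x - h)) = (\<lambda>x. partial_deriv j f (x - h))"
proof
  fix x
  have "((\<lambda>x. f (x - h)) has_derivative (\<lambda>y. frechet_derivative f (at (x - h)) y)) (at x)"
    by (rule has_derivative_compose[of "\<lambda>x. x - h" "\<lambda>y. y"])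
      (use assms frechet_derivative_works in \<open>auto intro!: derivative_eq_intros\<close>)
  then show "partial_deriv j (\<lambda>x. f (x - h)) x = partial_deriv j f (x - h)"
    by (subst partial_deriv_eq) (auto simp: partial_deriv_def)
qed

lemma test_function_shift:
  assumes "test_function \<phi>"
  shows "test_function (\<lambda>x. \<phi> (x - h))"
proof -
  have D: "fold partial_deriv js \<phi> differentiable at x" for js x
    using assms by (simp add: test_function_def)
  have "fold partial_deriv js (\<lambda>x. \<phi> (x - h)) = (\<lambda>x. fold partial_deriv js \<phi> (x - h))" for js
    using D
  proof (induction js arbitrary: \<phi>)
    case (Cons j js)
    have "partial_deriv j (\<lambda>x. \<phi> (x - h)) = (\<lambda>x. partial_deriv j \<phi> (x - h))"
      using Cons.prems[of "[]"] by (intro partial_deriv_shift) simp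
    moreover have "fold partial_deriv ks (partial_deriv j \<phi>) differentiable at x" for ks x
      using Cons.prems[of "j # ks"] by simp
    ultimately show ?case using Cons.IH[of "partial_deriv j \<phi>"] by simp
  qed simp
  moreover have "(\<lambda>x. fold partial_deriv js \<phi> (x - h)) differentiable at x" for js x
    by (rule differentiable_chain_at[of "\<lambda>x. x - h" x "fold partial_deriv js \<phi>", unfolded o_def])
      (use D in \<open>auto intro!: derivative_intros\<close>)
  moreover have "closure {x. \<phi> (x - h) \<noteq> 0} = (+) h ` closure {x. \<phi> x \<noteq> 0}"
  proof -
    have "{x. \<phi> (x - h) \<noteq> 0} = (+) h ` {x. \<phi> x \<noteq> 0}"
      by (force simp: image_iff intro: exI[of _ "_ - h"])
    then show ?thesis by (simp add: closure_translation)
  qed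
  ultimately show ?thesis
    using assms by (auto simp: test_function_def compact_translation)
qed

lemma test_function_support:
  fixes \<phi> :: "real^'n \<Rightarrow> real"
  assumes "test_function \<phi>"
  obtains R where "\<And>x. x \<notin> cball 0 R \<Longrightarrow> \<phi> x = 0 \<and> partial_deriv j \<phi> x = 0"
proof -
  define S where "S = closure {x. \<phi> x \<noteq> 0}"
  have "compact S" using assms by (simp add: test_function_def S_def)
  then have "bounded S" by (rule compact_imp_bounded)
  then obtain R where R: "\<And>x. x \<in> S \<Longrightarrow> norm x \<le> R" by (auto simp: bounded_iff)
  show thesis
  proof
    fix x :: "real^'n" assume "x \<notin> cball 0 R"
    then have x: "x \<in> - S" using R by auto
    have "open (- S)" by (simp add: S_def open_Compl)
    have 0: "\<phi> y = 0" if "y \<in> - S" for y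
      using that closure_subset[of "{x. \<phi> x \<noteq> 0}"] by (auto simp: S_def)
    have "(\<phi> has_derivative (\<lambda>h. 0)) (at x)"
      by (rule has_derivative_transform_within_open[OF has_derivative_const \<open>open (- S)\<close> x]) (simp add: 0)
    then show "\<phi> x = 0 \<and> partial_deriv j \<phi> x = 0"
      using 0[OF x] by (simp add: partial_deriv_eq)
  qed
qed

lemma continuous_compact_support_bounded:
  fixes \<phi> :: "'a::euclidean_space \<Rightarrow> 'b::real_normed_vector"
  assumes "continuous_on UNIV \<phi>" "\<And>x. x \<notin> cball 0 R \<Longrightarrow> \<phi> x = 0"
  obtains B where "0 \<le> B" "\<And>x. norm (\<phi> x) \<le> B * indicator (cball 0 R) x"
proof -
  have "compact (\<phi> ` cball 0 R)"
    by (intro compact_continuous_image continuous_on_subset[OF assms(1)]) auto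
  then obtain B where B: "\<And>x. x \<in> cball 0 R \<Longrightarrow> norm (\<phi> x) \<le> B"
    by (meson bounded_iff compact_imp_bounded imageI)
  show thesis
    by (rule that[of "max 0 B"]) (use B assms(2) in \<open>force simp: indicator_def\<close>)+
qed

text \<open>Supplies the absolute integrability for Fubini in both arrangements, with the
  translation on w or on the test function. In either case the support of \<psi> keeps the argument
  of w in the ball of radius R + |h|, so B times the L1 norm of w on that ball is a bound.\<close>

lemma integrable_line_shift:
  fixes w :: "'a::euclidean_space \<Rightarrow> complex" and \<psi> :: "'a \<Rightarrow> complex" and e :: "real \<Rightarrow> complex"
  assumes w: "\<And>R. integrable lborel (\<lambda>x. indicator (cball 0 R) x *\<^sub>R w x)"
    and [measurable]: "w \<in> borel_measurable borel" "\<psi> \<in> borel_measurable borel" "e \<in> borel_measurable borel"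
    and e: "\<And>s. norm (e s) \<le> 1"
    and \<psi>: "\<And>x. norm (\<psi> x) \<le> B * indicator (cball 0 R) x" and B: "0 \<le> B"
  shows "integrable (lborel \<Otimes>\<^sub>M lborel) (\<lambda>(x, s). \<psi> x * (indicator {0..1} s *\<^sub>R (e s * w (x + s *\<^sub>R h))))"
    "integrable (lborel \<Otimes>\<^sub>M lborel) (\<lambda>(x, s). (indicator {0..1} s *\<^sub>R (e s * \<psi> (x - s *\<^sub>R h))) * w x)"
proof -
  define W where "W x = ennreal (norm (indicator (cball 0 (R + norm h)) x *\<^sub>R w x))" for x
  have [measurable]: "cball 0 r \<in> sets (borel :: 'a measure)" for r by simp
  have [measurable]: "W \<in> borel_measurable borel" unfolding W_def by measurable
  have W: "(\<integral>\<^sup>+x. W x \<partial>lborel) < \<infinity>"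
    using w[of "R + norm h"] by (simp add: W_def integrable_iff_bounded)
  have \<psi>B: "norm (\<psi> x) \<le> B" and \<psi>0: "\<not> norm x \<le> R \<Longrightarrow> \<psi> x = 0" for x
    using \<psi>[of x] B by (cases "norm x \<le> R"; simp)+
  have ball: "norm x \<le> R \<Longrightarrow> s \<in> {0..1} \<Longrightarrow> norm (x + s *\<^sub>R h) \<le> R + norm h" for x s
    by (rule norm_triangle_le) (auto intro!: add_mono mult_left_le_one_le)
  have fin: "(\<integral>\<^sup>+(s::real). (\<integral>\<^sup>+x. ennreal B * (W x * indicator {0..1} s) \<partial>lborel) \<partial>lborel) < \<infinity>"
    using W by (simp add: nn_integral_cmult nn_integral_multc ennreal_mult_less_top)
  show "integrable (lborel \<Otimes>\<^sub>M lborel) (\<lambda>(x, s). \<psi> x * (indicator {0..1} s *\<^sub>R (e s * w (x + s *\<^sub>R h))))"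
  proof (rule integrableI_bounded)
    have "(\<integral>\<^sup>+z. ennreal (norm (case z of (x, s) \<Rightarrow> \<psi> x * (indicator {0..1} s *\<^sub>R (e s * w (x + s *\<^sub>R h))))) \<partial>(lborel \<Otimes>\<^sub>M lborel))
        = (\<integral>\<^sup>+(s::real). (\<integral>\<^sup>+x. ennreal (norm (\<psi> x * (indicator {0..1} s *\<^sub>R (e s * w (x + s *\<^sub>R h))))) \<partial>lborel) \<partial>lborel)"
      by (subst lborel_pair.nn_integral_snd[symmetric]) auto
    also have "\<dots> \<le> (\<integral>\<^sup>+(s::real). (\<integral>\<^sup>+x. ennreal B * (W (x + s *\<^sub>R h) * indicator {0..1} s) \<partial>lborel) \<partial>lborel)"
    proof (intro nn_integral_mono)
      fix s x
      have "norm (\<psi> x) * (norm (e s) * norm (w (x + s *\<^sub>R h))) \<le> B * (1 * norm (w (x + s *\<^sub>R h)))"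
        using \<psi>B e[of s] B by (intro mult_mono) auto
      then show "ennreal (norm (\<psi> x * (indicator {0..1} s *\<^sub>R (e s * w (x + s *\<^sub>R h)))))
        \<le> ennreal B * (W (x + s *\<^sub>R h) * indicator {0..1} s)"
        using ball[of x s] B \<psi>0[of x]
        by (cases "norm x \<le> R"; cases "s \<in> {0..1}")
          (auto simp: W_def norm_mult indicator_def split: if_splits simp flip: ennreal_mult)
    qed
    also have "\<dots> = (\<integral>\<^sup>+(s::real). (\<integral>\<^sup>+x. ennreal B * (W x * indicator {0..1} s) \<partial>lborel) \<partial>lborel)"
      by (simp add: nn_integral_cmult nn_integral_multc nn_integral_shift)
    finally show "(\<integral>\<^sup>+z. ennreal (norm (case z of (x, s) \<Rightarrow> \<psi> x * (indicator {0..1} s *\<^sub>R (e s * w (x + s *\<^sub>R h))))) \<partial>(lborel \<Otimes>\<^sub>M lborel)) < \<infinity>"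
      using fin by (rule order_le_less_trans)
  qed measurable
  show "integrable (lborel \<Otimes>\<^sub>M lborel) (\<lambda>(x, s). (indicator {0..1} s *\<^sub>R (e s * \<psi> (x - s *\<^sub>R h))) * w x)"
  proof (rule integrableI_bounded)
    have "(\<integral>\<^sup>+z. ennreal (norm (case z of (x, s) \<Rightarrow> (indicator {0..1} s *\<^sub>R (e s * \<psi> (x - s *\<^sub>R h))) * w x)) \<partial>(lborel \<Otimes>\<^sub>M lborel))
        = (\<integral>\<^sup>+(s::real). (\<integral>\<^sup>+x. ennreal (norm ((indicator {0..1} s *\<^sub>R (e s * \<psi> (x - s *\<^sub>R h))) * w x)) \<partial>lborel) \<partial>lborel)"
      by (subst lborel_pair.nn_integral_snd[symmetric]) auto
    also have "\<dots> \<le> (\<integral>\<^sup>+(s::real). (\<integral>\<^sup>+x. ennreal B * (W x * indicator {0..1} s) \<partial>lborel) \<partial>lborel)"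
    proof (intro nn_integral_mono)
      fix s x
      have "norm (e s) * norm (\<psi> (x - s *\<^sub>R h)) * norm (w x) \<le> 1 * B * norm (w x)"
        using \<psi>B e[of s] B by (intro mult_mono) auto
      then show "ennreal (norm ((indicator {0..1} s *\<^sub>R (e s * \<psi> (x - s *\<^sub>R h))) * w x))
        \<le> ennreal B * (W x * indicator {0..1} s)"
        using ball[of "x - s *\<^sub>R h" s] B \<psi>0[of "x - s *\<^sub>R h"]
        by (cases "norm (x - s *\<^sub>R h) \<le> R"; cases "s \<in> {0..1}")
          (auto simp: W_def norm_mult indicator_def split: if_splits simp flip: ennreal_mult)
    qed
    finally show "(\<integral>\<^sup>+z. ennreal (norm (case z of (x, s) \<Rightarrow> (indicator {0..1} s *\<^sub>R (e s * \<psi> (x - s *\<^sub>R h))) * w x)) \<partial>(lborel \<Otimes>\<^sub>M lborel)) < \<infinity>"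
      using fin by (rule order_le_less_trans)
  qed measurable
qed

lemma cdot_integrable:
  fixes g :: "real^'n \<Rightarrow> complex^'n"
  assumes g_int: "\<And>R j. integrable lborel (\<lambda>x. indicator (cball 0 R) x *\<^sub>R (g x $ j))"
  shows "integrable lborel (\<lambda>x. indicator (cball 0 R) x *\<^sub>R cdot (g x) h)"
proof -
  have "integrable lborel (\<lambda>x. \<Sum>j\<in>UNIV. (indicator (cball 0 R) x *\<^sub>R (g x $ j)) * complex_of_real (h $ j))"
    by (intro Bochner_Integration.integrable_sum integrable_mult_left g_int)
  then show ?thesis by (simp add: cdot_def scaleR_sum_right)
qed

lemma integrable_bounded_mult:
  fixes w \<psi> :: "real^'n \<Rightarrow> complex"
  assumes w: "integrable lborel (\<lambda>x. indicator (cball 0 R) x *\<^sub>R w x)"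
    and [measurable]: "w \<in> borel_measurable borel" "\<psi> \<in> borel_measurable borel"
    and \<psi>: "\<And>x. norm (\<psi> x) \<le> B * indicator (cball 0 R) x" and B: "0 \<le> B"
  shows "integrable lborel (\<lambda>x. \<psi> x * w x)"
proof (rule Bochner_Integration.integrable_bound)
  show "integrable lborel (\<lambda>x. B *\<^sub>R (indicator (cball 0 R) x *\<^sub>R w x))"
    by (intro integrable_scaleR_right w)
  show "AE x in lborel. norm (\<psi> x * w x) \<le> norm (B *\<^sub>R (indicator (cball 0 R) x *\<^sub>R w x))"
  proof (rule AE_I2)
    fix x
    show "norm (\<psi> x * w x) \<le> norm (B *\<^sub>R (indicator (cball 0 R) x *\<^sub>R w x))"
      using mult_right_mono[OF \<psi>[of x], of "norm (w x)"] B by (simp add: norm_mult mult_ac)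
  qed
qed measurable

lemma loc_integrable_shift:
  fixes v :: "real^'n \<Rightarrow> complex"
  assumes "\<And>R. integrable lborel (\<lambda>x. indicator (cball 0 R) x *\<^sub>R v x)" and [measurable]: "v \<in> borel_measurable borel"
  shows "integrable lborel (\<lambda>x. indicator (cball 0 R) x *\<^sub>R v (x + h))"
proof (rule Bochner_Integration.integrable_bound)
  show "integrable lborel (\<lambda>x. indicator (cball 0 (R + norm h)) (x + h) *\<^sub>R v (x + h))"
    by (rule integrable_shift[of "\<lambda>x. indicator (cball 0 (R + norm h)) x *\<^sub>R v x"]) (rule assms)
  have [measurable]: "cball 0 r \<in> sets (borel :: (real^'n) measure)" for r by simp
  show "(\<lambda>x. indicator (cball 0 R) x *\<^sub>R v (x + h)) \<in> borel_measurable lborel" by measurable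
  show "AE x in lborel. norm (indicator (cball 0 R) x *\<^sub>R v (x + h))
      \<le> norm (indicator (cball 0 (R + norm h)) (x + h) *\<^sub>R v (x + h))"
  proof (rule AE_I2)
    fix x
    show "norm (indicator (cball 0 R) x *\<^sub>R v (x + h)) \<le> norm (indicator (cball 0 (R + norm h)) (x + h) *\<^sub>R v (x + h))"
      using norm_triangle_ineq[of x h] by (simp add: indicator_def)
  qed
qed

text \<open>Fubini on a ball, with the indicator of the ball as test function and trivial phase,
  gives integrable sections for almost every x; balls of integer radius exhaust the space.\<close>

lemma AE_integrable_line:
  fixes h :: "real^'n" and v :: "real^'n \<Rightarrow> complex"
  assumes v: "\<And>R. integrable lborel (\<lambda>x. indicator (cball 0 R) x *\<^sub>R v x)" and [measurable]: "v \<in> borel_measurable borel"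
  shows "AE x in lborel. integrable lborel (\<lambda>s. indicator {0..1} s *\<^sub>R v (x + s *\<^sub>R h))"
proof -
  have [measurable]: "cball 0 r \<in> sets (borel :: (real^'n) measure)" for r by simp
  have "AE x in lborel. integrable lborel (\<lambda>s. (indicator (cball 0 (real n)) x :: complex) * (indicator {0..1} s *\<^sub>R (1 * v (x + s *\<^sub>R h))))" for n
  proof -
    have "integrable (lborel \<Otimes>\<^sub>M lborel) (\<lambda>(x, s). (indicator (cball 0 (real n)) x :: complex) * (indicator {0..1} s *\<^sub>R ((\<lambda>s. 1) s * v (x + s *\<^sub>R h))))"
      by (rule integrable_line_shift(1)[OF v, where B=1 and R="real n"]) (simp_all add: indicator_def)
    from lborel_pair.AE_integrable_fst'[OF this] show ?thesis by simp
  qed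
  then have "AE x in lborel. \<forall>n. integrable lborel (\<lambda>s. (indicator (cball 0 (real n)) x :: complex) * (indicator {0..1} s *\<^sub>R (1 * v (x + s *\<^sub>R h))))"
    by (subst AE_all_countable) blast
  then show ?thesis
  proof eventually_elim
    case (elim x)
    obtain n :: nat where n: "norm x \<le> real n" using real_arch_simple by blast
    show ?case using elim[rule_format, of n] n by simp
  qed
qed

section \<open>The difference formula for functions with a weak gradient\<close>

context
  fixes u :: "real^'n \<Rightarrow> complex" and g :: "real^'n \<Rightarrow> complex^'n"
  assumes u_int: "\<And>R. integrable lborel (\<lambda>x. indicator (cball 0 R) x *\<^sub>R u x)"
    and g_int: "\<And>R j. integrable lborel (\<lambda>x. indicator (cball 0 R) x *\<^sub>R (g x $ j))"
    and [measurable]: "u \<in> borel_measurable borel"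
    and g_meas [measurable]: "g \<in> borel_measurable borel"
    and weak: "\<forall>\<phi> j. test_function \<phi> \<longrightarrow>
        (LINT x|lborel. u x * complex_of_real (partial_deriv j \<phi> x)) =
        - (LINT x|lborel. g x $ j * complex_of_real (\<phi> x))"
begin

text \<open>Testing against \<open>\<phi>\<close> moves the translation onto \<open>\<phi>\<close>; along the segment the twisted test function
  \<open>exp (- \<i> s c) * \<phi> (x - s h)\<close> obeys the fundamental theorem of calculus, and the weak gradient
  converts its derivative back.\<close>

lemma twisted_difference_test:
  fixes \<phi> :: "real^'n \<Rightarrow> real" and c :: real and h :: "real^'n"
  assumes \<phi>: "test_function \<phi>"
  defines "e \<equiv> \<lambda>s. exp (- (\<i> * complex_of_real (s * c)))"
  defines "w \<equiv> \<lambda>x. cdot (g x) h - \<i> * complex_of_real c * u x"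
  shows "(LINT x|lborel. \<phi> x *\<^sub>R (e 1 * u (x + h) - u x - (LINT s|lborel. indicator {0..1} s *\<^sub>R (e s * w (x + s *\<^sub>R h))))) = 0"
proof -
  \<comment> \<open>One radius serves \<phi> and all its first partial derivatives, because there
    are finitely many indices.\<close>
  obtain R0 where R0: "\<And>j x. x \<notin> cball 0 R0 \<Longrightarrow> \<phi> x = 0 \<and> partial_deriv j \<phi> x = 0"
  proof -
    obtain R where "\<And>x. x \<notin> cball 0 R \<Longrightarrow> \<phi> x = 0"
      using test_function_support[OF \<phi>] by metis
    moreover have "\<exists>R. \<forall>x. x \<notin> cball 0 R \<longrightarrow> partial_deriv j \<phi> x = 0" for j
      using test_function_support[OF \<phi>, of j] by metis
    then obtain Q where "\<And>j x. x \<notin> cball 0 (Q j) \<Longrightarrow> partial_deriv j \<phi> x = 0" by metis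
    ultimately show thesis
      using that[of "Max (insert R (range Q))"] by (auto simp: not_le)
  qed
  have cont: "continuous_on UNIV \<phi>" "continuous_on UNIV (partial_deriv j \<phi>)" for j
    using test_function_continuous[OF \<phi>] by auto
  have [measurable]: "\<phi> \<in> borel_measurable borel" "partial_deriv j \<phi> \<in> borel_measurable borel" for j
    using cont by (auto intro!: borel_measurable_continuous_onI)
  have [measurable]: "e \<in> borel_measurable borel" "w \<in> borel_measurable borel"
    unfolding e_def w_def by measurable
  have e1: "norm (e s) \<le> 1" for s by (simp add: e_def)
  have w_int: "integrable lborel (\<lambda>x. indicator (cball 0 R) x *\<^sub>R w x)" for R
    unfolding w_def scaleR_diff_right
    using u_int[of R, THEN integrable_mult_right, of "\<i> * complex_of_real c"]
    by (intro Bochner_Integration.integrable_diff cdot_integrable g_int) simp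
  define D where "D x = (\<Sum>j\<in>UNIV. h $ j * partial_deriv j \<phi> x)" for x
  \<comment> \<open>\<open>D\<close> is the derivative of \<phi> in direction h, and \<psi> is
    chosen so that e s * \<psi> (x - s h) is the s-derivative of - e s * \<phi> (x - s h).\<close>
  define \<psi> where "\<psi> x = complex_of_real (D x) + \<i> * complex_of_real c * complex_of_real (\<phi> x)" for x
  have \<psi>_cont: "continuous_on UNIV \<psi>"
    unfolding \<psi>_def D_def by (intro continuous_intros cont)
  have [measurable]: "\<psi> \<in> borel_measurable borel"
    using \<psi>_cont by (rule borel_measurable_continuous_onI)
  obtain B where B: "0 \<le> B" "\<And>x. norm (complex_of_real (\<phi> x)) \<le> B * indicator (cball 0 R0) x"
    using continuous_compact_support_bounded[of "\<lambda>x. complex_of_real (\<phi> x)" R0] R0 cont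
    by (metis continuous_on_of_real of_real_0)
  obtain C where C: "0 \<le> C" "\<And>x. norm (\<psi> x) \<le> C * indicator (cball 0 R0) x"
  proof (rule continuous_compact_support_bounded[of \<psi> R0])
    show "\<psi> x = 0" if "x \<notin> cball 0 R0" for x
      using R0[OF that] by (simp add: \<psi>_def D_def)
  qed (use \<psi>_cont that in auto)
  have bump: "norm (complex_of_real (\<phi> (x - a))) \<le> B * indicator (cball 0 (R0 + norm a)) x" for x a
    using B(2)[of "x - a"] B(1) norm_triangle_sub[of x a]
      by (cases "norm (x - a) \<le> R0") (auto simp: indicator_def)
  define G where "G x = (LINT s|lborel. indicator {0..1} s *\<^sub>R (e s * w (x + s *\<^sub>R h)))" for x
  have P1: "integrable (lborel \<Otimes>\<^sub>M lborel) (\<lambda>(x, s). complex_of_real (\<phi> x) * (indicator {0..1} s *\<^sub>R (e s * w (x + s *\<^sub>R h))))"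
    by (rule integrable_line_shift(1)[OF w_int _ _ _ e1 B(2) B(1)]) measurable
  have P2: "integrable (lborel \<Otimes>\<^sub>M lborel) (\<lambda>(x, s). (indicator {0..1} s *\<^sub>R (e s * \<psi> (x - s *\<^sub>R h))) * u x)"
    by (rule integrable_line_shift(2)[OF u_int _ _ _ e1 C(2) C(1)]) measurable
  have G_int: "integrable lborel (\<lambda>x. complex_of_real (\<phi> x) * G x)"
    using lborel_pair.integrable_fst'[OF P1] by (simp add: G_def del: mult_scaleR_right)
  have u0: "integrable lborel (\<lambda>x. complex_of_real (\<phi> x) * u x)"
    by (rule integrable_bounded_mult[OF u_int _ _ B(2) B(1)]) measurable
  have shifted: "integrable lborel (\<lambda>x. complex_of_real (\<phi> (x - a)) * v x)"
    if "\<And>R. integrable lborel (\<lambda>x. indicator (cball 0 R) x *\<^sub>R v x)" and [measurable]: "v \<in> borel_measurable borel" for a and v :: "real^'n \<Rightarrow> complex"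
    by (rule integrable_bounded_mult[OF that(1) _ _ bump B(1)]) measurable
  have shifted': "integrable lborel (\<lambda>x. complex_of_real (partial_deriv j \<phi> (x - a)) * u x)" for a j
  proof -
    obtain B' where B': "0 \<le> B'" "\<And>x. norm (complex_of_real (partial_deriv j \<phi> x)) \<le> B' * indicator (cball 0 R0) x"
      using continuous_compact_support_bounded[of "\<lambda>x. complex_of_real (partial_deriv j \<phi> x)" R0] R0 cont
      by (metis continuous_on_of_real of_real_0)
    have "norm (complex_of_real (partial_deriv j \<phi> (x - a))) \<le> B' * indicator (cball 0 (R0 + norm a)) x" for x
      using B'(2)[of "x - a"] B'(1) norm_triangle_sub[of x a]
      by (cases "norm (x - a) \<le> R0") (auto simp: indicator_def)
    from integrable_bounded_mult[OF u_int _ _ this B'(1)] show ?thesis by measurable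
  qed
  \<comment> \<open>A change of variables puts the shift on \<phi>, which remains a test function.
    The weak gradient trades \<open>cdot (g x) h\<close> for -\<open>D\<close>, and the term with c
    joins it to form -\<psi>.\<close>
  have weak_w: "(LINT x|lborel. complex_of_real (\<phi> x) * w (x + a)) = - (LINT x|lborel. \<psi> (x - a) * u x)" for a
  proof -
    have t: "test_function (\<lambda>x. \<phi> (x - a))" by (rule test_function_shift[OF \<phi>])
    have pd: "partial_deriv j (\<lambda>x. \<phi> (x - a)) x = partial_deriv j \<phi> (x - a)" for j x
      using partial_deriv_shift[of \<phi> j a] test_function_differentiable(1)[OF \<phi>] by simp
    have "(LINT x|lborel. complex_of_real (\<phi> x) * w (x + a)) = (LINT x|lborel. complex_of_real (\<phi> (x - a)) * w x)"
      using integral_shift[of "\<lambda>x. complex_of_real (\<phi> (x - a)) * w x" a] by simp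
    also have "\<dots> = (LINT x|lborel. (\<Sum>j\<in>UNIV. complex_of_real (h $ j) * (complex_of_real (\<phi> (x - a)) * g x $ j))
        - \<i> * complex_of_real c * (complex_of_real (\<phi> (x - a)) * u x))"
      by (intro Bochner_Integration.integral_cong refl)
        (simp add: w_def cdot_def right_diff_distrib sum_distrib_left mult_ac)
    also have "\<dots> = (\<Sum>j\<in>UNIV. complex_of_real (h $ j) * (LINT x|lborel. complex_of_real (\<phi> (x - a)) * g x $ j))
        - \<i> * complex_of_real c * (LINT x|lborel. complex_of_real (\<phi> (x - a)) * u x)"
      using shifted[OF u_int, of a] shifted[OF g_int borel_measurable_vec_nth_comp[OF g_meas], where a=a] by simp
    also have "\<dots> = (\<Sum>j\<in>UNIV. complex_of_real (h $ j) * - (LINT x|lborel. complex_of_real (partial_deriv j \<phi> (x - a)) * u x))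
        - \<i> * complex_of_real c * (LINT x|lborel. complex_of_real (\<phi> (x - a)) * u x)"
      using weak[rule_format, OF t] by (simp add: pd mult.commute)
    also have "\<dots> = - (LINT x|lborel. (\<Sum>j\<in>UNIV. complex_of_real (h $ j) * (complex_of_real (partial_deriv j \<phi> (x - a)) * u x))
        + \<i> * complex_of_real c * (complex_of_real (\<phi> (x - a)) * u x))"
      using shifted[OF u_int, of a] shifted'[of _ a] by (simp add: sum_negf)
    also have "\<dots> = - (LINT x|lborel. \<psi> (x - a) * u x)"
      by (simp add: \<psi>_def D_def algebra_simps sum_distrib_left)
    finally show ?thesis .
  qed
  have FTC: "(LINT s|lborel. indicator {0..1} s *\<^sub>R (e s * \<psi> (x - s *\<^sub>R h)))
      = complex_of_real (\<phi> x) - e 1 * complex_of_real (\<phi> (x - h))" for x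
  proof -
    define F where "F s = - (e s * complex_of_real (\<phi> (x - s *\<^sub>R h)))" for s
    have "(LINT s|lborel. indicator {0..1} s *\<^sub>R (e s * \<psi> (x - s *\<^sub>R h))) = F 1 - F 0"
    proof (rule integral_FTC_atLeastAtMost)
      fix s :: real
      have "((\<lambda>s. \<phi> (x - s *\<^sub>R h)) has_derivative (\<lambda>t. D (x - s *\<^sub>R h) * - t)) (at s)"
      proof -
        have "((\<lambda>s. x - s *\<^sub>R h) has_derivative (\<lambda>t. - (t *\<^sub>R h))) (at s)"
          by (auto intro!: derivative_eq_intros)
        from has_derivative_compose[OF this test_function_has_derivative[OF \<phi>]]
        show ?thesis by (simp add: D_def sum_distrib_right sum_distrib_left sum_negf mult_ac)
      qed
      then have "((\<lambda>s. \<phi> (x - s *\<^sub>R h)) has_real_derivative - D (x - s *\<^sub>R h)) (at s)"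
        by (rule has_derivative_imp_has_field_derivative) (simp add: mult.commute)
      then have 1: "((\<lambda>s. complex_of_real (\<phi> (x - s *\<^sub>R h))) has_vector_derivative complex_of_real (- D (x - s *\<^sub>R h))) (at s)"
        by (rule has_vector_derivative_of_real)
      have 2: "(e has_vector_derivative (- (\<i> * complex_of_real c) * e s)) (at s)"
      proof -
        have "((\<lambda>z. exp (- (\<i> * (z * complex_of_real c)))) has_field_derivative
            - (\<i> * complex_of_real c) * exp (- (\<i> * (complex_of_real s * complex_of_real c)))) (at (complex_of_real s))"
          by (auto intro!: derivative_eq_intros)
        from has_vector_derivative_real_field[OF this] show ?thesis by (simp add: e_def)
      qed
      have "(F has_vector_derivative - (e s * complex_of_real (- D (x - s *\<^sub>R h)) + (- (\<i> * complex_of_real c) * e s) * complex_of_real (\<phi> (x - s *\<^sub>R h)))) (at s)"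
        unfolding F_def by (intro has_vector_derivative_minus has_vector_derivative_mult 1 2)
      then show "(F has_vector_derivative e s * \<psi> (x - s *\<^sub>R h)) (at s within {0..1})"
        by (rule has_vector_derivative_at_within[THEN has_vector_derivative_eq_rhs]) (simp add: \<psi>_def algebra_simps)
      show "continuous_on {0..1} (\<lambda>s. e s * \<psi> (x - s *\<^sub>R h))"
      proof (rule continuous_on_mult)
        show "continuous_on {0..1} e" unfolding e_def
          by (intro continuous_on_exp continuous_on_minus continuous_on_mult continuous_on_const continuous_on_of_real continuous_on_id)
        show "continuous_on {0..1} (\<lambda>s. \<psi> (x - s *\<^sub>R h))"
          by (rule continuous_on_compose2[OF \<psi>_cont]) (auto intro!: continuous_intros)
      qed
    qed simp
    then show ?thesis by (simp add: F_def e_def)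
  qed
  have uh0: "integrable lborel (\<lambda>x. complex_of_real (\<phi> (x - h)) * u x)"
    by (rule shifted[OF u_int]) measurable
  \<comment> \<open>The chain exchanges the integrals, applies \<open>weak_w\<close> with a = s h
    for each s, exchanges back, and evaluates the integral in s by \<open>FTC\<close>.\<close>
  have "(LINT x|lborel. complex_of_real (\<phi> x) * G x)
      = (LINT x|lborel. (LINT s|lborel. complex_of_real (\<phi> x) * (indicator {0..1} s *\<^sub>R (e s * w (x + s *\<^sub>R h)))))"
    unfolding G_def by (subst integral_mult_right_zero) (rule refl)
  also have "\<dots> = (LINT s|lborel. (LINT x|lborel. complex_of_real (\<phi> x) * (indicator {0..1} s *\<^sub>R (e s * w (x + s *\<^sub>R h)))))"
    by (rule lborel_pair.Fubini_integral[symmetric]) (rule P1)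
  also have "\<dots> = (LINT s|lborel. (indicator {0..1} s *\<^sub>R e s) * (LINT x|lborel. complex_of_real (\<phi> x) * w (x + s *\<^sub>R h)))"
  proof (rule Bochner_Integration.integral_cong[OF refl])
    fix s :: real
    have "(\<lambda>x. complex_of_real (\<phi> x) * (indicator {0..1} s *\<^sub>R (e s * w (x + s *\<^sub>R h))))
        = (\<lambda>x. (indicator {0..1} s *\<^sub>R e s) * (complex_of_real (\<phi> x) * w (x + s *\<^sub>R h)))"
      by (simp add: fun_eq_iff mult_ac)
    then show "(LINT x|lborel. complex_of_real (\<phi> x) * (indicator {0..1} s *\<^sub>R (e s * w (x + s *\<^sub>R h))))
        = (indicator {0..1} s *\<^sub>R e s) * (LINT x|lborel. complex_of_real (\<phi> x) * w (x + s *\<^sub>R h))"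
      by (simp only: integral_mult_right_zero)
  qed
  also have "\<dots> = - (LINT s|lborel. (indicator {0..1} s *\<^sub>R e s) * (LINT x|lborel. \<psi> (x - s *\<^sub>R h) * u x))"
    by (simp only: weak_w mult_minus_right Bochner_Integration.integral_minus)
  also have "\<dots> = - (LINT s|lborel. (LINT x|lborel. (indicator {0..1} s *\<^sub>R (e s * \<psi> (x - s *\<^sub>R h))) * u x))"
  proof -
    have "(indicator {0..1} s *\<^sub>R e s) * (LINT x|lborel. \<psi> (x - s *\<^sub>R h) * u x)
        = (LINT x|lborel. (indicator {0..1} s *\<^sub>R (e s * \<psi> (x - s *\<^sub>R h))) * u x)" for s
    proof -
      have "(\<lambda>x. (indicator {0..1} s *\<^sub>R (e s * \<psi> (x - s *\<^sub>R h))) * u x)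
          = (\<lambda>x. (indicator {0..1} s *\<^sub>R e s) * (\<psi> (x - s *\<^sub>R h) * u x))"
        by (simp add: fun_eq_iff mult.assoc)
      then show ?thesis by (simp only: integral_mult_right_zero)
    qed
    then show ?thesis by (simp only:)
  qed
  also have "\<dots> = - (LINT x|lborel. (LINT s|lborel. (indicator {0..1} s *\<^sub>R (e s * \<psi> (x - s *\<^sub>R h))) * u x))"
    by (simp only: lborel_pair.Fubini_integral[OF P2])
  also have "\<dots> = - (LINT x|lborel. (complex_of_real (\<phi> x) - e 1 * complex_of_real (\<phi> (x - h))) * u x)"
    by (simp only: integral_mult_left_zero FTC)
  also have "\<dots> = e 1 * (LINT x|lborel. complex_of_real (\<phi> (x - h)) * u x) - (LINT x|lborel. complex_of_real (\<phi> x) * u x)"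
  proof -
    have "(\<lambda>x. (complex_of_real (\<phi> x) - e 1 * complex_of_real (\<phi> (x - h))) * u x)
        = (\<lambda>x. complex_of_real (\<phi> x) * u x - e 1 * (complex_of_real (\<phi> (x - h)) * u x))"
      by (simp add: fun_eq_iff left_diff_distrib mult.assoc)
    moreover have "(LINT x|lborel. complex_of_real (\<phi> x) * u x - e 1 * (complex_of_real (\<phi> (x - h)) * u x))
        = (LINT x|lborel. complex_of_real (\<phi> x) * u x) - (LINT x|lborel. e 1 * (complex_of_real (\<phi> (x - h)) * u x))"
      by (intro Bochner_Integration.integral_diff u0 integrable_mult_right uh0)
    ultimately show ?thesis by (simp only: integral_mult_right_zero minus_diff_eq)
  qed
  finally have "(LINT x|lborel. complex_of_real (\<phi> x) * G x)
      = e 1 * (LINT x|lborel. complex_of_real (\<phi> (x - h)) * u x) - (LINT x|lborel. complex_of_real (\<phi> x) * u x)" .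
  moreover have "(LINT x|lborel. complex_of_real (\<phi> (x - h)) * u x) = (LINT x|lborel. complex_of_real (\<phi> x) * u (x + h))"
    using integral_shift[of "\<lambda>x. complex_of_real (\<phi> (x - h)) * u x" h] by simp
  ultimately have main: "(LINT x|lborel. complex_of_real (\<phi> x) * G x)
      = e 1 * (LINT x|lborel. complex_of_real (\<phi> x) * u (x + h)) - (LINT x|lborel. complex_of_real (\<phi> x) * u x)"
    by (simp only:)
  have uh1: "integrable lborel (\<lambda>x. complex_of_real (\<phi> x) * u (x + h))"
    using integrable_shift[OF uh0, of h] by simp
  have "(LINT x|lborel. \<phi> x *\<^sub>R (e 1 * u (x + h) - u x - G x))
      = (LINT x|lborel. e 1 * (complex_of_real (\<phi> x) * u (x + h)) - complex_of_real (\<phi> x) * u x - complex_of_real (\<phi> x) * G x)"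
    by (rule Bochner_Integration.integral_cong[OF refl]) (simp add: scaleR_conv_of_real[where 'a=complex] algebra_simps)
  also have "\<dots> = (LINT x|lborel. e 1 * (complex_of_real (\<phi> x) * u (x + h)) - complex_of_real (\<phi> x) * u x)
      - (LINT x|lborel. complex_of_real (\<phi> x) * G x)"
    by (rule Bochner_Integration.integral_diff[OF Bochner_Integration.integrable_diff[OF integrable_mult_right[OF uh1] u0] G_int])
  also have "\<dots> = 0"
  proof -
    have "(LINT x|lborel. e 1 * (complex_of_real (\<phi> x) * u (x + h)) - complex_of_real (\<phi> x) * u x)
      = (LINT x|lborel. e 1 * (complex_of_real (\<phi> x) * u (x + h))) - (LINT x|lborel. complex_of_real (\<phi> x) * u x)"
      by (rule Bochner_Integration.integral_diff[OF integrable_mult_right[OF uh1] u0])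
    moreover have "(LINT x|lborel. e 1 * (complex_of_real (\<phi> x) * u (x + h))) = e 1 * (LINT x|lborel. complex_of_real (\<phi> x) * u (x + h))"
      by (rule integral_mult_right_zero)
    ultimately show ?thesis by (simp only: main diff_self)
  qed
  finally have "(LINT x|lborel. \<phi> x *\<^sub>R (e 1 * u (x + h) - u x - G x)) = 0" .
  then show ?thesis by (simp only: G_def)
qed

text \<open>For constant c both sides are locally integrable in x, so
  \<open>twisted_difference_test\<close> combines with the fundamental lemma. The exceptional null
  set obtained this way may depend on c.\<close>

lemma AE_twisted_difference_fixed:
  fixes h :: "real^'n" and c :: real
  shows "AE x in lborel. exp (- (\<i> * complex_of_real c)) * u (x + h) - u x
    = (LINT s|lborel. indicator {0..1} s *\<^sub>R (exp (- (\<i> * complex_of_real (s * c))) *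
        (cdot (g (x + s *\<^sub>R h)) h - \<i> * complex_of_real c * u (x + s *\<^sub>R h))))"
proof -
  define e where "e s = exp (- (\<i> * complex_of_real (s * c)))" for s
  define w where "w x = cdot (g x) h - \<i> * complex_of_real c * u x" for x
  have [measurable]: "e \<in> borel_measurable borel" "w \<in> borel_measurable borel"
    unfolding e_def w_def by measurable
  have e1: "norm (e s) \<le> 1" for s by (simp add: e_def)
  have w_int: "integrable lborel (\<lambda>x. indicator (cball 0 R) x *\<^sub>R w x)" for R
    unfolding w_def scaleR_diff_right
    using u_int[of R, THEN integrable_mult_right, of "\<i> * complex_of_real c"]
    by (intro Bochner_Integration.integrable_diff cdot_integrable g_int) simp
  define G where "G x = (LINT s|lborel. indicator {0..1} s *\<^sub>R (e s * w (x + s *\<^sub>R h)))" for x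
  have [measurable]: "cball 0 r \<in> sets (borel :: (real^'n) measure)" for r by simp
  have [measurable]: "G \<in> borel_measurable borel" unfolding G_def by measurable
  have G_int: "integrable lborel (\<lambda>x. indicator (cball 0 R) x *\<^sub>R G x)" for R
  proof -
    have "integrable (lborel \<Otimes>\<^sub>M lborel) (\<lambda>(x, s). (indicator (cball 0 R) x :: complex) * (indicator {0..1} s *\<^sub>R (e s * w (x + s *\<^sub>R h))))"
      by (rule integrable_line_shift(1)[OF w_int _ _ _ e1, where B=1 and R=R]) (simp_all add: indicator_def)
    from lborel_pair.integrable_fst'[OF this]
    have "integrable lborel (\<lambda>x. (indicator (cball 0 R) x :: complex) * G x)"
      by (simp add: G_def del: mult_scaleR_right)
    moreover have "(\<lambda>x. (indicator (cball 0 R) x :: complex) * G x) = (\<lambda>x. indicator (cball 0 R) x *\<^sub>R G x)"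
      by (auto simp: fun_eq_iff indicator_def)
    ultimately show ?thesis by simp
  qed
  have "AE x in lborel. e 1 * u (x + h) - u x - G x = 0"
  proof (rule AE_zero_of_test_functions)
    show "integrable lborel (\<lambda>x. indicator (cball 0 R) x *\<^sub>R (e 1 * u (x + h) - u x - G x))" for R
      unfolding scaleR_diff_right
      using loc_integrable_shift[OF u_int, of R h, THEN integrable_mult_right, of "e 1"]
      by (intro Bochner_Integration.integrable_diff G_int u_int) simp_all
    show "(LINT x|lborel. \<phi> x *\<^sub>R (e 1 * u (x + h) - u x - G x)) = 0" if "test_function \<phi>" for \<phi>
      using twisted_difference_test[OF that, of c h] by (simp add: e_def w_def G_def)
  qed measurable
  then show ?thesis by eventually_elim (simp add: e_def w_def G_def)
qed

text \<open>The value c = h . A (x + h/2) used later depends on x, so one null set must serve all c.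
  It is collected over rational c; the remaining c follow because both sides are continuous in c
  whenever u and the h-component of g are integrable along the segment.\<close>

lemma AE_twisted_difference:
  fixes h :: "real^'n"
  shows "AE x in lborel. \<forall>c. exp (- (\<i> * complex_of_real c)) * u (x + h) - u x
    = (LINT s|lborel. indicator {0..1} s *\<^sub>R (exp (- (\<i> * complex_of_real (s * c))) *
        (cdot (g (x + s *\<^sub>R h)) h - \<i> * complex_of_real c * u (x + s *\<^sub>R h))))"
proof -
  have "AE x in lborel. \<forall>c\<in>\<rat>. exp (- (\<i> * complex_of_real c)) * u (x + h) - u x
    = (LINT s|lborel. indicator {0..1} s *\<^sub>R (exp (- (\<i> * complex_of_real (s * c))) *
        (cdot (g (x + s *\<^sub>R h)) h - \<i> * complex_of_real c * u (x + s *\<^sub>R h))))"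
    by (subst AE_ball_countable[OF countable_rat]) (intro ballI AE_twisted_difference_fixed)
  moreover have "AE x in lborel. integrable lborel (\<lambda>s. indicator {0..1} s *\<^sub>R u (x + s *\<^sub>R h))"
    by (rule AE_integrable_line[OF u_int]) measurable
  moreover have "AE x in lborel. integrable lborel (\<lambda>s. indicator {0..1} s *\<^sub>R cdot (g (x + s *\<^sub>R h)) h)"
    by (rule AE_integrable_line[OF cdot_integrable[OF g_int]]) measurable
  ultimately show ?thesis
  proof eventually_elim
    case (elim x)
    define L where "L c = exp (- (\<i> * complex_of_real c)) * u (x + h) - u x" for c
    define I where "I c s = indicator {0..1} s *\<^sub>R (exp (- (\<i> * complex_of_real (s * c))) *
        (cdot (g (x + s *\<^sub>R h)) h - \<i> * complex_of_real c * u (x + s *\<^sub>R h)))" for c s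
    have "L c = (LINT s|lborel. I c s)" for c
    proof -
      have "\<exists>r\<in>\<rat>. c < r \<and> r < c + 1 / real (Suc n)" for n
        by (intro Rats_dense_in_real) simp
      \<comment> \<open>The rationals are taken within distance 1 of c, so |r n| \<le> |c| + 1
        yields one integrable bound for all n.\<close>
      then obtain r where r: "\<And>n. r n \<in> \<rat>" "\<And>n. c < r n" "\<And>n. r n < c + 1 / real (Suc n)"
        by metis
      have r_lim: "r \<longlonglongrightarrow> c"
      proof (rule tendsto_sandwich[OF _ _ tendsto_const])
        have "(\<lambda>n. c + 1 / real (Suc n)) \<longlonglongrightarrow> c + 0"
          by (intro tendsto_intros LIMSEQ_Suc lim_const_over_n)
        then show "(\<lambda>n. c + 1 / real (Suc n)) \<longlonglongrightarrow> c" by simp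
      qed (use r in \<open>auto intro!: always_eventually less_imp_le simp del: of_nat_Suc\<close>)
      have rb: "\<bar>r n\<bar> \<le> \<bar>c\<bar> + 1" for n
      proof -
        have "1 / real (Suc n) \<le> 1" by simp
        then show ?thesis using r(2)[of n] r(3)[of n] by linarith
      qed
      have "(\<lambda>n. LINT s|lborel. I (r n) s) \<longlonglongrightarrow> (LINT s|lborel. I c s)"
      proof (rule integral_dominated_convergence)
        show "integrable lborel (\<lambda>s. norm (indicator {0..1} s *\<^sub>R cdot (g (x + s *\<^sub>R h)) h)
            + (\<bar>c\<bar> + 1) * norm (indicator {0..1} s *\<^sub>R u (x + s *\<^sub>R h)))"
          using elim(2,3) by (intro Bochner_Integration.integrable_add integrable_mult_right integrable_norm)
        show "AE s in lborel. (\<lambda>n. I (r n) s) \<longlonglongrightarrow> I c s"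
          unfolding I_def by (intro AE_I2 tendsto_intros r_lim)
        show "AE s in lborel. norm (I (r n) s) \<le> norm (indicator {0..1} s *\<^sub>R cdot (g (x + s *\<^sub>R h)) h)
            + (\<bar>c\<bar> + 1) * norm (indicator {0..1} s *\<^sub>R u (x + s *\<^sub>R h))" for n
        proof (rule AE_I2)
          fix s
          have "norm (I (r n) s) = indicator {0..1} s * norm (cdot (g (x + s *\<^sub>R h)) h - \<i> * complex_of_real (r n) * u (x + s *\<^sub>R h))"
            by (simp add: I_def norm_mult)
          also have "\<dots> \<le> indicator {0..1} s * (norm (cdot (g (x + s *\<^sub>R h)) h) + (\<bar>c\<bar> + 1) * norm (u (x + s *\<^sub>R h)))"
            using rb[of n]
            by (intro mult_left_mono order_trans[OF norm_triangle_ineq4] add_left_mono)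
              (auto simp: norm_mult intro!: mult_right_mono)
          finally show "norm (I (r n) s) \<le> norm (indicator {0..1} s *\<^sub>R cdot (g (x + s *\<^sub>R h)) h)
            + (\<bar>c\<bar> + 1) * norm (indicator {0..1} s *\<^sub>R u (x + s *\<^sub>R h))"
            by (cases "s \<in> {0..1}") simp_all
        qed
      qed (simp_all add: I_def)
      moreover have "(LINT s|lborel. I (r n) s) = L (r n)" for n
        using elim(1) r(1)[of n] by (simp add: L_def I_def)
      moreover have "(\<lambda>n. L (r n)) \<longlonglongrightarrow> L c"
        unfolding L_def by (intro tendsto_intros r_lim)
      ultimately show ?thesis using LIMSEQ_unique by auto
    qed
    then show ?case by (simp add: L_def I_def)
  qed
qed

end

section \<open>Magnetic differences\<close>

definition mag_deriv :: "(real^'n \<Rightarrow> real^'n) \<Rightarrow> (real^'n \<Rightarrow> complex) \<Rightarrow> (real^'n \<Rightarrow> complex^'n)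
    \<Rightarrow> real^'n \<Rightarrow> real^'n \<Rightarrow> complex" where
  "mag_deriv A u g x w = cdot (magnetic_gradient A u g x) w"

text \<open>This is \<Psi>(x, x + h) - \<Psi>(x, x): for y = x + h the midpoint is x + h/2 and x - y
  = -h, hence the minus sign in the phase.\<close>

definition mag_diff :: "(real^'n \<Rightarrow> real^'n) \<Rightarrow> (real^'n \<Rightarrow> complex) \<Rightarrow> real^'n \<Rightarrow> real^'n \<Rightarrow> complex" where
  "mag_diff A u x h = exp (- (\<i> * complex_of_real (h \<bullet> A (x + (1/2) *\<^sub>R h)))) * u (x + h) - u x"

lemma mag_deriv_eq:
  "mag_deriv A u g x w = cdot (g x) w - \<i> * complex_of_real (A x \<bullet> w) * u x"
  by (simp add: mag_deriv_def cdot_magnetic_gradient)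

lemma mag_deriv_scaleR:
  "mag_deriv A u g x (s *\<^sub>R w) = s *\<^sub>R mag_deriv A u g x w"
  by (simp add: mag_deriv_def cdot_scaleR)

lemma mag_deriv_measurable [measurable (raw)]:
  assumes [measurable]: "A \<in> borel_measurable borel" "u \<in> borel_measurable borel" "g \<in> borel_measurable borel"
    "f \<in> borel_measurable M" "h \<in> borel_measurable M"
  shows "(\<lambda>x. mag_deriv A u g (f x) (h x)) \<in> borel_measurable M"
  unfolding mag_deriv_eq by measurable

lemma mag_diff_measurable [measurable (raw)]:
  assumes [measurable]: "A \<in> borel_measurable borel" "u \<in> borel_measurable borel"
    "f \<in> borel_measurable M" "h \<in> borel_measurable M"
  shows "(\<lambda>x. mag_diff A u (f x) (h x)) \<in> borel_measurable M"
  unfolding mag_diff_def by measurable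

text \<open>If f is not integrable, its Bochner integral is 0 by convention and the bound is
  trivial.\<close>

lemma norm_integral_le_nn_integral:
  fixes f :: "'a \<Rightarrow> 'b::{banach, second_countable_topology}"
  shows "ennreal (norm (LINT x|M. f x)) \<le> (\<integral>\<^sup>+x. ennreal (norm (f x)) \<partial>M)"
  by (cases "integrable M f") (simp_all add: integral_norm_bound_ennreal not_integrable_integral_eq)

context
  fixes A :: "real^'n \<Rightarrow> real^'n" and u :: "real^'n \<Rightarrow> complex" and g :: "real^'n \<Rightarrow> complex^'n" and L :: real
  assumes u_int: "\<And>R. integrable lborel (\<lambda>x. indicator (cball 0 R) x *\<^sub>R u x)"
    and g_int: "\<And>R j. integrable lborel (\<lambda>x. indicator (cball 0 R) x *\<^sub>R (g x $ j))"
    and u_meas [measurable]: "u \<in> borel_measurable borel" and g_meas [measurable]: "g \<in> borel_measurable borel"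
    and weak: "\<forall>\<phi> j. test_function \<phi> \<longrightarrow>
        (LINT x|lborel. u x * complex_of_real (partial_deriv j \<phi> x)) =
        - (LINT x|lborel. g x $ j * complex_of_real (\<phi> x))"
    and A: "L-lipschitz_on UNIV A"
begin

lemma mag_diff_bound:
  "AE x in lborel. ennreal (cmod (mag_diff A u x h))
    \<le> line_avg (\<lambda>y. ennreal (cmod (mag_deriv A u g y h) + L * (norm h)\<^sup>2 * cmod (u y))) h x"
  using AE_twisted_difference[OF u_int g_int u_meas g_meas weak, of h]
proof eventually_elim
  case (elim x)
  define c where "c = h \<bullet> A (x + (1/2) *\<^sub>R h)"
  define I where "I s = indicator {0..1} s *\<^sub>R (exp (- (\<i> * complex_of_real (s * c))) *
        (cdot (g (x + s *\<^sub>R h)) h - \<i> * complex_of_real c * u (x + s *\<^sub>R h)))" for s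
  have "ennreal (cmod (mag_diff A u x h)) = ennreal (cmod (LINT s|lborel. I s))"
    using elim[rule_format, of c] by (simp add: mag_diff_def I_def c_def)
  also have "\<dots> \<le> (\<integral>\<^sup>+s. ennreal (cmod (I s)) \<partial>lborel)"
    by (rule norm_integral_le_nn_integral)
  also have "\<dots> \<le> line_avg (\<lambda>y. ennreal (cmod (mag_deriv A u g y h) + L * (norm h)\<^sup>2 * cmod (u y))) h x"
    unfolding line_avg_def
  proof (rule nn_integral_mono)
    fix s :: real
    show "ennreal (cmod (I s)) \<le> ennreal (cmod (mag_deriv A u g (x + s *\<^sub>R h) h)
        + L * (norm h)\<^sup>2 * cmod (u (x + s *\<^sub>R h))) * indicator {0..1} s"
    proof (cases "s \<in> {0..1}")
      case True
      define y where "y = x + s *\<^sub>R h"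
      have "norm (y - (x + (1/2) *\<^sub>R h)) = \<bar>s - 1/2\<bar> * norm h"
        by (simp add: y_def flip: scaleR_diff_left norm_scaleR)
      also have "\<dots> \<le> 1 * norm h" using True by (intro mult_right_mono) auto
      finally have "norm (A y - A (x + (1/2) *\<^sub>R h)) \<le> L * norm h"
        using lipschitz_onD[OF A, of y "x + (1/2) *\<^sub>R h"] lipschitz_on_nonneg[OF A]
        by (auto simp: dist_norm intro: order_trans mult_left_mono)
      then have "norm (A y - A (x + (1/2) *\<^sub>R h)) * norm h \<le> L * norm h * norm h"
        by (intro mult_right_mono) auto
      then have "\<bar>(A y - A (x + (1/2) *\<^sub>R h)) \<bullet> h\<bar> \<le> L * norm h * norm h"
        using Cauchy_Schwarz_ineq2 order_trans by blast
      then have Ac: "\<bar>A y \<bullet> h - c\<bar> \<le> L * (norm h)\<^sup>2"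
        by (simp add: c_def inner_diff_left inner_diff_right inner_commute power2_eq_square mult.assoc)
      have "cdot (g y) h - \<i> * complex_of_real c * u y
          = mag_deriv A u g y h + \<i> * complex_of_real (A y \<bullet> h - c) * u y"
        by (simp add: mag_deriv_eq algebra_simps)
      then have "cmod (cdot (g y) h - \<i> * complex_of_real c * u y)
          \<le> cmod (mag_deriv A u g y h) + cmod (\<i> * complex_of_real (A y \<bullet> h - c) * u y)"
        by (metis norm_triangle_ineq)
      also have "cmod (\<i> * complex_of_real (A y \<bullet> h - c) * u y) \<le> L * (norm h)\<^sup>2 * cmod (u y)"
        using Ac unfolding norm_mult norm_of_real norm_ii by (simp add: mult_right_mono)
      finally show ?thesis
        using True by (simp add: I_def norm_mult y_def ennreal_leI)
    qed (simp add: I_def)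
  qed
  finally show ?case .
qed

text \<open>The quotient is the segment average of \<open>e k s * X k s\<close>, where the phase
  tends to 1. Differentiation along segments is applied to u and to the w-component of g separately,
  because the coefficient of u in \<open>X\<close> is the midpoint value \<open>b k\<close>, which
  varies with k.\<close>

lemma mag_diff_quotient_tendsto:
  assumes d: "\<And>k. 0 < d k" "d \<longlonglongrightarrow> 0"
  shows "AE x in lborel. (\<lambda>k. (1 / d k) *\<^sub>R mag_diff A u x (d k *\<^sub>R w)) \<longlonglongrightarrow> mag_deriv A u g x w"
proof -
  have [measurable]: "(\<lambda>x. cdot (g x) w) \<in> borel_measurable borel" by measurable
  have cg: "integrable lborel (\<lambda>x. indicator (cball 0 R) x *\<^sub>R cdot (g x) w)" for R
    by (rule cdot_integrable[OF g_int])
  have "AE x in lborel. \<forall>k. \<forall>c. exp (- (\<i> * complex_of_real c)) * u (x + d k *\<^sub>R w) - u x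
    = (LINT s|lborel. indicator {0..1} s *\<^sub>R (exp (- (\<i> * complex_of_real (s * c))) *
        (cdot (g (x + s *\<^sub>R d k *\<^sub>R w)) (d k *\<^sub>R w) - \<i> * complex_of_real c * u (x + s *\<^sub>R d k *\<^sub>R w))))"
    by (subst AE_all_countable) (intro allI AE_twisted_difference[OF u_int g_int u_meas g_meas weak])
  moreover have "AE x in lborel. \<forall>k. integrable lborel (\<lambda>s. indicator {0..1} s *\<^sub>R u (x + s *\<^sub>R d k *\<^sub>R w))"
    by (subst AE_all_countable) (intro allI AE_integrable_line[OF u_int u_meas])
  moreover have "AE x in lborel. \<forall>k. integrable lborel (\<lambda>s. indicator {0..1} s *\<^sub>R cdot (g (x + s *\<^sub>R d k *\<^sub>R w)) w)"
    by (subst AE_all_countable) (intro allI AE_integrable_line[OF cg], measurable)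
  moreover have "AE x in lborel. (\<lambda>k. line_avg (\<lambda>y. ennreal (norm (u y - u x))) (d k *\<^sub>R w) x) \<longlonglongrightarrow> 0"
    by (rule AE_line_avg_tendsto_0[OF u_int d])
  moreover have "AE x in lborel. (\<lambda>k. line_avg (\<lambda>y. ennreal (norm (cdot (g y) w - cdot (g x) w))) (d k *\<^sub>R w) x) \<longlonglongrightarrow> 0"
    by (rule AE_line_avg_tendsto_0[OF cg d])
  ultimately show ?thesis
  proof eventually_elim
    case (elim x)
    define y where "y k s = x + s *\<^sub>R d k *\<^sub>R w" for k s
    have [measurable]: "y k \<in> borel_measurable borel" for k unfolding y_def by measurable
    define b where "b k = w \<bullet> A (x + (1/2) *\<^sub>R d k *\<^sub>R w)" for k
    define b0 where "b0 = w \<bullet> A x"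
    define Y where "Y = mag_deriv A u g x w"
    define e where "e k s = exp (- (\<i> * complex_of_real (s * (d k * b k))))" for k s
    have [measurable]: "e k \<in> borel_measurable borel" for k unfolding e_def by measurable
    define X where "X k s = cdot (g (y k s)) w - \<i> * complex_of_real (b k) * u (y k s)" for k s
    have [measurable]: "X k \<in> borel_measurable borel" for k unfolding X_def by measurable
    have isA: "isCont A x"
      using lipschitz_on_continuous_on[OF A] by (simp add: continuous_on_eq_continuous_at)
    have "(\<lambda>k. x + (1/2) *\<^sub>R d k *\<^sub>R w) \<longlonglongrightarrow> x + (1/2) *\<^sub>R 0 *\<^sub>R w"
      by (intro tendsto_intros d)
    then have b_lim: "b \<longlonglongrightarrow> b0"
      unfolding b_def b0_def by (intro tendsto_inner tendsto_const isCont_tendsto_compose[OF isA]) simp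
    then obtain B where B: "0 < B" "\<And>k. \<bar>b k\<bar> \<le> B"
      using convergent_imp_Bseq[OF convergentI[OF b_lim]] by (auto simp: Bseq_def)
    have quot: "(1 / d k) *\<^sub>R mag_diff A u x (d k *\<^sub>R w) = (LINT s|lborel. indicator {0..1} s *\<^sub>R (e k s * X k s))" for k
    proof -
      have "mag_diff A u x (d k *\<^sub>R w) = (LINT s|lborel. indicator {0..1} s *\<^sub>R (exp (- (\<i> * complex_of_real (s * (d k * b k)))) *
        (cdot (g (x + s *\<^sub>R d k *\<^sub>R w)) (d k *\<^sub>R w) - \<i> * complex_of_real (d k * b k) * u (x + s *\<^sub>R d k *\<^sub>R w))))"
        using elim(1)[rule_format, of "d k * b k" k] by (simp add: mag_diff_def b_def)
      also have "\<dots> = (LINT s|lborel. d k *\<^sub>R (indicator {0..1} s *\<^sub>R (e k s * X k s)))"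
        by (rule Bochner_Integration.integral_cong[OF refl])
          (simp add: e_def X_def y_def cdot_scaleR scaleR_conv_of_real[where 'a=complex] algebra_simps)
      also have "\<dots> = d k *\<^sub>R (LINT s|lborel. indicator {0..1} s *\<^sub>R (e k s * X k s))"
        by (rule integral_scaleR_right)
      finally show ?thesis using d(1)[of k] by simp
    qed
    have int: "integrable lborel (\<lambda>s. indicator {0..1} s *\<^sub>R (e k s * X k s))" for k
    proof (rule Bochner_Integration.integrable_bound)
      show "integrable lborel (\<lambda>s. indicator {0..1} s *\<^sub>R cdot (g (y k s)) w - (\<i> * complex_of_real (b k)) * (indicator {0..1} s *\<^sub>R u (y k s)))"
        using elim(2,3) unfolding y_def by (intro Bochner_Integration.integrable_diff integrable_mult_right) auto
      show "AE s in lborel. norm (indicator {0..1} s *\<^sub>R (e k s * X k s))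
          \<le> norm (indicator {0..1} s *\<^sub>R cdot (g (y k s)) w - (\<i> * complex_of_real (b k)) * (indicator {0..1} s *\<^sub>R u (y k s)))"
        by (intro AE_I2) (simp add: e_def X_def indicator_def norm_mult)
    qed measurable
    \<comment> \<open>The first two terms tend to 0 by differentiation along segments, the last
      because \<open>b k\<close> tends to \<open>b0\<close> and \<open>d k\<close> to 0.\<close>
    define R where "R k = line_avg (\<lambda>y. ennreal (norm (cdot (g y) w - cdot (g x) w))) (d k *\<^sub>R w) x
        + (ennreal B * line_avg (\<lambda>y. ennreal (norm (u y - u x))) (d k *\<^sub>R w) x
        + ennreal (\<bar>b k - b0\<bar> * cmod (u x) + d k * B * cmod Y))" for k
    have bound: "ennreal (cmod ((1 / d k) *\<^sub>R mag_diff A u x (d k *\<^sub>R w) - Y)) \<le> R k" for k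
    proof -
      have "(LINT s|lborel. indicator {0..1::real} s *\<^sub>R Y) = Y"
        by (subst integral_scaleR_left) simp_all
      then have "(1 / d k) *\<^sub>R mag_diff A u x (d k *\<^sub>R w) - Y
          = (LINT s|lborel. indicator {0..1} s *\<^sub>R (e k s * X k s) - indicator {0..1} s *\<^sub>R Y)"
        using int[of k] unfolding quot by (subst Bochner_Integration.integral_diff) auto
      then have "ennreal (cmod ((1 / d k) *\<^sub>R mag_diff A u x (d k *\<^sub>R w) - Y))
          \<le> (\<integral>\<^sup>+s. ennreal (cmod (indicator {0..1} s *\<^sub>R (e k s * X k s) - indicator {0..1} s *\<^sub>R Y)) \<partial>lborel)"
        by (simp only: norm_integral_le_nn_integral)
      also have "\<dots> \<le> (\<integral>\<^sup>+s. ennreal (norm (cdot (g (y k s)) w - cdot (g x) w)) * indicator {0..1} s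
          + (ennreal B * (ennreal (norm (u (y k s) - u x)) * indicator {0..1} s)
          + ennreal (\<bar>b k - b0\<bar> * cmod (u x) + d k * B * cmod Y) * indicator {0..1} s) \<partial>lborel)"
      proof (rule nn_integral_mono)
        fix s :: real
        show "ennreal (cmod (indicator {0..1} s *\<^sub>R (e k s * X k s) - indicator {0..1} s *\<^sub>R Y))
          \<le> ennreal (norm (cdot (g (y k s)) w - cdot (g x) w)) * indicator {0..1} s
          + (ennreal B * (ennreal (norm (u (y k s) - u x)) * indicator {0..1} s)
          + ennreal (\<bar>b k - b0\<bar> * cmod (u x) + d k * B * cmod Y) * indicator {0..1} s)"
        proof (cases "s \<in> {0..1}")
          case True
          have e1: "cmod (e k s) = 1" by (simp add: e_def)
          have "cmod (e k s - 1) = cmod (exp (\<i> * complex_of_real (- (s * (d k * b k)))) - 1)"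
            by (simp add: e_def)
          also have "\<dots> = 2 * \<bar>sin (- (s * (d k * b k)) / 2)\<bar>"
            using dist_exp_i_1[of "- (s * (d k * b k))"] by simp
          also have "\<dots> \<le> 2 * \<bar>- (s * (d k * b k)) / 2\<bar>"
            by (intro mult_left_mono abs_sin_x_le_abs_x) simp
          also have "\<dots> = s * (d k * \<bar>b k\<bar>)"
            using True d(1)[of k] by (simp add: abs_mult)
          also have "\<dots> \<le> 1 * (d k * B)"
            using True d(1)[of k] B(2)[of k] by (intro mult_mono) auto
          finally have e2: "cmod (e k s - 1) \<le> d k * B" by simp
          \<comment> \<open>Exact telescoping: g, u, the potential and the phase are replaced one
            after the other. The factor \<open>e k s\<close> has modulus 1, and the last term is
            covered by |exp (i t) - 1| \<le> |t|.\<close>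
          have "e k s * X k s - Y = e k s * (cdot (g (y k s)) w - cdot (g x) w)
              - e k s * (\<i> * complex_of_real (b k) * (u (y k s) - u x))
              - e k s * (\<i> * complex_of_real (b k - b0) * u x) + (e k s - 1) * Y"
            unfolding X_def Y_def mag_deriv_eq b0_def
            by (simp add: algebra_simps inner_commute)
          then have "cmod (e k s * X k s - Y) \<le> cmod (cdot (g (y k s)) w - cdot (g x) w)
              + \<bar>b k\<bar> * cmod (u (y k s) - u x) + \<bar>b k - b0\<bar> * cmod (u x) + cmod (e k s - 1) * cmod Y"
            using norm_triangle_ineq[of "e k s * (cdot (g (y k s)) w - cdot (g x) w)
              - e k s * (\<i> * complex_of_real (b k) * (u (y k s) - u x))
              - e k s * (\<i> * complex_of_real (b k - b0) * u x)" "(e k s - 1) * Y"]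
              norm_triangle_ineq4[of "e k s * (cdot (g (y k s)) w - cdot (g x) w)
              - e k s * (\<i> * complex_of_real (b k) * (u (y k s) - u x))" "e k s * (\<i> * complex_of_real (b k - b0) * u x)"]
              norm_triangle_ineq4[of "e k s * (cdot (g (y k s)) w - cdot (g x) w)" "e k s * (\<i> * complex_of_real (b k) * (u (y k s) - u x))"]
            unfolding norm_mult e1 norm_of_real norm_ii by simp
          also have "\<dots> \<le> cmod (cdot (g (y k s)) w - cdot (g x) w)
              + B * cmod (u (y k s) - u x) + \<bar>b k - b0\<bar> * cmod (u x) + d k * B * cmod Y"
            using B(2)[of k] e2 by (intro add_mono mult_right_mono) auto
          finally have "ennreal (cmod (e k s * X k s - Y)) \<le> ennreal (cmod (cdot (g (y k s)) w - cdot (g x) w)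
              + (B * cmod (u (y k s) - u x) + (\<bar>b k - b0\<bar> * cmod (u x) + d k * B * cmod Y)))"
            by (intro ennreal_leI) simp
          also have "\<dots> = ennreal (cmod (cdot (g (y k s)) w - cdot (g x) w))
              + (ennreal B * ennreal (cmod (u (y k s) - u x)) + ennreal (\<bar>b k - b0\<bar> * cmod (u x) + d k * B * cmod Y))"
            using B(1) d(1)[of k] by (simp add: ennreal_mult)
          finally show ?thesis using True by simp
        qed simp
      qed
      also have "\<dots> = R k"
        unfolding R_def line_avg_def y_def
        by (simp add: nn_integral_add nn_integral_cmult)
      finally show ?thesis .
    qed
    have "R \<longlonglongrightarrow> 0 + (ennreal B * 0 + ennreal (\<bar>b0 - b0\<bar> * cmod (u x) + 0 * B * cmod Y))"
      unfolding R_def by (intro tendsto_intros elim ennreal_tendsto_cmult b_lim d) auto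
    then have "R \<longlonglongrightarrow> 0" by simp
    then have "(\<lambda>k. ennreal (cmod ((1 / d k) *\<^sub>R mag_diff A u x (d k *\<^sub>R w) - Y))) \<longlonglongrightarrow> 0"
      by (rule tendsto_sandwich[OF always_eventually always_eventually tendsto_const, rotated 2]) (use bound in auto)
    then have "(\<lambda>k. cmod ((1 / d k) *\<^sub>R mag_diff A u x (d k *\<^sub>R w) - Y)) \<longlonglongrightarrow> 0"
      by (subst (asm) ennreal_0[symmetric], subst (asm) tendsto_ennreal_iff) auto
    then show ?case
      unfolding Y_def by (simp add: tendsto_norm_zero_iff LIM_zero_iff)
  qed
qed

end

section \<open>Limits of the near and far parts of the rescaled integral\<close>

context
  fixes A :: "real^'n \<Rightarrow> real^'n" and u :: "real^'n \<Rightarrow> complex" and g :: "real^'n \<Rightarrow> complex^'n" and L :: real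
    and N :: "real^'n \<Rightarrow> real" and p q :: real
  assumes u_int: "\<And>R. integrable lborel (\<lambda>x. indicator (cball 0 R) x *\<^sub>R u x)"
    and g_int: "\<And>R j. integrable lborel (\<lambda>x. indicator (cball 0 R) x *\<^sub>R (g x $ j))"
    and u_meas [measurable]: "u \<in> borel_measurable borel" and g_meas [measurable]: "g \<in> borel_measurable borel"
    and weak: "\<forall>\<phi> j. test_function \<phi> \<longrightarrow>
        (LINT x|lborel. u x * complex_of_real (partial_deriv j \<phi> x)) =
        - (LINT x|lborel. g x $ j * complex_of_real (\<phi> x))"
    and A: "L-lipschitz_on UNIV A"
    and N: "is_norm N" and p: "1 < p" and q: "q = real CARD('n) + p"
    and u_Lp: "(\<integral>\<^sup>+x. ennreal (cmod (u x) powr p) \<partial>lborel) < \<infinity>"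
    and energy: "(\<integral>\<^sup>+x. (\<integral>\<^sup>+z\<in>{z. N z \<le> 1}. ennreal (cmod_p p (mag_deriv A u g x z) powr p) \<partial>lborel) \<partial>lborel) < \<infinity>"
begin

text \<open>If |u| \<le> \<open>d k\<close>/4 at both x and x + \<open>d k\<close> w, then the
  difference has modulus at most \<open>d k\<close>/2, hence \<open>cmod_p\<close> at most
  \<open>d k\<close>. So one of the two points lies in \<open>S k\<close>, and the weight integrates
  over {\<open>d k\<close> N w > 1} to a multiple of \<open>d k powr p\<close>.\<close>

lemma far_tendsto_0:
  assumes d: "\<And>k. 0 < d k" "d \<longlonglongrightarrow> 0"
  shows "(\<lambda>k. \<integral>\<^sup>+w. (\<integral>\<^sup>+x. ennreal (1 / N w powr q) *
      indicator {x. d k < cmod_p p (mag_diff A u x (d k *\<^sub>R w)) \<and> 1 < d k * N w} x \<partial>lborel) \<partial>lborel) \<longlonglongrightarrow> 0"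
proof -
  let ?D = "\<lambda>k w x. cmod_p p (mag_diff A u x (d k *\<^sub>R w))"
  let ?a = "\<lambda>w. ennreal (1 / N w powr q)"
  note [measurable] = lipschitz_on_UNIV_measurable[OF A] is_norm_measurable[OF N]
  define S where "S k = {x. d k / 4 < cmod (u x)}" for k
  have [measurable]: "S k \<in> sets borel" for k unfolding S_def by measurable
  \<comment> \<open>The 2 counts the points x and x + \<open>d k\<close> w; the rest comes from
    \<open>nn_integral_homogeneous_superlevel\<close> applied to \<open>d k\<close> N, with N \<le>
    1 on the unit ball.\<close>
  define c where "c = 2 * ennreal (q / p) * emeasure lborel {z. N z \<le> 1}"
  have c: "c < \<infinity>" using emeasure_compact_finite[OF is_norm_compact_ball[OF N]] by (simp add: c_def ennreal_mult_less_top)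
  have bound: "(\<integral>\<^sup>+w. (\<integral>\<^sup>+x. ?a w *
      indicator {x. d k < ?D k w x \<and> 1 < d k * N w} x \<partial>lborel) \<partial>lborel)
      \<le> c * (\<integral>\<^sup>+x. ennreal (d k powr p) * indicator (S k) x \<partial>lborel)" for k
  proof -
    have "(\<integral>\<^sup>+x. ?a w *
        indicator {x. d k < ?D k w x \<and> 1 < d k * N w} x \<partial>lborel)
        \<le> ?a w * indicator {w. 1 < d k * N w} w * (2 * emeasure lborel (S k))" for w
    proof -
      have "(\<integral>\<^sup>+x. ?a w *
          indicator {x. d k < ?D k w x \<and> 1 < d k * N w} x \<partial>lborel)
          \<le> (\<integral>\<^sup>+x. ?a w * indicator {w. 1 < d k * N w} w * (indicator (S k) x + indicator (S k) (x + d k *\<^sub>R w)) \<partial>lborel)"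
      proof (rule nn_integral_mono)
        fix x
        have "x \<in> S k \<or> x + d k *\<^sub>R w \<in> S k" if "d k < ?D k w x"
        proof (rule ccontr)
          assume "\<not> ?thesis"
          then have "cmod (u x) \<le> d k / 4" "cmod (u (x + d k *\<^sub>R w)) \<le> d k / 4" by (auto simp: S_def)
          moreover have "cmod (mag_diff A u x (d k *\<^sub>R w)) \<le> cmod (u (x + d k *\<^sub>R w)) + cmod (u x)"
            unfolding mag_diff_def by (rule order_trans[OF norm_triangle_ineq4]) (simp add: norm_mult)
          ultimately show False using that cmod_p_le_cmod[of p "mag_diff A u x (d k *\<^sub>R w)"] p by simp
        qed
        then have "(indicator {x. d k < ?D k w x \<and> 1 < d k * N w} x :: ennreal)
          \<le> indicator {w. 1 < d k * N w} w * (indicator (S k) x + indicator (S k) (x + d k *\<^sub>R w))"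
          by (auto simp: indicator_def)
        then show "?a w *
          indicator {x. d k < ?D k w x \<and> 1 < d k * N w} x
          \<le> ?a w * indicator {w. 1 < d k * N w} w * (indicator (S k) x + indicator (S k) (x + d k *\<^sub>R w))"
          unfolding mult.assoc by (rule mult_left_mono) simp
      qed
      also have "\<dots> = ?a w * indicator {w. 1 < d k * N w} w * ((\<integral>\<^sup>+x. indicator (S k) x \<partial>lborel) + (\<integral>\<^sup>+x. indicator (S k) (x + d k *\<^sub>R w) \<partial>lborel))"
        by (simp add: nn_integral_cmult nn_integral_add)
      also have "\<dots> = ?a w * indicator {w. 1 < d k * N w} w * (2 * emeasure lborel (S k))"
        by (subst nn_integral_shift) (simp_all add: mult_2)
      finally show ?thesis .
    qed
    then have "(\<integral>\<^sup>+w. (\<integral>\<^sup>+x. ?a w *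
      indicator {x. d k < ?D k w x \<and> 1 < d k * N w} x \<partial>lborel) \<partial>lborel)
      \<le> (\<integral>\<^sup>+w. ?a w * indicator {w. 1 < d k * N w} w * (2 * emeasure lborel (S k)) \<partial>lborel)"
      by (rule nn_integral_mono)
    also have "\<dots> = (\<integral>\<^sup>+w. ?a w * indicator {w. 1 < d k * N w} w \<partial>lborel) * (2 * emeasure lborel (S k))"
      by (rule nn_integral_multc) measurable
    also have "(\<integral>\<^sup>+w. ?a w * indicator {w. 1 < d k * N w} w \<partial>lborel)
        = ennreal (q / p) * (\<integral>\<^sup>+z\<in>{z. N z \<le> 1}. ennreal ((d k * N z) powr p) \<partial>lborel)"
      using nn_integral_homogeneous_superlevel[of N "\<lambda>w. d k * N w" p] d(1)[of k] p
      by (simp add: is_norm_scaleR[OF N] is_norm_pos[OF N] is_norm_nonneg[OF N] less_imp_le q)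
    also have "(\<integral>\<^sup>+z\<in>{z. N z \<le> 1}. ennreal ((d k * N z) powr p) \<partial>lborel)
        \<le> (\<integral>\<^sup>+z. ennreal (d k powr p) * indicator {z. N z \<le> 1} z \<partial>lborel)"
    proof (rule nn_integral_mono)
      fix z
      show "ennreal ((d k * N z) powr p) * indicator {z. N z \<le> 1} z \<le> ennreal (d k powr p) * indicator {z. N z \<le> 1} z"
        using d(1)[of k] p is_norm_nonneg[OF N, of z]
        by (auto simp: indicator_def intro!: ennreal_leI powr_mono2 mult_left_le)
    qed
    also have "\<dots> = ennreal (d k powr p) * emeasure lborel {z. N z \<le> 1}"
      by (simp add: nn_integral_cmult)
    finally have "(\<integral>\<^sup>+w. (\<integral>\<^sup>+x. ?a w *
      indicator {x. d k < ?D k w x \<and> 1 < d k * N w} x \<partial>lborel) \<partial>lborel)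
      \<le> ennreal (q / p) * (ennreal (d k powr p) * emeasure lborel {z. N z \<le> 1}) * (2 * emeasure lborel (S k))"
      by (simp add: mult_left_mono mult_right_mono)
    also have "\<dots> = c * (ennreal (d k powr p) * emeasure lborel (S k))"
      by (simp add: c_def mult_ac)
    finally show ?thesis by (simp add: nn_integral_cmult)
  qed
  \<comment> \<open>Chebyshev alone would only bound this quantity. With the factor kept inside, the
    integrand is at most 4^p |u|^p and tends to 0 at every point.\<close>
  have "(\<lambda>k. \<integral>\<^sup>+x. ennreal (d k powr p) * indicator (S k) x \<partial>lborel) \<longlonglongrightarrow> (\<integral>\<^sup>+(x::real^'n). 0 \<partial>lborel)"
  proof (rule nn_integral_dominated_convergence)
    show "AE x in lborel. ennreal (d k powr p) * indicator (S k) x \<le> ennreal (4 powr p) * ennreal (cmod (u x) powr p)" for k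
    proof (rule AE_I2)
      fix x
      have "d k powr p \<le> (4 * cmod (u x)) powr p" if "x \<in> S k"
        using that d(1)[of k] p by (intro powr_mono2) (auto simp: S_def)
      then show "ennreal (d k powr p) * indicator (S k) x \<le> ennreal (4 powr p) * ennreal (cmod (u x) powr p)"
        by (auto simp: indicator_def powr_mult simp flip: ennreal_mult)
    qed
    show "(\<integral>\<^sup>+x. ennreal (4 powr p) * ennreal (cmod (u x) powr p) \<partial>lborel) < \<infinity>"
      using u_Lp by (simp add: nn_integral_cmult ennreal_mult_less_top)
    show "AE x in lborel. (\<lambda>k. ennreal (d k powr p) * indicator (S k) x) \<longlonglongrightarrow> 0"
    proof (rule AE_I2)
      fix x
      have "(\<lambda>k. d k powr p) \<longlonglongrightarrow> 0 powr p"
        using d p by (intro tendsto_powr' tendsto_const) (auto intro!: always_eventually less_imp_le)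
      then have "(\<lambda>k. ennreal (d k powr p)) \<longlonglongrightarrow> ennreal 0"
        using p by (intro tendsto_ennrealI) simp
      then have lim: "(\<lambda>k. ennreal (d k powr p)) \<longlonglongrightarrow> 0" by simp
      show "(\<lambda>k. ennreal (d k powr p) * indicator (S k) x) \<longlonglongrightarrow> 0"
        by (rule tendsto_sandwich[OF always_eventually always_eventually tendsto_const lim]) (auto simp: indicator_def)
    qed
  qed auto
  then have "(\<lambda>k. c * (\<integral>\<^sup>+x. ennreal (d k powr p) * indicator (S k) x \<partial>lborel)) \<longlonglongrightarrow> c * 0"
    using c by (intro ennreal_tendsto_cmult) auto
  then have lim: "(\<lambda>k. c * (\<integral>\<^sup>+x. ennreal (d k powr p) * indicator (S k) x \<partial>lborel)) \<longlonglongrightarrow> 0" by simp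
  show ?thesis
    by (rule tendsto_sandwich[OF always_eventually always_eventually tendsto_const lim]) (use bound in auto)
qed

text \<open>Two nested dominated convergences. For fixed w the sets lie, up to null sets, in one set
  \<open>E w\<close> independent of k; in w the majorant is \<open>\<Phi>\<close>, which bounds a w
  times the measure of \<open>E w\<close>. The indicators converge wherever the limiting derivative
  does not have modulus exactly 1.\<close>

lemma near_tendsto:
  assumes d: "\<And>k. 0 < d k" "d \<longlonglongrightarrow> 0"
  shows "(\<lambda>k. \<integral>\<^sup>+w. (\<integral>\<^sup>+x. ennreal (1 / N w powr q) *
      indicator {x. d k < cmod_p p (mag_diff A u x (d k *\<^sub>R w)) \<and> \<not> 1 < d k * N w} x \<partial>lborel) \<partial>lborel)
    \<longlonglongrightarrow> (\<integral>\<^sup>+w. (\<integral>\<^sup>+x. ennreal (1 / N w powr q) *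
      indicator {x. 1 < cmod_p p (mag_deriv A u g x w)} x \<partial>lborel) \<partial>lborel)"
proof -
  let ?D = "\<lambda>k w x. cmod_p p (mag_diff A u x (d k *\<^sub>R w))"
  let ?a = "\<lambda>w. ennreal (1 / N w powr q)"
  let ?G = "\<lambda>x w. cmod_p p (mag_deriv A u g x w)"
  note [measurable] = lipschitz_on_UNIV_measurable[OF A] is_norm_measurable[OF N]
  obtain T where T: "\<And>k. d k \<le> T"
    using convergent_imp_Bseq[OF convergentI[OF d(2)]] by (force simp: Bseq_def abs_le_iff)
  obtain C where C: "0 < C" "\<And>x. norm x \<le> C * N x" using is_norm_ge_norm[OF N] by metis
  have L: "0 \<le> L" using A by (rule lipschitz_on_nonneg)
  \<comment> \<open>Of degree 1 in w although the error in \<open>mag_diff_bound\<close> is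
    quadratic: \<open>d k\<close> N w \<le> 1 gives \<open>d k\<close> |w| \<le> C, and one factor
    \<open>d k\<close> |w| is absorbed into C.\<close>
  define m where "m x w = cmod (mag_deriv A u g x w) + L * C * norm w * cmod (u x)" for x w
  have m_nonneg: "0 \<le> m x w" for x w using L C(1) by (simp add: m_def)
  have m_scale: "m x (s *\<^sub>R w) = s * m x w" if "0 < s" for x s w
    using that by (simp add: m_def mag_deriv_scaleR algebra_simps)
  have [measurable (raw)]: "(\<lambda>x. m (f x) (h x)) \<in> borel_measurable M"
    if [measurable]: "f \<in> borel_measurable M" "h \<in> borel_measurable M" for M and f h :: "'z \<Rightarrow> real^'n"
    unfolding m_def by measurable
  \<comment> \<open>The threshold is 1/2, left over from \<open>cmod_p\<close> \<le> 2
    \<open>cmod\<close>; it is written as 2 * (1/4) to match \<open>weak_type_truncated\<close> with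
    l = 1/4.\<close>
  define E where "E w = {x. \<exists>k. ennreal (2 * (1/4)) < (\<integral>\<^sup>+s\<in>{0..1}. ennreal (m (x + (s * d k) *\<^sub>R w) w) \<partial>lborel)}" for w
  have [measurable]: "E w \<in> sets borel" for w unfolding E_def by measurable
  define a where "a w = ?a w" for w
  have [measurable]: "a \<in> borel_measurable borel" unfolding a_def by measurable
  \<comment> \<open>80 = 4 * 20: the weak type constant 20 divided by the level 1/4.\<close>
  define \<Phi> where "\<Phi> w = a w * (80 * (\<integral>\<^sup>+x. ennreal (m x w) * indicator {x. ennreal (1/4) < ennreal (m x w)} x \<partial>lborel))" for w
  have [measurable]: "\<Phi> \<in> borel_measurable borel" unfolding \<Phi>_def by measurable
  have aE: "a w * emeasure lborel (E w) \<le> \<Phi> w" for w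
  proof -
    have "ennreal (1/4) * emeasure lborel (E w) \<le> 20 * (\<integral>\<^sup>+x. ennreal (m x w) * indicator {x. ennreal (1/4) < ennreal (m x w)} x \<partial>lborel)"
      unfolding E_def by (rule weak_type_truncated[OF _ d(1) T]) auto
    then have "4 * (ennreal (1/4) * emeasure lborel (E w)) \<le> 4 * (20 * (\<integral>\<^sup>+x. ennreal (m x w) * indicator {x. ennreal (1/4) < ennreal (m x w)} x \<partial>lborel))"
      by (rule mult_left_mono) simp
    moreover have "4 * ennreal (1/4) = 1"
      by (simp flip: ennreal_numeral ennreal_mult)
    ultimately show ?thesis
      unfolding \<Phi>_def by (intro mult_left_mono) (simp_all flip: mult.assoc)
  qed
  have in_E: "AE x in lborel. d k < ?D k w x \<and> \<not> 1 < d k * N w \<longrightarrow> x \<in> E w" for k w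
    using mag_diff_bound[OF u_int g_int u_meas g_meas weak A, of "d k *\<^sub>R w"]
  proof eventually_elim
    case (elim x)
    show ?case
    proof
      assume *: "d k < ?D k w x \<and> \<not> 1 < d k * N w"
      have dw: "d k * norm w \<le> C"
      proof -
        have "d k * norm w \<le> d k * (C * N w)" using C(2)[of w] d(1)[of k] by (intro mult_left_mono) auto
        also have "\<dots> = C * (d k * N w)" by simp
        also have "\<dots> \<le> C * 1" using * C(1) by (intro mult_left_mono) auto
        finally show ?thesis by simp
      qed
      have "d k < 2 * cmod (mag_diff A u x (d k *\<^sub>R w))"
        using * cmod_p_le_cmod[of p "mag_diff A u x (d k *\<^sub>R w)"] p by linarith
      then have "ennreal (d k / 2) < ennreal (cmod (mag_diff A u x (d k *\<^sub>R w)))"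
        using d(1)[of k] by (simp add: ennreal_less_iff)
      also note elim
      also have "line_avg (\<lambda>y. ennreal (cmod (mag_deriv A u g y (d k *\<^sub>R w)) + L * (norm (d k *\<^sub>R w))\<^sup>2 * cmod (u y))) (d k *\<^sub>R w) x
          \<le> (\<integral>\<^sup>+s. ennreal (d k) * (ennreal (m (x + (s * d k) *\<^sub>R w) w) * indicator {0..1} s) \<partial>lborel)"
        unfolding line_avg_def
      proof (rule nn_integral_mono)
        fix s :: real
        define y where "y = x + (s * d k) *\<^sub>R w"
        have "L * (norm (d k *\<^sub>R w))\<^sup>2 * cmod (u y) = (d k * norm w) * (L * (d k * norm w) * cmod (u y))"
          using d(1)[of k] by (simp add: power2_eq_square mult_ac)
        also have "\<dots> \<le> C * (L * (d k * norm w) * cmod (u y))"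
          using dw L d(1)[of k] by (intro mult_right_mono) auto
        finally have "cmod (mag_deriv A u g y (d k *\<^sub>R w)) + L * (norm (d k *\<^sub>R w))\<^sup>2 * cmod (u y) \<le> d k * m y w"
          using d(1)[of k] by (simp add: m_def mag_deriv_scaleR algebra_simps)
        then have "ennreal (cmod (mag_deriv A u g y (d k *\<^sub>R w)) + L * (norm (d k *\<^sub>R w))\<^sup>2 * cmod (u y))
            \<le> ennreal (d k) * ennreal (m y w)"
          using d(1)[of k] m_nonneg by (simp add: ennreal_leI flip: ennreal_mult)
        then show "ennreal (cmod (mag_deriv A u g (x + s *\<^sub>R d k *\<^sub>R w) (d k *\<^sub>R w))
            + L * (norm (d k *\<^sub>R w))\<^sup>2 * cmod (u (x + s *\<^sub>R d k *\<^sub>R w))) * indicator {0..1} s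
            \<le> ennreal (d k) * (ennreal (m (x + (s * d k) *\<^sub>R w) w) * indicator {0..1} s)"
          by (simp add: y_def indicator_def)
      qed
      also have "\<dots> = ennreal (d k) * (\<integral>\<^sup>+s\<in>{0..1}. ennreal (m (x + (s * d k) *\<^sub>R w) w) \<partial>lborel)"
        by (rule nn_integral_cmult) measurable
      also have "ennreal (d k / 2) = ennreal (d k) * ennreal (1/2)"
        using d(1)[of k] by (subst ennreal_mult[symmetric]) auto
      finally have "ennreal (d k) * ennreal (1/2) < ennreal (d k) * (\<integral>\<^sup>+s\<in>{0..1}. ennreal (m (x + (s * d k) *\<^sub>R w) w) \<partial>lborel)"
        .
      then have "ennreal (1/2) < (\<integral>\<^sup>+s\<in>{0..1}. ennreal (m (x + (s * d k) *\<^sub>R w) w) \<partial>lborel)"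
        by (meson leD leI mult_left_mono zero_le)
      then show "x \<in> E w" unfolding E_def by auto
    qed
  qed
  \<comment> \<open>Fubini makes w the inner variable. For each x the truncated homogeneity formula
    turns the w-integral into the integral of m^p over the unit ball, which splits into the energy
    density and a multiple of |u|^p.\<close>
  have \<Phi>_fin: "(\<integral>\<^sup>+w. \<Phi> w \<partial>lborel) < \<infinity>"
  proof -
    define c1 where "c1 = (q * ((1/4) powr (1 - p) / (p - 1)))"
    define B where "B = emeasure lborel {z::real^'n. N z \<le> 1}"
    have B: "B < \<infinity>" using emeasure_compact_finite[OF is_norm_compact_ball[OF N]] by (simp add: B_def)
    have inner: "(\<integral>\<^sup>+w. a w * (ennreal (m x w) * indicator {w. 1/4 < m x w} w) \<partial>lborel)
        = ennreal c1 * (\<integral>\<^sup>+z\<in>{z. N z \<le> 1}. ennreal (m x z powr p) \<partial>lborel)" for x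
      unfolding a_def c1_def
      using nn_integral_homogeneous_truncated[of N "m x" p "1/4"] p
      by (simp add: is_norm_scaleR[OF N] is_norm_pos[OF N] m_nonneg m_scale q)
    \<comment> \<open>One 2^p comes from splitting the sum, the other from \<open>cmod\<close> \<le>
      2 \<open>cmod_p\<close>. One factor C belongs to the definition of m, the other bounds |z| on
      the unit ball.\<close>
    have m_powr: "(\<integral>\<^sup>+z\<in>{z. N z \<le> 1}. ennreal (m x z powr p) \<partial>lborel)
        \<le> ennreal (2 powr p * 2 powr p) * (\<integral>\<^sup>+z\<in>{z. N z \<le> 1}. ennreal (?G x z powr p) \<partial>lborel)
          + ennreal (2 powr p * (L * C * C) powr p) * B * ennreal (cmod (u x) powr p)" for x
    proof -
      have "(\<integral>\<^sup>+z\<in>{z. N z \<le> 1}. ennreal (m x z powr p) \<partial>lborel)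
          \<le> (\<integral>\<^sup>+z. ennreal (2 powr p * 2 powr p) * (ennreal (?G x z powr p) * indicator {z. N z \<le> 1} z)
            + ennreal (2 powr p * (L * C * C) powr p) * ennreal (cmod (u x) powr p) * indicator {z. N z \<le> 1} z \<partial>lborel)"
      proof (rule nn_integral_mono)
        fix z
        show "ennreal (m x z powr p) * indicator {z. N z \<le> 1} z
          \<le> ennreal (2 powr p * 2 powr p) * (ennreal (?G x z powr p) * indicator {z. N z \<le> 1} z)
            + ennreal (2 powr p * (L * C * C) powr p) * ennreal (cmod (u x) powr p) * indicator {z. N z \<le> 1} z"
        proof (cases "N z \<le> 1")
          case True
          have nz: "norm z \<le> C" using C(2)[of z] mult_left_mono[OF True less_imp_le[OF C(1)]] by simp
          have "m x z \<le> 2 * ?G x z + L * C * C * cmod (u x)"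
            unfolding m_def using cmod_le_cmod_p[of p] p nz L C(1)
            by (intro add_mono mult_right_mono mult_left_mono) auto
          then have "m x z powr p \<le> (2 * ?G x z + L * C * C * cmod (u x)) powr p"
            using p m_nonneg by (intro powr_mono2) auto
          also have "\<dots> \<le> 2 powr p * (2 * ?G x z) powr p + 2 powr p * (L * C * C * cmod (u x)) powr p"
            using p L C(1) cmod_p_nonneg by (intro powr_add_le) auto
          also have "\<dots> = 2 powr p * 2 powr p * ?G x z powr p + 2 powr p * (L * C * C) powr p * cmod (u x) powr p"
            using L C(1) cmod_p_nonneg by (simp add: powr_mult)
          finally show ?thesis
            using True by (simp add: ennreal_leI flip: ennreal_mult ennreal_plus)
        qed simp
      qed
      also have "\<dots> = ennreal (2 powr p * 2 powr p) * (\<integral>\<^sup>+z\<in>{z. N z \<le> 1}. ennreal (?G x z powr p) \<partial>lborel)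
          + ennreal (2 powr p * (L * C * C) powr p) * ennreal (cmod (u x) powr p) * B"
        unfolding B_def by (subst nn_integral_add, measurable, subst nn_integral_cmult, measurable, subst nn_integral_cmult_indicator, measurable)
      finally show ?thesis by (simp add: mult_ac)
    qed
    have "(\<integral>\<^sup>+w. \<Phi> w \<partial>lborel) = (\<integral>\<^sup>+w. (\<integral>\<^sup>+x. 80 * (a w * (ennreal (m x w) * indicator {w. 1/4 < m x w} w)) \<partial>lborel) \<partial>lborel)"
      unfolding \<Phi>_def
    proof (rule nn_integral_cong)
      fix w
      have "(\<integral>\<^sup>+x. 80 * (a w * (ennreal (m x w) * indicator {w. 1/4 < m x w} w)) \<partial>lborel)
          = 80 * (a w * (\<integral>\<^sup>+x. ennreal (m x w) * indicator {x. ennreal (1/4) < ennreal (m x w)} x \<partial>lborel))"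
        by (subst nn_integral_cmult, measurable, subst nn_integral_cmult, measurable) (simp add: ennreal_less_iff indicator_def)
      then show "a w * (80 * (\<integral>\<^sup>+x. ennreal (m x w) * indicator {x. ennreal (1/4) < ennreal (m x w)} x \<partial>lborel))
          = (\<integral>\<^sup>+x. 80 * (a w * (ennreal (m x w) * indicator {w. 1/4 < m x w} w)) \<partial>lborel)"
        by (simp add: mult.left_commute)
    qed
    also have "\<dots> = (\<integral>\<^sup>+x. (\<integral>\<^sup>+w. 80 * (a w * (ennreal (m x w) * indicator {w. 1/4 < m x w} w)) \<partial>lborel) \<partial>lborel)"
      by (rule lborel_pair.Fubini') measurable
    also have "\<dots> = (\<integral>\<^sup>+x. 80 * (ennreal c1 * (\<integral>\<^sup>+z\<in>{z. N z \<le> 1}. ennreal (m x z powr p) \<partial>lborel)) \<partial>lborel)"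
      by (subst nn_integral_cmult, measurable) (simp only: inner)
    also have "\<dots> \<le> (\<integral>\<^sup>+x. 80 * (ennreal c1 * (ennreal (2 powr p * 2 powr p) * (\<integral>\<^sup>+z\<in>{z. N z \<le> 1}. ennreal (?G x z powr p) \<partial>lborel)
          + ennreal (2 powr p * (L * C * C) powr p) * B * ennreal (cmod (u x) powr p))) \<partial>lborel)"
      by (intro nn_integral_mono mult_left_mono m_powr) auto
    also have "\<dots> = 80 * (ennreal c1 * (ennreal (2 powr p * 2 powr p) * (\<integral>\<^sup>+x. (\<integral>\<^sup>+z\<in>{z. N z \<le> 1}. ennreal (?G x z powr p) \<partial>lborel) \<partial>lborel)
          + ennreal (2 powr p * (L * C * C) powr p) * B * (\<integral>\<^sup>+x. ennreal (cmod (u x) powr p) \<partial>lborel)))"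
      by (simp add: nn_integral_cmult nn_integral_add)
    also have "\<dots> < \<infinity>"
      using energy u_Lp B by (simp add: ennreal_mult_less_top)
    finally show ?thesis .
  qed
  \<comment> \<open>For each x, homogeneity makes the exceptional set of w null; exchanging the two
    quantifiers gives, for almost every w, a null set of x.\<close>
  have neq: "AE w in lborel. AE x in lborel. ?G x w \<noteq> 1"
  proof (subst lborel_pair.AE_commute)
    show "AE x in lborel. AE w in lborel. ?G x w \<noteq> 1"
      using p by (intro AE_I2 AE_homogeneous_neq_1[of N])
        (simp_all add: is_norm_scaleR[OF N] is_norm_pos[OF N] cmod_p_nonneg mag_deriv_scaleR cmod_p_scaleR)
  qed measurable
  have \<Phi>_AE: "AE w in lborel. \<Phi> w \<noteq> \<infinity>"
    using \<Phi>_fin by (intro nn_integral_PInf_AE) auto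
  show ?thesis
    unfolding a_def[symmetric]
  proof (rule nn_integral_dominated_convergence[where w=\<Phi>])
    show "(\<integral>\<^sup>+w. \<Phi> w \<partial>lborel) < \<infinity>" by (rule \<Phi>_fin)
    show "AE w in lborel. (\<integral>\<^sup>+x. a w * indicator {x. d k < ?D k w x \<and> \<not> 1 < d k * N w} x \<partial>lborel) \<le> \<Phi> w" for k
    proof (rule AE_I2)
      fix w
      have "(\<integral>\<^sup>+x. a w * indicator {x. d k < ?D k w x \<and> \<not> 1 < d k * N w} x \<partial>lborel)
          \<le> (\<integral>\<^sup>+x. a w * indicator (E w) x \<partial>lborel)"
        using in_E[of k w] by (intro nn_integral_mono_AE) (auto elim!: eventually_mono simp: indicator_def)
      also have "\<dots> = a w * emeasure lborel (E w)" by (simp add: nn_integral_cmult)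
      also note aE
      finally show "(\<integral>\<^sup>+x. a w * indicator {x. d k < ?D k w x \<and> \<not> 1 < d k * N w} x \<partial>lborel) \<le> \<Phi> w" .
    qed
    show "AE w in lborel. (\<lambda>k. \<integral>\<^sup>+x. a w * indicator {x. d k < ?D k w x \<and> \<not> 1 < d k * N w} x \<partial>lborel)
        \<longlonglongrightarrow> (\<integral>\<^sup>+x. a w * indicator {x. 1 < ?G x w} x \<partial>lborel)"
      using neq \<Phi>_AE
    proof eventually_elim
      case (elim w)
      show ?case
      proof (rule nn_integral_dominated_convergence[where w="\<lambda>x. a w * indicator (E w) x"])
        show "AE x in lborel. a w * indicator {x. d k < ?D k w x \<and> \<not> 1 < d k * N w} x
            \<le> a w * indicator (E w) x" for k
          using in_E[of k w] by (auto elim!: eventually_mono simp: indicator_def)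
        have "(\<integral>\<^sup>+x. a w * indicator (E w) x \<partial>lborel) \<le> \<Phi> w"
          using aE[of w] by (simp add: nn_integral_cmult)
        then show "(\<integral>\<^sup>+x. a w * indicator (E w) x \<partial>lborel) < \<infinity>"
          using elim(2) by (simp add: less_top order_le_less_trans)
        show "AE x in lborel. (\<lambda>k. a w * indicator {x. d k < ?D k w x \<and> \<not> 1 < d k * N w} x)
            \<longlonglongrightarrow> a w * indicator {x. 1 < ?G x w} x"
          using elim(1) mag_diff_quotient_tendsto[OF u_int g_int u_meas g_meas weak A d, of w]
        proof eventually_elim
          case (elim x)
          have "(\<lambda>k. cmod_p p ((1 / d k) *\<^sub>R mag_diff A u x (d k *\<^sub>R w))) \<longlonglongrightarrow> ?G x w"
            using p elim(2) by (intro cmod_p_tendsto) auto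
          then have lim: "(\<lambda>k. ?D k w x / d k) \<longlonglongrightarrow> ?G x w"
            using p d(1) by (simp add: cmod_p_scaleR less_imp_le)
          have "(\<lambda>k. d k * N w) \<longlonglongrightarrow> 0 * N w" by (intro tendsto_intros d)
          then have small: "eventually (\<lambda>k. d k * N w < 1) sequentially"
            by (intro order_tendstoD) auto
          \<comment> \<open>The indicators are eventually constant in k: the quotient settles
            strictly on one side of 1, and the constraint on \<open>d k\<close> N w holds for all
            large k.\<close>
          have "eventually (\<lambda>k. (d k < ?D k w x \<and> \<not> 1 < d k * N w)
              \<longleftrightarrow> 1 < ?G x w) sequentially"
          proof (cases "1 < ?G x w")
            case True
            show ?thesis
              using order_tendstoD(1)[OF lim True] small
              by eventually_elim (use True d(1) in \<open>auto simp: less_divide_eq\<close>)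
          next
            case False
            then have "?G x w < 1" using elim(1) by simp
            from order_tendstoD(2)[OF lim this] small show ?thesis
              by eventually_elim (use False d(1) in \<open>auto simp: divide_less_eq\<close>)
          qed
          then show ?case
            by (intro tendsto_eventually) (erule eventually_mono, simp add: indicator_def)
        qed
      qed measurable
    qed
  qed measurable
qed

text \<open>The near part carries the whole limit. After Fubini, the superlevel formula evaluates it
  for each x and produces the factor q / p.\<close>

lemma scaled_tendsto:
  assumes d: "\<And>k. 0 < d k" "d \<longlonglongrightarrow> 0"
  shows "(\<lambda>k. \<integral>\<^sup>+w. (\<integral>\<^sup>+x. ennreal (1 / N w powr q) *
      indicator {x. d k < cmod_p p (mag_diff A u x (d k *\<^sub>R w))} x \<partial>lborel) \<partial>lborel)
    \<longlonglongrightarrow> (\<integral>\<^sup>+x. ennreal (q / p) *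
      (\<integral>\<^sup>+z\<in>{z. N z \<le> 1}. ennreal (cmod_p p (mag_deriv A u g x z) powr p) \<partial>lborel) \<partial>lborel)"
proof -
  let ?D = "\<lambda>k w x. cmod_p p (mag_diff A u x (d k *\<^sub>R w))"
  let ?a = "\<lambda>w. ennreal (1 / N w powr q)"
  let ?G = "\<lambda>x w. cmod_p p (mag_deriv A u g x w)"
  note [measurable] = lipschitz_on_UNIV_measurable[OF A] is_norm_measurable[OF N]
  have split: "(\<integral>\<^sup>+w. (\<integral>\<^sup>+x. ?a w *
      indicator {x. d k < ?D k w x} x \<partial>lborel) \<partial>lborel)
      = (\<integral>\<^sup>+w. (\<integral>\<^sup>+x. ?a w *
      indicator {x. d k < ?D k w x \<and> \<not> 1 < d k * N w} x \<partial>lborel) \<partial>lborel)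
      + (\<integral>\<^sup>+w. (\<integral>\<^sup>+x. ?a w *
      indicator {x. d k < ?D k w x \<and> 1 < d k * N w} x \<partial>lborel) \<partial>lborel)" for k
  proof (subst nn_integral_add[symmetric])
    show "(\<integral>\<^sup>+w. (\<integral>\<^sup>+x. ?a w *
      indicator {x. d k < ?D k w x} x \<partial>lborel) \<partial>lborel)
      = (\<integral>\<^sup>+w. (\<integral>\<^sup>+x. ?a w *
      indicator {x. d k < ?D k w x \<and> \<not> 1 < d k * N w} x \<partial>lborel)
      + (\<integral>\<^sup>+x. ?a w *
      indicator {x. d k < ?D k w x \<and> 1 < d k * N w} x \<partial>lborel) \<partial>lborel)"
    proof (rule nn_integral_cong, subst nn_integral_add[symmetric])
      fix w
      show "(\<integral>\<^sup>+x. ?a w *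
          indicator {x. d k < ?D k w x} x \<partial>lborel)
        = (\<integral>\<^sup>+x. ?a w *
          indicator {x. d k < ?D k w x \<and> \<not> 1 < d k * N w} x
          + ?a w *
          indicator {x. d k < ?D k w x \<and> 1 < d k * N w} x \<partial>lborel)"
        by (rule nn_integral_cong) (auto simp: indicator_def)
    qed measurable
  qed measurable
  have "(\<integral>\<^sup>+w. (\<integral>\<^sup>+x. ?a w *
      indicator {x. 1 < ?G x w} x \<partial>lborel) \<partial>lborel)
      = (\<integral>\<^sup>+x. (\<integral>\<^sup>+w. ?a w *
      indicator {x. 1 < ?G x w} x \<partial>lborel) \<partial>lborel)"
    by (rule lborel_pair.Fubini') measurable
  also have "\<dots> = (\<integral>\<^sup>+x. ennreal (q / p) *
      (\<integral>\<^sup>+z\<in>{z. N z \<le> 1}. ennreal (?G x z powr p) \<partial>lborel) \<partial>lborel)"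
  proof (rule nn_integral_cong)
    fix x
    have "(\<integral>\<^sup>+w. ?a w * indicator {x. 1 < ?G x w} x \<partial>lborel)
        = (\<integral>\<^sup>+w. ?a w * indicator {w. 1 < ?G x w} w \<partial>lborel)"
      by (intro nn_integral_cong) (simp add: indicator_def)
    also have "\<dots> = ennreal (q / p) *
      (\<integral>\<^sup>+z\<in>{z. N z \<le> 1}. ennreal (?G x z powr p) \<partial>lborel)"
      using nn_integral_homogeneous_superlevel[of N "\<lambda>w. ?G x w" p] p
      by (simp add: is_norm_scaleR[OF N] is_norm_pos[OF N] cmod_p_nonneg mag_deriv_scaleR cmod_p_scaleR q)
    finally show "(\<integral>\<^sup>+w. ?a w * indicator {x. 1 < ?G x w} x \<partial>lborel)
      = ennreal (q / p) *
      (\<integral>\<^sup>+z\<in>{z. N z \<le> 1}. ennreal (?G x z powr p) \<partial>lborel)" .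
  qed
  finally show ?thesis
    unfolding split using tendsto_add[OF near_tendsto[OF d] far_tendsto_0[OF d]] by simp
qed

end

text \<open>Under y = x + \<delta> w the Jacobian \<delta>^n and the factor \<delta>^p cancel the
  \<delta>^(n+p) that comes out of the norm. Fubini first makes y the inner variable for this
  substitution and then moves w outside, since the limit will be studied for fixed w.\<close>

lemma nn_integral_magnetic_shift:
  fixes N :: "real^'n \<Rightarrow> real" and A :: "real^'n \<Rightarrow> real^'n" and u :: "real^'n \<Rightarrow> complex"
  assumes [measurable]: "A \<in> borel_measurable borel" "u \<in> borel_measurable borel"
    and N: "is_norm N" and \<delta>: "0 < \<delta>"
  shows "(\<integral>\<^sup>+y. (\<integral>\<^sup>+x. ennreal (\<delta> powr p / N (x - y) powr (real CARD('n) + p)) *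
      indicator {(x, y). cmod_p p (magnetic_shift A u x y - magnetic_shift A u x x) > \<delta>} (x, y) \<partial>lborel) \<partial>lborel)
    = (\<integral>\<^sup>+w. (\<integral>\<^sup>+x. ennreal (1 / N w powr (real CARD('n) + p)) *
      indicator {x. \<delta> < cmod_p p (mag_diff A u x (\<delta> *\<^sub>R w))} x \<partial>lborel) \<partial>lborel)"
proof -
  note [measurable] = is_norm_measurable[OF N]
  define F where "F x y = ennreal (\<delta> powr p / N (x - y) powr (real CARD('n) + p)) *
      indicator {(x, y). cmod_p p (magnetic_shift A u x y - magnetic_shift A u x x) > \<delta>} (x, y)" for x y
  have F_eq: "F x y = ennreal (\<delta> powr p / N (x - y) powr (real CARD('n) + p)) *
      indicator {\<delta><..} (cmod_p p (mag_diff A u x (y - x)))" for x y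
  proof -
    have "magnetic_shift A u x y - magnetic_shift A u x x = mag_diff A u x (y - x)"
    proof -
      have "midpoint x y = x + (1/2) *\<^sub>R (y - x)"
        by (simp add: vec_eq_iff midpoint_def field_simps)
      moreover have "(x - y) \<bullet> v = - ((y - x) \<bullet> v)" for v
        by (simp add: inner_diff_left)
      ultimately show ?thesis
        by (simp add: magnetic_shift_def mag_diff_def)
    qed
    then show ?thesis by (simp add: F_def indicator_def)
  qed
  have "(\<integral>\<^sup>+y. (\<integral>\<^sup>+x. F x y \<partial>lborel) \<partial>lborel) = (\<integral>\<^sup>+x. (\<integral>\<^sup>+y. F x y \<partial>lborel) \<partial>lborel)"
    unfolding F_eq by (rule lborel_pair.Fubini') measurable
  also have "\<dots> = (\<integral>\<^sup>+x. (\<integral>\<^sup>+w. ennreal (1 / N w powr (real CARD('n) + p)) *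
      indicator {x. \<delta> < cmod_p p (mag_diff A u x (\<delta> *\<^sub>R w))} x \<partial>lborel) \<partial>lborel)"
  proof (rule nn_integral_cong)
    fix x :: "real^'n"
    have "(\<integral>\<^sup>+y. F x y \<partial>lborel) = ennreal (\<bar>\<delta>\<bar> ^ DIM(real^'n)) * (\<integral>\<^sup>+w. F x (x + \<delta> *\<^sub>R w) \<partial>lborel)"
      using \<delta> unfolding F_eq by (intro nn_integral_affine) auto
    also have "\<dots> = (\<integral>\<^sup>+w. ennreal (\<bar>\<delta>\<bar> ^ DIM(real^'n)) * F x (x + \<delta> *\<^sub>R w) \<partial>lborel)"
      unfolding F_eq by (rule nn_integral_cmult[symmetric]) measurable
    also have "\<dots> = (\<integral>\<^sup>+w. ennreal (1 / N w powr (real CARD('n) + p)) *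
      indicator {x. \<delta> < cmod_p p (mag_diff A u x (\<delta> *\<^sub>R w))} x \<partial>lborel)"
    proof (rule nn_integral_cong)
      fix w :: "real^'n"
      have "N (x - (x + \<delta> *\<^sub>R w)) = \<delta> * N w"
        using is_norm_minus[OF N, of "\<delta> *\<^sub>R w"] is_norm_scaleR[OF N, of \<delta> w] \<delta> by simp
      \<comment> \<open>This includes w = 0, where both sides are 0 because division by 0 gives
        0.\<close>
      then have "\<bar>\<delta>\<bar> ^ DIM(real^'n) * (\<delta> powr p / N (x - (x + \<delta> *\<^sub>R w)) powr (real CARD('n) + p))
          = 1 / N w powr (real CARD('n) + p)"
        using \<delta> is_norm_nonneg[OF N, of w]
        by (simp add: powr_mult powr_add flip: powr_realpow)
      then have "ennreal (\<bar>\<delta>\<bar> ^ DIM(real^'n)) * ennreal (\<delta> powr p / N (x - (x + \<delta> *\<^sub>R w)) powr (real CARD('n) + p))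
          = ennreal (1 / N w powr (real CARD('n) + p))"
        by (subst ennreal_mult'[symmetric]) (auto simp: \<delta> less_imp_le)
      then show "ennreal (\<bar>\<delta>\<bar> ^ DIM(real^'n)) * F x (x + \<delta> *\<^sub>R w) = ennreal (1 / N w powr (real CARD('n) + p)) *
        indicator {x. \<delta> < cmod_p p (mag_diff A u x (\<delta> *\<^sub>R w))} x"
        by (simp only: F_eq mult.assoc[symmetric] add_diff_cancel_left') (simp add: indicator_def)
    qed
    finally show "(\<integral>\<^sup>+y. F x y \<partial>lborel) = (\<integral>\<^sup>+w. ennreal (1 / N w powr (real CARD('n) + p)) *
      indicator {x. \<delta> < cmod_p p (mag_diff A u x (\<delta> *\<^sub>R w))} x \<partial>lborel)" .
  qed
  also have "\<dots> = (\<integral>\<^sup>+w. (\<integral>\<^sup>+x. ennreal (1 / N w powr (real CARD('n) + p)) *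
      indicator {x. \<delta> < cmod_p p (mag_diff A u x (\<delta> *\<^sub>R w))} x \<partial>lborel) \<partial>lborel)"
    by (rule lborel_pair.Fubini') measurable
  finally show ?thesis by (simp add: F_def)
qed

text \<open>The integrand is continuous and K is compact, so the Bochner integral over K is finite
  and coincides with the nonnegative integral that the homogeneity formulas produce. The power p
  undoes the root in the definition.\<close>

lemma polar_moment_norm_powr:
  fixes K :: "(real^'n) set" and v :: "complex^'n"
  assumes K: "compact K" and p: "1 < p"
  shows "ennreal (polar_moment_norm p K v powr p)
    = ennreal ((real CARD('n) + p) / p) * (\<integral>\<^sup>+z\<in>K. ennreal (cmod_p p (cdot v z) powr p) \<partial>lborel)"
proof -
  define f where "f z = cmod_p p (cdot v z) powr p" for z
  have cont: "continuous_on UNIV f"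
    unfolding f_def cdot_def using p cmod_p_continuous[of p] cmod_p_nonneg
    by (intro continuous_on_powr' continuous_on_compose2[OF cmod_p_continuous] continuous_intros) auto
  then have [measurable]: "f \<in> borel_measurable borel" by (rule borel_measurable_continuous_onI)
  have [measurable]: "K \<in> sets borel" using K by (simp add: compact_imp_closed)
  have int: "integrable lborel (\<lambda>z. indicator K z *\<^sub>R f z)"
    using borel_integrable_compact[OF K continuous_on_subset[OF cont]] by simp
  have "(LINT z:K|lebesgue. f z) = (LINT z|lborel. indicator K z *\<^sub>R f z)"
    unfolding set_lebesgue_integral_def by (rule integral_completion) measurable
  moreover have "(\<integral>\<^sup>+z. ennreal (indicator K z *\<^sub>R f z) \<partial>lborel) = ennreal (LINT z|lborel. indicator K z *\<^sub>R f z)"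
    by (rule nn_integral_eq_integral[OF int]) (simp add: f_def)
  moreover have "(\<integral>\<^sup>+z. ennreal (indicator K z *\<^sub>R f z) \<partial>lborel) = (\<integral>\<^sup>+z\<in>K. ennreal (f z) \<partial>lborel)"
    by (intro nn_integral_cong) (simp add: indicator_def)
  ultimately have eq: "ennreal (LINT z:K|lebesgue. f z) = (\<integral>\<^sup>+z\<in>K. ennreal (f z) \<partial>lborel)"
    by simp
  have nonneg: "0 \<le> (LINT z:K|lebesgue. f z)"
    unfolding set_lebesgue_integral_def by (intro integral_nonneg_AE AE_I2) (simp add: f_def)
  have "polar_moment_norm p K v powr p = (real CARD('n) + p) / p * (LINT z:K|lebesgue. f z)"
    unfolding polar_moment_norm_def f_def[symmetric] using p nonneg by (simp add: powr_powr)
  then have "ennreal (polar_moment_norm p K v powr p) = ennreal ((real CARD('n) + p) / p) * ennreal (LINT z:K|lebesgue. f z)"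
    using p nonneg by (subst ennreal_mult[symmetric]) auto
  then show ?thesis unfolding eq by (simp add: f_def)
qed

section \<open>Borel representatives and the limit formula\<close>

text \<open>The Fubini arguments live on products of Borel measures, whereas u and g are only
  Lebesgue measurable. Restrictions to balls show that f is measurable, and each coordinate agrees
  almost everywhere with a Borel function.\<close>

lemma locally_integrable_borel_representative:
  fixes f :: "real^'n \<Rightarrow> 'b::euclidean_space"
  assumes f: "locally_integrable f"
  obtains f' where "f' \<in> borel_measurable borel" "AE x in lborel. f x = f' x"
    "\<And>R. integrable lborel (\<lambda>x. indicator (cball 0 R) x *\<^sub>R f' x)"
proof -
  have int: "integrable lebesgue (\<lambda>x. indicator (cball 0 R) x *\<^sub>R f x)" for R
    using f by (simp add: locally_integrable_def set_integrable_def)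
  have f_meas: "f \<in> borel_measurable lebesgue"
  proof (rule borel_measurable_LIMSEQ_metric)
    show "(\<lambda>x. indicator (cball 0 (real n)) x *\<^sub>R f x) \<in> borel_measurable lebesgue" for n
      using int by (rule borel_measurable_integrable)
    fix x :: "real^'n"
    obtain m :: nat where m: "norm x \<le> real m" using real_arch_simple by blast
    have "eventually (\<lambda>n. indicator (cball 0 (real n)) x *\<^sub>R f x = f x) sequentially"
      using eventually_ge_at_top[of m] by eventually_elim (use m in \<open>simp add: indicator_def\<close>)
    then show "(\<lambda>n. indicator (cball 0 (real n)) x *\<^sub>R f x) \<longlonglongrightarrow> f x"
      by (rule tendsto_eventually)
  qed
  have "\<exists>h\<in>borel_measurable lborel. AE x in lborel. f x \<bullet> b = h x" for b
    by (intro completion_ex_borel_measurable_real borel_measurable_inner f_meas) simp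
  then obtain h where h: "\<And>b. h b \<in> borel_measurable lborel" "\<And>b. AE x in lborel. f x \<bullet> b = h b x"
    by metis
  have [measurable]: "h b \<in> borel_measurable borel" for b using h(1) by simp
  define f' where "f' x = (\<Sum>b\<in>Basis. h b x *\<^sub>R b)" for x
  have [measurable]: "f' \<in> borel_measurable borel" unfolding f'_def by measurable
  have "AE x in lborel. \<forall>b\<in>Basis. f x \<bullet> b = h b x"
    using h(2) by (intro AE_finite_allI) auto
  then have eq: "AE x in lborel. f x = f' x"
  proof eventually_elim
    case (elim x)
    then show ?case using euclidean_representation[of "f x"] by (simp add: f'_def)
  qed
  have "integrable lborel (\<lambda>x. indicator (cball 0 R) x *\<^sub>R f' x)" for R
  proof -
    have [measurable]: "cball 0 R \<in> sets (borel :: (real^'n) measure)" by simp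
    have m: "(\<lambda>x. indicator (cball 0 R) x *\<^sub>R f' x) \<in> borel_measurable lborel" by measurable
    have "integrable lebesgue (\<lambda>x. indicator (cball 0 R) x *\<^sub>R f' x)"
      by (rule integrable_cong_AE_imp[OF int[of R] measurable_completion[OF m]])
        (use AE_completion[OF eq] in \<open>auto elim!: eventually_mono\<close>)
    then show ?thesis using m by (simp add: integrable_completion)
  qed
  then show thesis using that[of f'] eq by simp
qed

lemma integral_lebesgue_eq_lborel:
  fixes f h :: "'a::euclidean_space \<Rightarrow> 'b::euclidean_space"
  assumes h: "h \<in> borel_measurable borel" and f: "AE x in lborel. f x = h x"
  shows "(LINT x|lebesgue. f x) = (LINT x|lborel. h x)"
proof -
  have h': "h \<in> borel_measurable lborel" using h by simp
  have eq: "AE x in lebesgue. h x = f x"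
    using AE_completion[OF f] by eventually_elim simp
  have hc: "h \<in> borel_measurable lebesgue" by (rule measurable_completion[OF h'])
  have "f \<in> borel_measurable lebesgue"
    by (rule borel_measurable_AE[OF hc eq])
  then have "(LINT x|lebesgue. f x) = (LINT x|lebesgue. h x)"
    using hc eq by (intro integral_cong_AE) auto
  then show ?thesis using integral_completion[OF h'] by simp
qed

text \<open>The Borel version \<open>u'\<close> is prescribed rather than produced, so that two
  gradients of u can be compared through one and the same \<open>u'\<close>.\<close>

lemma has_weak_gradient_borel:
  fixes u :: "real^'n \<Rightarrow> complex" and g :: "real^'n \<Rightarrow> complex^'n"
  assumes g: "has_weak_gradient u g"
    and u': "u' \<in> borel_measurable borel" "AE x in lborel. u x = u' x"
  obtains g' where "g' \<in> borel_measurable borel" "AE x in lborel. g x = g' x"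
    "\<And>R j. integrable lborel (\<lambda>x. indicator (cball 0 R) x *\<^sub>R (g' x $ j))"
    "\<forall>\<phi> j. test_function \<phi> \<longrightarrow>
      (LINT x|lborel. u' x * complex_of_real (partial_deriv j \<phi> x)) =
      - (LINT x|lborel. g' x $ j * complex_of_real (\<phi> x))"
proof -
  have "locally_integrable g" using g by (simp add: has_weak_gradient_def)
  then obtain g' where g': "g' \<in> borel_measurable borel" "AE x in lborel. g x = g' x"
    "\<And>R. integrable lborel (\<lambda>x. indicator (cball 0 R) x *\<^sub>R g' x)"
    by (rule locally_integrable_borel_representative) (rule that)
  have [measurable]: "g' \<in> borel_measurable borel" "u' \<in> borel_measurable borel" by (rule g'(1) u'(1))+
  have [measurable]: "(\<lambda>x. g' x $ j) \<in> borel_measurable borel" for j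
    by (rule borel_measurable_vec_nth_comp[OF g'(1)])
  show thesis
  proof
    show "integrable lborel (\<lambda>x. indicator (cball 0 R) x *\<^sub>R (g' x $ j))" for R j
      using integrable_bounded_linear[OF bounded_linear_vec_nth g'(3)[of R], of j] by simp
    show "\<forall>\<phi> j. test_function \<phi> \<longrightarrow>
      (LINT x|lborel. u' x * complex_of_real (partial_deriv j \<phi> x)) =
      - (LINT x|lborel. g' x $ j * complex_of_real (\<phi> x))"
    proof (intro allI impI)
      fix \<phi> :: "real^'n \<Rightarrow> real" and j assume t: "test_function \<phi>"
      have [measurable]: "\<phi> \<in> borel_measurable borel" "partial_deriv j \<phi> \<in> borel_measurable borel"
        using test_function_continuous[OF t] by (auto intro!: borel_measurable_continuous_onI)
      have "(LINT x|lebesgue. u x * complex_of_real (partial_deriv j \<phi> x)) = (LINT x|lborel. u' x * complex_of_real (partial_deriv j \<phi> x))"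
        using u'(2) by (intro integral_lebesgue_eq_lborel) (measurable, auto elim!: eventually_mono)
      moreover have "(LINT x|lebesgue. g x $ j * complex_of_real (\<phi> x)) = (LINT x|lborel. g' x $ j * complex_of_real (\<phi> x))"
        using g'(2) by (intro integral_lebesgue_eq_lborel) (measurable, auto elim!: eventually_mono)
      ultimately show "(LINT x|lborel. u' x * complex_of_real (partial_deriv j \<phi> x)) =
          - (LINT x|lborel. g' x $ j * complex_of_real (\<phi> x))"
        using g t by (simp add: has_weak_gradient_def)
    qed
  qed (use g' in auto)
qed

lemma test_function_mult_integrable:
  fixes v :: "real^'n \<Rightarrow> complex"
  assumes t: "test_function \<phi>" and v: "\<And>R. integrable lborel (\<lambda>x. indicator (cball 0 R) x *\<^sub>R v x)"
    and [measurable]: "v \<in> borel_measurable borel"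
  shows "integrable lborel (\<lambda>x. v x * complex_of_real (\<phi> x))"
proof -
  obtain R where R: "\<And>x. x \<notin> cball 0 R \<Longrightarrow> \<phi> x = 0"
    using test_function_support[OF t] by metis
  obtain B where B: "0 \<le> B" "\<And>x. norm (\<phi> x) \<le> B * indicator (cball 0 R) x"
    using continuous_compact_support_bounded[OF test_function_continuous(1)[OF t] R] by blast
  have [measurable]: "\<phi> \<in> borel_measurable borel"
    using test_function_continuous[OF t] by (auto intro!: borel_measurable_continuous_onI)
  have "integrable lborel (\<lambda>x. complex_of_real (\<phi> x) * v x)"
    by (rule integrable_bounded_mult[OF v _ _ _ B(1)]) (use B(2) in auto)
  then show ?thesis by (simp add: mult.commute)
qed

text \<open>Membership in \<open>magnetic_sobolev\<close> gives finite energy for some gradient,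
  while the theorem speaks of a given g; uniqueness transfers the finiteness. Both gradients have
  equal integrals against every test function, so the fundamental lemma applies to each component of
  the difference.\<close>

lemma weak_gradient_unique:
  fixes u :: "real^'n \<Rightarrow> complex" and g1 g2 :: "real^'n \<Rightarrow> complex^'n"
  assumes u': "u' \<in> borel_measurable borel" "AE x in lborel. u x = u' x"
    and g1: "has_weak_gradient u g1" and g2: "has_weak_gradient u g2"
  shows "AE x in lborel. g1 x = g2 x"
proof -
  obtain h1 where h1: "h1 \<in> borel_measurable borel" "AE x in lborel. g1 x = h1 x"
    "\<And>R j. integrable lborel (\<lambda>x. indicator (cball 0 R) x *\<^sub>R (h1 x $ j))"
    "\<forall>\<phi> j. test_function \<phi> \<longrightarrow>
      (LINT x|lborel. u' x * complex_of_real (partial_deriv j \<phi> x)) =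
      - (LINT x|lborel. h1 x $ j * complex_of_real (\<phi> x))"
    by (rule has_weak_gradient_borel[OF g1 u']) (rule that)
  obtain h2 where h2: "h2 \<in> borel_measurable borel" "AE x in lborel. g2 x = h2 x"
    "\<And>R j. integrable lborel (\<lambda>x. indicator (cball 0 R) x *\<^sub>R (h2 x $ j))"
    "\<forall>\<phi> j. test_function \<phi> \<longrightarrow>
      (LINT x|lborel. u' x * complex_of_real (partial_deriv j \<phi> x)) =
      - (LINT x|lborel. h2 x $ j * complex_of_real (\<phi> x))"
    by (rule has_weak_gradient_borel[OF g2 u']) (rule that)
  have "AE x in lborel. h1 x $ j - h2 x $ j = 0" for j
  proof (rule AE_zero_of_test_functions)
    have m: "(\<lambda>x. h1 x $ j) \<in> borel_measurable borel" "(\<lambda>x. h2 x $ j) \<in> borel_measurable borel"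
      by (rule borel_measurable_vec_nth_comp[OF h1(1)] borel_measurable_vec_nth_comp[OF h2(1)])+
    show "(\<lambda>x. h1 x $ j - h2 x $ j) \<in> borel_measurable borel"
      using m by (rule borel_measurable_diff)
    show "integrable lborel (\<lambda>x. indicator (cball 0 R) x *\<^sub>R (h1 x $ j - h2 x $ j))" for R
      unfolding scaleR_diff_right by (rule Bochner_Integration.integrable_diff[OF h1(3) h2(3)])
    fix \<phi> :: "real^'n \<Rightarrow> real" assume t: "test_function \<phi>"
    have "(LINT x|lborel. \<phi> x *\<^sub>R (h1 x $ j - h2 x $ j))
        = (LINT x|lborel. h1 x $ j * complex_of_real (\<phi> x) - h2 x $ j * complex_of_real (\<phi> x))"
      by (rule Bochner_Integration.integral_cong[OF refl]) (simp add: scaleR_conv_of_real[where 'a=complex] algebra_simps)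
    also have "\<dots> = (LINT x|lborel. h1 x $ j * complex_of_real (\<phi> x)) - (LINT x|lborel. h2 x $ j * complex_of_real (\<phi> x))"
      by (rule Bochner_Integration.integral_diff[OF test_function_mult_integrable[OF t h1(3) m(1)]
            test_function_mult_integrable[OF t h2(3) m(2)]])
    also have "\<dots> = 0"
      using h1(4)[rule_format, OF t, of j] h2(4)[rule_format, OF t, of j] by simp
    finally show "(LINT x|lborel. \<phi> x *\<^sub>R (h1 x $ j - h2 x $ j)) = 0" .
  qed
  then have "AE x in lborel. \<forall>j. h1 x $ j - h2 x $ j = 0"
    by (subst AE_all_countable) blast
  then show ?thesis
    using h1(2) h2(2) by eventually_elim (simp add: vec_eq_iff)
qed

theorem theorem1p1:
  fixes K :: "(real^'n) set"
    and A :: "real^'n \<Rightarrow> real^'n"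
    and p :: real
    and u :: "real^'n \<Rightarrow> complex"
    and g :: "real^'n \<Rightarrow> complex^'n"
  assumes "norm_body K"
    and "p > 1"
    and "\<exists>L. L-lipschitz_on UNIV A"
    and "u \<in> magnetic_sobolev p A K"
    and "has_weak_gradient u g"
  shows "((\<lambda>\<delta>. \<integral>\<^sup>+ y. \<integral>\<^sup>+ x.
             ennreal (\<delta> powr p / gauge_norm K (x - y) powr (real CARD('n) + p)) *
             indicator {(x, y). cmod_p p (magnetic_shift A u x y - magnetic_shift A u x x) > \<delta>} (x, y)
           \<partial>lebesgue \<partial>lebesgue)
         \<longlongrightarrow>
         (\<integral>\<^sup>+ x. ennreal (polar_moment_norm p K
             (g x - (\<chi> j. \<i> * complex_of_real (A x $ j) * u x)) powr p) \<partial>lebesgue))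
         (at_right 0)"
proof -
  define N where "N = gauge_norm K"
  have N: "is_norm N" and K: "{z. N z \<le> 1} = K"
    using assms(1) by (auto simp: norm_body_def N_def)
  have p: "1 < p" by fact
  obtain L where L: "L-lipschitz_on UNIV A" using assms(3) by blast
  note [measurable] = lipschitz_on_UNIV_measurable[OF L]
  have "compact K"
    using is_norm_compact_ball[OF N] K by simp
  have "locally_integrable u" using assms(5) by (simp add: has_weak_gradient_def)
  then obtain u' where u': "u' \<in> borel_measurable borel" "AE x in lborel. u x = u' x"
    "\<And>R. integrable lborel (\<lambda>x. indicator (cball 0 R) x *\<^sub>R u' x)"
    by (rule locally_integrable_borel_representative) (rule that)
  obtain g' where g': "g' \<in> borel_measurable borel" "AE x in lborel. g x = g' x"
    "\<And>R j. integrable lborel (\<lambda>x. indicator (cball 0 R) x *\<^sub>R (g' x $ j))"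
    "\<forall>\<phi> j. test_function \<phi> \<longrightarrow>
      (LINT x|lborel. u' x * complex_of_real (partial_deriv j \<phi> x)) =
      - (LINT x|lborel. g' x $ j * complex_of_real (\<phi> x))"
    by (rule has_weak_gradient_borel[OF assms(5) u'(1,2)]) (rule that)
  have [measurable]: "u' \<in> borel_measurable borel" "g' \<in> borel_measurable borel" by (rule g'(1) u'(1))+
  have [measurable]: "K \<in> sets borel" using \<open>compact K\<close> by (simp add: compact_imp_closed)
  define q where "q = real CARD('n) + p"
  \<comment> \<open>Stated for every h that equals \<open>g'\<close> almost everywhere, as it is
    used twice: for the gradient \<open>g1\<close> of finite energy and for the given
    \<open>g\<close>.\<close>
  have energy_eq: "(\<integral>\<^sup>+x. ennreal (polar_moment_norm p K (magnetic_gradient A u h x) powr p) \<partial>lebesgue)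
      = (\<integral>\<^sup>+x. ennreal (q / p) * (\<integral>\<^sup>+z\<in>{z. N z \<le> 1}. ennreal (cmod_p p (mag_deriv A u' g' x z) powr p) \<partial>lborel) \<partial>lborel)"
    if "AE x in lborel. h x = g' x" for h
  proof -
    have "(\<integral>\<^sup>+x. ennreal (polar_moment_norm p K (magnetic_gradient A u h x) powr p) \<partial>lebesgue)
        = (\<integral>\<^sup>+x. ennreal (polar_moment_norm p K (magnetic_gradient A u h x) powr p) \<partial>lborel)"
      by (rule nn_integral_completion)
    also have "\<dots> = (\<integral>\<^sup>+x. ennreal (polar_moment_norm p K (magnetic_gradient A u' g' x) powr p) \<partial>lborel)"
      using that u'(2) by (intro nn_integral_cong_AE) (auto simp: magnetic_gradient_def elim!: eventually_elim2)
    finally show ?thesis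
      by (simp add: polar_moment_norm_powr[OF \<open>compact K\<close> p] K q_def mag_deriv_def)
  qed
  obtain g1 where g1: "has_weak_gradient u g1" "magnetic_energy p A K u g1 < \<infinity>"
    using assms(4) by (auto simp: magnetic_sobolev_def)
  have "AE x in lborel. g1 x = g x"
    by (rule weak_gradient_unique[OF u'(1,2) g1(1) assms(5)])
  then have "AE x in lborel. g1 x = g' x"
    using g'(2) by eventually_elim simp
  from energy_eq[OF this] g1(2)
  have "(\<integral>\<^sup>+x. ennreal (q / p) * (\<integral>\<^sup>+z\<in>{z. N z \<le> 1}. ennreal (cmod_p p (mag_deriv A u' g' x z) powr p) \<partial>lborel) \<partial>lborel) < \<infinity>"
    by (simp add: magnetic_energy_def)
  moreover have "(\<integral>\<^sup>+x. ennreal (q / p) * (\<integral>\<^sup>+z\<in>{z. N z \<le> 1}. ennreal (cmod_p p (mag_deriv A u' g' x z) powr p) \<partial>lborel) \<partial>lborel)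
      = ennreal (q / p) * (\<integral>\<^sup>+x. (\<integral>\<^sup>+z\<in>{z. N z \<le> 1}. ennreal (cmod_p p (mag_deriv A u' g' x z) powr p) \<partial>lborel) \<partial>lborel)"
    unfolding K by (rule nn_integral_cmult) measurable
  moreover have "0 < q / p" using p by (simp add: q_def add_nonneg_pos)
  ultimately have energy: "(\<integral>\<^sup>+x. (\<integral>\<^sup>+z\<in>{z. N z \<le> 1}. ennreal (cmod_p p (mag_deriv A u' g' x z) powr p) \<partial>lborel) \<partial>lborel) < \<infinity>"
    by (auto simp: ennreal_mult_less_top)
  have u_Lp: "(\<integral>\<^sup>+x. ennreal (cmod (u' x) powr p) \<partial>lborel) < \<infinity>"
  proof -
    have "(\<integral>\<^sup>+x. ennreal (cmod (u' x) powr p) \<partial>lborel) \<le> (\<integral>\<^sup>+x. ennreal (2 powr p) * ennreal (cmod_p p (u' x) powr p) \<partial>lborel)"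
    proof (rule nn_integral_mono)
      fix x
      have "cmod (u' x) powr p \<le> (2 * cmod_p p (u' x)) powr p"
        using p cmod_le_cmod_p[of p "u' x"] by (intro powr_mono2) auto
      also have "\<dots> = 2 powr p * cmod_p p (u' x) powr p"
        using cmod_p_nonneg by (simp add: powr_mult)
      finally show "ennreal (cmod (u' x) powr p) \<le> ennreal (2 powr p) * ennreal (cmod_p p (u' x) powr p)"
        by (simp add: ennreal_leI flip: ennreal_mult)
    qed
    also have "\<dots> = ennreal (2 powr p) * (\<integral>\<^sup>+x. ennreal (cmod_p p (u' x) powr p) \<partial>lborel)"
      by (rule nn_integral_cmult) measurable
    also have "(\<integral>\<^sup>+x. ennreal (cmod_p p (u' x) powr p) \<partial>lborel) = (\<integral>\<^sup>+x. ennreal (cmod_p p (u x) powr p) \<partial>lebesgue)"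
      unfolding nn_integral_completion using u'(2) by (intro nn_integral_cong_AE) (auto elim!: eventually_mono)
    also have "ennreal (2 powr p) * (\<integral>\<^sup>+x. ennreal (cmod_p p (u x) powr p) \<partial>lebesgue) < \<infinity>"
      using assms(4) by (simp add: magnetic_sobolev_def Lp_space_def ennreal_mult_less_top)
    finally show ?thesis .
  qed
  \<comment> \<open>Nonnegative integrals over a completion agree with those over the original
    measure for all functions, which passes from \<open>lebesgue\<close> to \<open>lborel\<close>.
    Then u is replaced by \<open>u'\<close> for almost every y and, for each such y, almost every
    x.\<close>
  have rewrite: "(\<integral>\<^sup>+ y. \<integral>\<^sup>+ x. ennreal (\<delta> powr p / gauge_norm K (x - y) powr (real CARD('n) + p)) *
        indicator {(x, y). cmod_p p (magnetic_shift A u x y - magnetic_shift A u x x) > \<delta>} (x, y) \<partial>lebesgue \<partial>lebesgue)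
      = (\<integral>\<^sup>+w. (\<integral>\<^sup>+x. ennreal (1 / N w powr q) *
        indicator {x. \<delta> < cmod_p p (mag_diff A u' x (\<delta> *\<^sub>R w))} x \<partial>lborel) \<partial>lborel)" if "0 < \<delta>" for \<delta>
  proof -
    have "(\<integral>\<^sup>+ y. \<integral>\<^sup>+ x. ennreal (\<delta> powr p / gauge_norm K (x - y) powr (real CARD('n) + p)) *
        indicator {(x, y). cmod_p p (magnetic_shift A u x y - magnetic_shift A u x x) > \<delta>} (x, y) \<partial>lborel \<partial>lborel)
      = (\<integral>\<^sup>+ y. \<integral>\<^sup>+ x. ennreal (\<delta> powr p / N (x - y) powr (real CARD('n) + p)) *
        indicator {(x, y). cmod_p p (magnetic_shift A u' x y - magnetic_shift A u' x x) > \<delta>} (x, y) \<partial>lborel \<partial>lborel)"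
    proof (rule nn_integral_cong_AE, use u'(2) in eventually_elim, rule nn_integral_cong_AE, use u'(2) in eventually_elim)
      fix x y assume "u y = u' y" "u x = u' x"
      then show "ennreal (\<delta> powr p / gauge_norm K (x - y) powr (real CARD('n) + p)) *
          indicator {(x, y). cmod_p p (magnetic_shift A u x y - magnetic_shift A u x x) > \<delta>} (x, y)
        = ennreal (\<delta> powr p / N (x - y) powr (real CARD('n) + p)) *
          indicator {(x, y). cmod_p p (magnetic_shift A u' x y - magnetic_shift A u' x x) > \<delta>} (x, y)"
        by (simp add: magnetic_shift_def N_def indicator_def)
    qed
    then show ?thesis
      unfolding nn_integral_completion q_def
      using nn_integral_magnetic_shift[OF _ u'(1) N that, of A p] by simp
  qed
  \<comment> \<open>The one-sided limit is tested along arbitrary sequences of positive numbers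
    tending to 0, the setting in which the maximal function and the null sets were handled.\<close>
  show ?thesis
    unfolding tendsto_at_iff_sequentially
  proof (intro allI impI)
    fix d :: "nat \<Rightarrow> real"
    assume *: "\<forall>i. d i \<in> {0<..} - {0}" "d \<longlonglongrightarrow> 0"
    then have d: "0 < d k" for k by auto
    have "(\<lambda>k. \<integral>\<^sup>+w. (\<integral>\<^sup>+x. ennreal (1 / N w powr q) *
        indicator {x. d k < cmod_p p (mag_diff A u' x (d k *\<^sub>R w))} x \<partial>lborel) \<partial>lborel)
      \<longlonglongrightarrow> (\<integral>\<^sup>+x. ennreal (q / p) *
        (\<integral>\<^sup>+z\<in>{z. N z \<le> 1}. ennreal (cmod_p p (mag_deriv A u' g' x z) powr p) \<partial>lborel) \<partial>lborel)"
      by (rule scaled_tendsto[OF u'(3) g'(3) u'(1) g'(1,4) L N p q_def u_Lp energy d *(2)])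
    then show "((\<lambda>\<delta>. \<integral>\<^sup>+ y. \<integral>\<^sup>+ x. ennreal (\<delta> powr p / gauge_norm K (x - y) powr (real CARD('n) + p)) *
        indicator {(x, y). cmod_p p (magnetic_shift A u x y - magnetic_shift A u x x) > \<delta>} (x, y) \<partial>lebesgue \<partial>lebesgue) \<circ> d)
      \<longlonglongrightarrow> (\<integral>\<^sup>+ x. ennreal (polar_moment_norm p K (g x - (\<chi> j. \<i> * complex_of_real (A x $ j) * u x)) powr p) \<partial>lebesgue)"
      unfolding o_def rewrite[OF d] energy_eq[OF g'(2), unfolded magnetic_gradient_def] .
  qed
qed

end
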